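(* Let $r_c>0$. For every $\beta>0$, $\mu>0$ and every initial point $(\boldsymbol{x}_i,m_i)\in\mathcal{P}^-\times(0,\infty)$, there exists a limiting value $\tau_{\mathrm{max}}>0$, depending on $(\boldsymbol{x}_i,m_i)$, such that: 1) if $\tau>\tau_{\mathrm{max}}$, the system $\Sigma_{\mathrm{sat}}$ with thrust bound $\tau$ is controllable for the orbital insertion problem from $(\boldsymbol{x}_i,m_i)$; 2) if $0<\tau\le\tau_{\mathrm{max}}$, the system $\Sigma_{\mathrm{sat}}$ with thrust bound $\tau$ is not controllable for the orbital insertion problem from $(\boldsymbol{x}_i,m_i)$.
   Context: Let $\mu,\beta,r_c>0$ be constants and let $\|\cdot\|$ be the Euclidean norm. The system $\Sigma_{\mathrm{sat}}$ with state $(\boldsymbol{r},\boldsymbol{v},m)\in(\mathbb{R}^3\setminus\{0\})\times\mathbb{R}^3\times(0,\infty)$ is $$\dot{\boldsymbol{r}}=\boldsymbol{v},\qquad \dot{\boldsymbol{v}}=-\frac{\mu}{\|\boldsymbol{r}\|^3}\boldsymbol{r}+\frac{\boldsymbol{\tau}}{m},\qquad \dot m=-\beta\|\boldsymbol{\tau}\|,$$ with measurable control $\boldsymbol{\tau}(\cdot)$; thrust bound $\tau>0$ means that $\boldsymbol{\tau}(\cdot)$ takes values in $\mathcal{T}(\tau)=\{\boldsymbol{w}\in\mathbb{R}^3:\|\boldsymbol{w}\|\le\tau\}$. Write $\boldsymbol{x}=(\boldsymbol{r},\boldsymbol{v})$. For $\boldsymbol{x}=(\boldsymbol{r},\boldsymbol{v})$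 with $\boldsymbol{r}\ne0$ put $\boldsymbol{h}=\boldsymbol{r}\times\boldsymbol{v}$, $\boldsymbol{L}=\boldsymbol{v}\times\boldsymbol{h}-\mu\,\boldsymbol{r}/\|\boldsymbol{r}\|$, $E=\|\boldsymbol{v}\|^2/2-\mu/\|\boldsymbol{r}\|$, $e(\boldsymbol{x})=\|\boldsymbol{L}\|/\mu$. The periodic region is $\mathcal{P}=\{\boldsymbol{x}:\boldsymbol{h}\ne0,\ E<0\}$ (on which $e<1$). On $\mathcal{P}$ the perigee and apogee distances are $r_p(\boldsymbol{x})=\|\boldsymbol{h}\|^2/(\mu(1+e(\boldsymbol{x})))$ and $r_a(\boldsymbol{x})=\|\boldsymbol{h}\|^2/(\mu(1-e(\boldsymbol{x})))$. Set $\mathcal{A}=\{\boldsymbol{x}=(\boldsymbol{r},\boldsymbol{v})\in\mathcal{P}:\|\boldsymbol{r}\|>r_c\}$, $\mathcal{P}^+=\{\boldsymbol{x}\in\mathcal{P}:r_p(\boldsymbol{x})>r_c\}$ and $\mathcal{P}^-=\{\boldsymbol{x}=(\boldsymbol{r},\boldsymbol{v})\in\mathcal{P}:\|\boldsymbol{r}\|>r_c,\ r_p(\boldsymbol{x})<r_c<r_a(\boldsymbol{x})\}$. An admissible controlled trajectory on a finite interval $[0,t_f]$ is a trajectory $(\boldsymbol{x}(\cdot),m(\cdot))$ of $\Sigma_{\mathrm{sat}}$ defined on $[0,t_f]$ such that $\boldsymbol{x}(t)\in\mathcal{A}$ and $m(t)\ge M_0$ for all $t\in[0,t_f]$, for some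 $M_0>0$. For $(\boldsymbol{x}_i,m_i)\in\mathcal{P}^-\times(0,\infty)$, $\Sigma_{\mathrm{sat}}$ with thrust bound $\tau$ is controllable for the orbital insertion problem (OIP) from $(\boldsymbol{x}_i,m_i)$ if, for every $\boldsymbol{x}_f\in\mathcal{P}^+$, there exist a finite time $t_f$ and a measurable control with values in $\mathcal{T}(\tau)$ whose trajectory starting from $(\boldsymbol{x}_i,m_i)$ is an admissible controlled trajectory on $[0,t_f]$ with $\boldsymbol{x}(t_f)=\boldsymbol{x}_f$. *)

theory Defs
  imports "HOL-Analysis.Analysis"
begin

unbundle cross3_syntax

type_synonym phase = "(real^3) \<times> (real^3)"

definition ang_mom :: "phase \<Rightarrow> real^3" where
  "ang_mom x = (case x of (r, v) \<Rightarrow> r \<times> v)"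

definition laplace_vec :: "real \<Rightarrow> phase \<Rightarrow> real^3" where
  "laplace_vec \<mu> x = (case x of (r, v) \<Rightarrow> v \<times> ang_mom (r, v) - (\<mu> / norm r) *\<^sub>R r)"

definition energy :: "real \<Rightarrow> phase \<Rightarrow> real" where
  "energy \<mu> x = (case x of (r, v) \<Rightarrow> (norm v)\<^sup>2 / 2 - \<mu> / norm r)"

definition eccentricity :: "real \<Rightarrow> phase \<Rightarrow> real" where
  "eccentricity \<mu> x = norm (laplace_vec \<mu> x) / \<mu>"

definition perigee :: "real \<Rightarrow> phase \<Rightarrow> real" where
  "perigee \<mu> x = (norm (ang_mom x))\<^sup>2 / (\<mu> * (1 + eccentricity \<mu> x))"

definition apogee :: "real \<Rightarrow> phase \<Rightarrow> real" where
  "apogee \<mu> x = (norm (ang_mom x))\<^sup>2 / (\<mu> * (1 - eccentricity \<mu> x))"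

definition periodic_region :: "real \<Rightarrow> phase set" where
  "periodic_region \<mu> = {x. fst x \<noteq> 0 \<and> ang_mom x \<noteq> 0 \<and> energy \<mu> x < 0}"

definition admissible_region :: "real \<Rightarrow> real \<Rightarrow> phase set" where
  "admissible_region \<mu> r\<^sub>c = {x \<in> periodic_region \<mu>. norm (fst x) > r\<^sub>c}"

definition P_plus :: "real \<Rightarrow> real \<Rightarrow> phase set" where
  "P_plus \<mu> r\<^sub>c = {x \<in> periodic_region \<mu>. perigee \<mu> x > r\<^sub>c}"

definition P_minus :: "real \<Rightarrow> real \<Rightarrow> phase set" where
  "P_minus \<mu> r\<^sub>c = {x \<in> periodic_region \<mu>.
     norm (fst x) > r\<^sub>c \<and> perigee \<mu> x < r\<^sub>c \<and> r\<^sub>c < apogee \<mu> x}"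

definition sat_field :: "real \<Rightarrow> real \<Rightarrow> phase \<times> real \<Rightarrow> real^3 \<Rightarrow> phase \<times> real" where
  "sat_field \<mu> \<beta> y w = (case y of ((r, v), m) \<Rightarrow>
     ((v, - (\<mu> / norm r ^ 3) *\<^sub>R r + (1 / m) *\<^sub>R w), - \<beta> * norm w))"

definition control :: "real \<Rightarrow> real \<Rightarrow> (real \<Rightarrow> real^3) \<Rightarrow> bool" where
  "control \<tau> t\<^sub>f u \<longleftrightarrow>
     u \<in> borel_measurable (lebesgue_on {0..t\<^sub>f}) \<and> (\<forall>t\<in>{0..t\<^sub>f}. u t \<in> cball 0 \<tau>)"

text \<open>Since controls are only measurable, the differential equation is understood in the sense of
  Caratheodory: the state is the indefinite Lebesgue integral of the right-hand side.\<close>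

definition sat_trajectory ::
  "real \<Rightarrow> real \<Rightarrow> real \<Rightarrow> (real \<Rightarrow> real^3) \<Rightarrow> (real \<Rightarrow> phase) \<Rightarrow> (real \<Rightarrow> real) \<Rightarrow> bool" where
  "sat_trajectory \<mu> \<beta> t\<^sub>f u x m \<longleftrightarrow>
     (\<forall>t\<in>{0..t\<^sub>f}. fst (x t) \<noteq> 0 \<and> m t > 0) \<and>
     (\<lambda>s. sat_field \<mu> \<beta> (x s, m s) (u s)) absolutely_integrable_on {0..t\<^sub>f} \<and>
     (\<forall>t\<in>{0..t\<^sub>f}. (x t, m t) =
        (x 0, m 0) + integral {0..t} (\<lambda>s. sat_field \<mu> \<beta> (x s, m s) (u s)))"

definition admissible_trajectory ::
  "real \<Rightarrow> real \<Rightarrow> real \<Rightarrow> real \<Rightarrow> (real \<Rightarrow> real^3) \<Rightarrow> (real \<Rightarrow> phase) \<Rightarrow> (real \<Rightarrow> real) \<Rightarrow> bool" where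
  "admissible_trajectory \<mu> \<beta> r\<^sub>c t\<^sub>f u x m \<longleftrightarrow>
     sat_trajectory \<mu> \<beta> t\<^sub>f u x m \<and>
     (\<exists>M\<^sub>0>0. \<forall>t\<in>{0..t\<^sub>f}. x t \<in> admissible_region \<mu> r\<^sub>c \<and> m t \<ge> M\<^sub>0)"

definition OIP_controllable :: "real \<Rightarrow> real \<Rightarrow> real \<Rightarrow> real \<Rightarrow> phase \<Rightarrow> real \<Rightarrow> bool" where
  "OIP_controllable \<mu> \<beta> r\<^sub>c \<tau> x\<^sub>i m\<^sub>i \<longleftrightarrow>
     (\<forall>x\<^sub>f \<in> P_plus \<mu> r\<^sub>c. \<exists>t\<^sub>f\<ge>0. \<exists>u x m.
        control \<tau> t\<^sub>f u \<and> admissible_trajectory \<mu> \<beta> r\<^sub>c t\<^sub>f u x m \<and>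
        x 0 = x\<^sub>i \<and> m 0 = m\<^sub>i \<and> x t\<^sub>f = x\<^sub>f)"

end

theory Submission
  imports Defs
begin

text \<open>All steering is done by inverse dynamics: instead of solving the controlled equation, a path is
prescribed and the acceleration that the engine has to supply is read off
(\<open>steers_along_path\<close>). The mass obeys the rocket equation
\<open>m t = m 0 * exp (- \<beta> * \<integral> \<parallel>a\<parallel>)\<close>, so it stays positive on any finite interval, however much fuel
is spent.

Controllability does not depend on the target. A Kepler orbit of \<open>P_plus\<close> is periodic and stays in
the admissible region. Adding a small cubic polynomial correction to one revolution steers from any
point near its start to any point near its start, and the thrust needed tends to \<open>0\<close> with the
correction. Since \<open>P_plus\<close> is connected, these local transfers chain up: any two of its points are
joined with any positive thrust bound (\<open>steers_within_P_plus\<close>). Hence the insertion problem is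
solvable with bound \<open>\<tau>\<close> exactly if one point of \<open>P_plus\<close> can be reached with bound \<open>\<tau>\<close>, and the set
of good bounds is an up-set. The limiting value is its infimum, and three facts remain.

\<^item> The up-set is not empty: with a large thrust the velocity is changed to a nearly circular one while
  the position hardly moves (\<open>steers_into_P_plus\<close>).

\<^item> It is bounded away from \<open>0\<close>: with a small thrust the trajectory follows the unpowered ellipse
  through the initial point. Before its perigee the osculating perigee distance stays below \<open>r\<^sub>c\<close>,
  and at its perigee the trajectory leaves the admissible region
  (\<open>small_thrust_misses_P_plus\<close>).

\<^item> The infimum is not attained: a trajectory into \<open>P_plus\<close> can be deformed into one with a strictly
  smaller thrust bound that still ends in the open set \<open>P_plus\<close> (\<open>steers_with_less_thrust\<close>).
  The deformation cuts the acceleration \<open>a\<close> by \<open>\<kappa> t *\<^sub>R a\<close> with an exponentially growing weight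
  \<open>\<kappa> t = k * exp (K * t)\<close>. The displacement is a double integral of the cut, which the weight makes
  smaller than \<open>\<kappa> t\<close> by a factor of order \<open>1 / K\<^sup>2\<close>. For large \<open>K\<close> the resulting changes of
  gravity and of mass are negligible against the reduction of the thrust.\<close>

section \<open>Gravity and integral inequalities\<close>

text \<open>The sign is chosen so that this vector points away from the center: a free body has the acceleration
\<open>- gravity \<mu> r\<close>.\<close>
definition gravity :: "real \<Rightarrow> real^3 \<Rightarrow> real^3" where
  "gravity \<mu> r = (\<mu> / norm r ^ 3) *\<^sub>R r"

text \<open>On \<open>norm x \<ge> c\<close> the derivative of gravity has norm at most \<open>2 * \<mu> / c ^ 3\<close>, but that set is
not convex. A direct estimate gives a slightly larger constant: in the difference, the change of
\<open>x\<close> contributes once and the change of \<open>1 / norm x ^ 3\<close> three times.\<close>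
lemma gravity_lipschitz:
  fixes x y :: "real^3"
  assumes "\<mu> > 0" "c > 0" "norm x \<ge> c" "norm y \<ge> c"
  shows "norm (gravity \<mu> x - gravity \<mu> y) \<le> 4 * \<mu> / c ^ 3 * norm (x - y)"
proof -
  define p where "p = norm x"
  define q where "q = norm y"
  have p: "p \<ge> c" "p > 0" and q: "q \<ge> c" "q > 0"
    using assms by (auto simp: p_def q_def)
  have pq: "\<bar>q - p\<bar> \<le> norm (x - y)"
    unfolding p_def q_def by (metis norm_minus_commute norm_triangle_ineq3)
  have split: "gravity \<mu> x - gravity \<mu> y
      = (\<mu> / p^3) *\<^sub>R (x - y) + (\<mu> / p^3 - \<mu> / q^3) *\<^sub>R y"
    unfolding gravity_def p_def q_def by (simp add: algebra_simps)
  have cube: "q^3 - p^3 = (q - p) * (q\<^sup>2 + q * p + p\<^sup>2)"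
    by (simp add: algebra_simps power2_eq_square power3_eq_cube)
  have "\<bar>\<mu> / p^3 - \<mu> / q^3\<bar> * q = \<mu> * \<bar>q^3 - p^3\<bar> / (p^3 * q^3) * q"
    using p q assms by (simp add: divide_simps abs_mult abs_divide) (simp add: abs_mult flip: right_diff_distrib)
  also have "\<dots> = \<mu> * \<bar>q - p\<bar> * (q\<^sup>2 + q * p + p\<^sup>2) / (p^3 * q^3) * q"
    using p q by (simp add: cube abs_mult abs_of_pos add_pos_pos)
  also have "\<dots> = \<mu> * \<bar>q - p\<bar> * (1 / p^3 + 1 / (p^2 * q) + 1 / (p * q^2))"
    using p q by (simp add: field_simps eval_nat_numeral)
  also have "\<dots> \<le> \<mu> * norm (x - y) * (1 / c^3 + 1 / (c^2 * c) + 1 / (c * c^2))"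
    using p q assms pq
    by (intro mult_mono add_mono divide_left_mono power_mono mult_nonneg_nonneg mult_pos_pos add_nonneg_nonneg) auto
  also have "\<dots> = 3 * \<mu> / c^3 * norm (x - y)"
    by (simp add: power2_eq_square power3_eq_cube ac_simps)
  finally have 2: "\<bar>\<mu> / p^3 - \<mu> / q^3\<bar> * q \<le> 3 * \<mu> / c^3 * norm (x - y)" .
  have 1: "\<mu> / p^3 * norm (x - y) \<le> \<mu> / c^3 * norm (x - y)"
    using p assms by (intro mult_right_mono divide_left_mono power_mono) auto
  have "norm (gravity \<mu> x - gravity \<mu> y) \<le> \<mu> / p^3 * norm (x - y) + \<bar>\<mu> / p^3 - \<mu> / q^3\<bar> * q"
    unfolding split using p assms
    by (intro order_trans[OF norm_triangle_ineq]) (simp add: q_def)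
  also have "\<dots> \<le> \<mu> / c^3 * norm (x - y) + 3 * \<mu> / c^3 * norm (x - y)"
    using 1 2 by (rule add_mono)
  also have "\<dots> = 4 * \<mu> / c ^ 3 * norm (x - y)"
    by (simp add: field_simps)
  finally show ?thesis .
qed

lemma continuous_on_gravity [continuous_intros]:
  assumes "continuous_on S f" "\<And>x. x \<in> S \<Longrightarrow> f x \<noteq> 0"
  shows "continuous_on S (\<lambda>x. gravity \<mu> (f x))"
  unfolding gravity_def using assms by (intro continuous_intros) auto

text \<open>The right-hand side of the hypothesis times \<open>exp (- L * t)\<close> is nonincreasing.\<close>
lemma gronwall:
  fixes \<phi> :: "real \<Rightarrow> real"
  assumes cont: "continuous_on {0..T} \<phi>"
    and le: "\<And>t. t \<in> {0..T} \<Longrightarrow> \<phi> t \<le> a + L * integral {0..t} \<phi>"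
    and "L \<ge> 0" and t: "t \<in> {0..T}"
  shows "\<phi> t \<le> a * exp (L * t)"
proof -
  define J where "J = (\<lambda>t. (a + L * integral {0..t} \<phi>) * exp (- L * t))"
  have der: "(J has_real_derivative (L * \<phi> s - L * (a + L * integral {0..s} \<phi>)) * exp (- L * s))
      (at s within {0..T})" if "s \<in> {0..T}" for s
  proof -
    have "((\<lambda>u. integral {0..u} \<phi>) has_real_derivative \<phi> s) (at s within {0..T})"
      using integral_has_vector_derivative[OF cont that]
      by (simp add: has_real_derivative_iff_has_vector_derivative)
    then show ?thesis
      unfolding J_def by (auto intro!: derivative_eq_intros simp: algebra_simps)
  qed
  have "J t \<le> J 0"
  proof (rule DERIV_nonpos_imp_decreasing_open[where f = J and a = 0 and b = t])
    show "0 \<le> t" using t by auto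
    show "continuous_on {0..t} J"
      by (rule DERIV_continuous_on, rule DERIV_subset[OF der]) (use t in auto)
    show "\<exists>y. (J has_real_derivative y) (at s) \<and> y \<le> 0" if "0 < s" "s < t" for s
    proof -
      have "s \<in> {0..T}" "s \<in> interior {0..T}" using that t by auto
      then have "(J has_real_derivative (L * \<phi> s - L * (a + L * integral {0..s} \<phi>)) * exp (- L * s)) (at s)"
        using der[OF \<open>s \<in> {0..T}\<close>] at_within_interior[OF \<open>s \<in> interior {0..T}\<close>] by metis
      moreover have "(L * \<phi> s - L * (a + L * integral {0..s} \<phi>)) * exp (- L * s) \<le> 0"
        using mult_left_mono[OF le[OF \<open>s \<in> {0..T}\<close>] \<open>L \<ge> 0\<close>] by (intro mult_nonpos_nonneg) auto
      ultimately show ?thesis by blast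
    qed
  qed
  then have "(a + L * integral {0..t} \<phi>) * exp (- L * t) \<le> a" by (simp add: J_def)
  then have "a + L * integral {0..t} \<phi> \<le> a * exp (L * t)"
    by (simp add: exp_minus field_simps)
  then show ?thesis using le[OF t] by linarith
qed

lemma has_integral_Pair_iff:
  fixes f :: "real \<Rightarrow> 'a::euclidean_space" and g :: "real \<Rightarrow> 'b::euclidean_space"
  shows "((\<lambda>s. (f s, g s)) has_integral (a, b)) S \<longleftrightarrow> (f has_integral a) S \<and> (g has_integral b) S"
proof
  assume *: "((\<lambda>s. (f s, g s)) has_integral (a, b)) S"
  show "(f has_integral a) S \<and> (g has_integral b) S"
    using has_integral_linear[OF * bounded_linear_fst] has_integral_linear[OF * bounded_linear_snd]
    by (simp add: o_def)
next
  assume *: "(f has_integral a) S \<and> (g has_integral b) S"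
  have 1: "bounded_linear (\<lambda>x::'a. (x, 0::'b))"
    by (intro bounded_linear_Pair bounded_linear_ident bounded_linear_zero)
  have 2: "bounded_linear (\<lambda>x::'b. (0::'a, x))"
    by (intro bounded_linear_Pair bounded_linear_ident bounded_linear_zero)
  show "((\<lambda>s. (f s, g s)) has_integral (a, b)) S"
    using has_integral_add[OF has_integral_linear[OF conjunct1[OF *] 1] has_integral_linear[OF conjunct2[OF *] 2]]
    by (simp add: o_def)
qed

lemma bounded_measurable_integrable:
  fixes f :: "real \<Rightarrow> 'a::euclidean_space"
  assumes "f \<in> borel_measurable (lebesgue_on {0..T})"
    and "\<And>t. t \<in> {0..T} \<Longrightarrow> norm (f t) \<le> K" and "s \<ge> 0" "t \<le> T"
  shows "f integrable_on {s..t}"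
proof -
  have "f integrable_on {0..T}"
    by (rule measurable_bounded_by_integrable_imp_integrable[OF assms(1), where g = "\<lambda>_. K"])
       (use assms(2) in auto)
  then show ?thesis by (rule integrable_on_subinterval) (use assms in auto)
qed

lemma integral_bound_interval:
  fixes f :: "real \<Rightarrow> 'a::euclidean_space"
  assumes "f integrable_on {s..t}" "s \<le> t" "\<And>x. x \<in> {s..t} \<Longrightarrow> norm (f x) \<le> K"
  shows "norm (integral {s..t} f) \<le> K * (t - s)"
proof -
  have "norm (integral {s..t} f) \<le> integral {s..t} (\<lambda>_. K)"
    using assms by (intro integral_norm_bound_integral) auto
  then show ?thesis using assms(2) by (simp add: mult.commute)
qed

text \<open>This is the fundamental theorem for \<open>exp (- F)\<close>, where \<open>F\<close> is the indefinite integral of a bounded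
measurable function and so need not be differentiable everywhere. The increments of
\<open>G = exp (- F) + \<integral> f * exp (- F)\<close> turn out to be quadratically small, which makes \<open>G\<close>
differentiable with derivative \<open>0\<close> at every point.\<close>
lemma has_integral_exp_neg_integral:
  fixes f :: "real \<Rightarrow> real"
  assumes meas: "f \<in> borel_measurable (lebesgue_on {0..T})"
    and bnd: "\<And>t. t \<in> {0..T} \<Longrightarrow> 0 \<le> f t \<and> f t \<le> K"
    and t: "t \<in> {0..T}"
  defines "F \<equiv> \<lambda>t. integral {0..t} f"
  shows "((\<lambda>s. - f s * exp (- F s)) has_integral (exp (- F t) - 1)) {0..t}"
proof -
  have K: "K \<ge> 0" using bnd[OF t] by linarith
  have int_f: "f integrable_on {s..u}" if "0 \<le> s" "u \<le> T" for s u
    using bounded_measurable_integrable[OF meas, of K s u] bnd that by auto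
  have F_diff: "F u - F s = integral {s..u} f" if "0 \<le> s" "s \<le> u" "u \<le> T" for s u
    unfolding F_def using Henstock_Kurzweil_Integration.integral_combine[OF that(1,2) int_f] that by auto
  have F_mono: "0 \<le> F u - F s \<and> F u - F s \<le> K * (u - s)" if "0 \<le> s" "s \<le> u" "u \<le> T" for s u
    using F_diff[OF that] integral_bound_interval[OF int_f[of s u], of K] bnd that
    by (auto intro!: integral_nonneg int_f)
  have F0: "F 0 = 0" by (simp add: F_def)
  have contF: "continuous_on {0..T} F"
    unfolding F_def by (intro indefinite_integral_continuous_1 int_f) auto
  define g where "g = (\<lambda>s. f s * exp (- F s))"
  have int_g: "g integrable_on {s..u}" if "0 \<le> s" "u \<le> T" for s u
  proof (rule bounded_measurable_integrable)
    have "(\<lambda>s. exp (- F s)) \<in> borel_measurable (lebesgue_on {0..T})"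
      by (intro continuous_imp_measurable_on_sets_lebesgue continuous_intros contF) auto
    then show "g \<in> borel_measurable (lebesgue_on {0..T})"
      unfolding g_def using meas by measurable
    fix t assume t: "t \<in> {0..T}"
    then have "F t \<ge> 0" using F_mono[of 0 t] F0 by auto
    then have "f t * exp (- F t) \<le> K * 1" using bnd[OF t] K
      by (intro mult_mono) auto
    then show "norm (g t) \<le> K" unfolding g_def using bnd[OF t]
      by (simp add: abs_mult)
  qed (use that in auto)
  define G where "G = (\<lambda>u. exp (- F u) + integral {0..u} g)"
  \<comment> \<open>The first-order terms of the two summands of \<open>G\<close> cancel. What remains is controlled by
  \<open>1 - D \<le> exp (- D)\<close> and \<open>exp (- D) * (1 + D) \<le> 1\<close>.\<close>
  have quad: "\<bar>G u - G s\<bar> \<le> K\<^sup>2 * (u - s)\<^sup>2" if s: "0 \<le> s" "s \<le> u" "u \<le> T" for s u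
  proof -
    define D where "D = F u - F s"
    have D: "0 \<le> D" "D \<le> K * (u - s)" using F_mono[OF s] by (auto simp: D_def)
    have es: "0 < exp (- F s)" "exp (- F s) \<le> 1"
      using F_mono[of 0 s] F0 s by auto
    have "integral {0..u} g - integral {0..s} g = integral {s..u} g"
      using Henstock_Kurzweil_Integration.integral_combine[OF s(1,2) int_g] s by auto
    then have Gd: "G u - G s = exp (- F u) - exp (- F s) + integral {s..u} g"
      by (simp add: G_def)
    have eu: "exp (- F u) = exp (- F s) * exp (- D)"
      by (simp add: D_def flip: exp_add)
    have up: "integral {s..u} g \<le> exp (- F s) * D"
    proof -
      have "integral {s..u} g \<le> integral {s..u} (\<lambda>x. exp (- F s) * f x)"
      proof (rule integral_le[OF int_g])
        show "(\<lambda>x. exp (- F s) * f x) integrable_on {s..u}"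
          using int_f[of s u] s by (simp add: integrable_on_mult_right)
        fix x assume x: "x \<in> {s..u}"
        then have "F s \<le> F x" "0 \<le> f x" using F_mono[of s x] bnd[of x] s by auto
        then show "g x \<le> exp (- F s) * f x" unfolding g_def
          by (subst mult.commute) (intro mult_right_mono, auto)
      qed (use s in auto)
      also have "\<dots> = exp (- F s) * D" using F_diff[OF s] by (simp add: D_def)
      finally show ?thesis .
    qed
    have lo: "integral {s..u} g \<ge> exp (- F u) * D"
    proof -
      have "integral {s..u} g \<ge> integral {s..u} (\<lambda>x. exp (- F u) * f x)"
      proof (rule integral_le[OF _ int_g])
        show "(\<lambda>x. exp (- F u) * f x) integrable_on {s..u}"
          using int_f[of s u] s by (simp add: integrable_on_mult_right)
        fix x assume x: "x \<in> {s..u}"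
        then have "F x \<le> F u" "0 \<le> f x" using F_mono[of x u] bnd[of x] s by auto
        then show "exp (- F u) * f x \<le> g x" unfolding g_def
          by (subst mult.commute) (intro mult_left_mono, auto)
      qed (use s in auto)
      then show ?thesis using F_diff[OF s] by (simp add: D_def)
    qed
    have e1: "exp (- D) \<ge> 1 - D" using exp_ge_add_one_self[of "-D"] by simp
    have e2: "1 - exp (-D) \<ge> exp (-D) * D"
    proof -
      have "exp D \<ge> 1 + D" by (rule exp_ge_add_one_self)
      then have "exp (-D) * (1 + D) \<le> exp (-D) * exp D" by (intro mult_left_mono) auto
      then show ?thesis by (simp add: algebra_simps flip: exp_add)
    qed
    have "G u - G s \<le> exp (- F s) * (exp (- D) - 1 + D)"
      using up Gd eu by (simp add: algebra_simps)
    moreover have "exp (-D) - 1 + D \<le> D\<^sup>2"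
    proof -
      have "exp (-D) * (1 + D) \<le> 1" using e2 by (simp add: algebra_simps)
      moreover have "(1 - D + D\<^sup>2) * (1 + D) \<ge> 1"
        using D by (simp add: algebra_simps power2_eq_square)
      ultimately have "exp (-D) * (1 + D) \<le> (1 - D + D\<^sup>2) * (1 + D)" by linarith
      then show ?thesis using D by (simp add: mult_le_cancel_right)
    qed
    moreover have "exp (-D) - 1 + D \<ge> 0" using e1 by linarith
    ultimately have A: "G u - G s \<le> D\<^sup>2"
      using es by (smt (verit) mult_left_le_one_le)
    have "G u - G s \<ge> exp (- F s) * (exp (- D) - 1 + exp (-D) * D)"
      using lo Gd eu by (simp add: algebra_simps)
    moreover have "exp (- D) - 1 + exp (-D) * D \<ge> - D\<^sup>2"
    proof -
      have "exp (- D) * (1 + D) \<ge> (1 - D) * (1 + D)"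
        using e1 D by (intro mult_right_mono) auto
      then show ?thesis by (simp add: algebra_simps power2_eq_square)
    qed
    moreover have "exp (- F s) * (- D\<^sup>2) \<ge> - D\<^sup>2"
      using es mult_left_le_one_le[of "D\<^sup>2" "exp (- F s)"] by simp
    ultimately have B: "G u - G s \<ge> - D\<^sup>2"
      using mult_left_mono[of "- D\<^sup>2" "exp (- D) - 1 + exp (-D) * D" "exp (- F s)"] es by linarith
    have "D\<^sup>2 \<le> (K * (u - s))\<^sup>2" using D by (intro power_mono)
    then show ?thesis using A B by (simp add: power_mult_distrib)
  qed
  have "(G has_vector_derivative 0) (at s within {0..T})" if s: "s \<in> {0..T}" for s
    unfolding has_vector_derivative_def has_derivative_within_alt
  proof (intro conjI allI impI)
    show "bounded_linear (\<lambda>x. x *\<^sub>R (0::real))" by (simp add: bounded_linear_zero)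
    fix e :: real assume e: "e > 0"
    show "\<exists>d>0. \<forall>y\<in>{0..T}. norm (y - s) < d \<longrightarrow> norm (G y - G s - (y - s) *\<^sub>R 0) \<le> e * norm (y - s)"
    proof (intro exI conjI ballI impI)
      show "e / (K\<^sup>2 + 1) > 0" using e by (simp add: add_nonneg_pos)
      fix y assume y: "y \<in> {0..T}" "norm (y - s) < e / (K\<^sup>2 + 1)"
      have "\<bar>G y - G s\<bar> \<le> K\<^sup>2 * (y - s)\<^sup>2"
        using quad[of s y] quad[of y s] s y by (cases "s \<le> y") (auto simp: power2_commute abs_minus_commute)
      also have "\<dots> = (K\<^sup>2 * \<bar>y - s\<bar>) * \<bar>y - s\<bar>" by (simp add: power2_eq_square)
      also have "\<dots> \<le> e * \<bar>y - s\<bar>"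
      proof (rule mult_right_mono)
        have "K\<^sup>2 * \<bar>y - s\<bar> \<le> (K\<^sup>2 + 1) * (e / (K\<^sup>2 + 1))" using y
          by (intro mult_mono) auto
        also have "\<dots> = e" by (simp add: add_nonneg_pos less_imp_neq[symmetric])
        finally show "K\<^sup>2 * \<bar>y - s\<bar> \<le> e" .
      qed simp
      finally show "norm (G y - G s - (y - s) *\<^sub>R 0) \<le> e * norm (y - s)" by simp
    qed
  qed
  then obtain c where c: "\<And>s. s \<in> {0..T} \<Longrightarrow> G s = c"
    using has_vector_derivative_zero_constant[of "{0..T}" G] convex_real_interval by metis
  have "G t = G 0" using c[OF t] c[of 0] t by auto
  then have "exp (- F t) + integral {0..t} g = 1" by (simp add: G_def F0)
  then have eq: "- integral {0..t} g = exp (- F t) - 1" by simp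
  have "(g has_integral integral {0..t} g) {0..t}"
    using int_g[of 0 t] t by auto
  then have "((\<lambda>s. - g s) has_integral (exp (- F t) - 1)) {0..t}"
    unfolding eq[symmetric] by (rule has_integral_neg)
  then show ?thesis by (simp add: g_def)
qed

section \<open>Steering and inverse dynamics\<close>

text \<open>Negative energy bounds the speed in terms of the distance; these bounds make the vector field bounded
along admissible trajectories.\<close>
lemma admissible_bounds:
  assumes "\<mu> > 0" "r\<^sub>c > 0" "(r, v) \<in> admissible_region \<mu> r\<^sub>c"
  shows "norm r > r\<^sub>c" "r \<noteq> 0" "norm v \<le> sqrt (2 * \<mu> / r\<^sub>c)" "norm (gravity \<mu> r) \<le> \<mu> / r\<^sub>c\<^sup>2"
proof -
  have r: "norm r > r\<^sub>c" and E: "(norm v)\<^sup>2 / 2 - \<mu> / norm r < 0"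
    using assms(3) by (auto simp: admissible_region_def periodic_region_def energy_def)
  then show "norm r > r\<^sub>c" "r \<noteq> 0" using assms(2) by auto
  have "\<mu> / norm r \<le> \<mu> / r\<^sub>c" using r assms by (intro divide_left_mono mult_pos_pos) auto
  then have "(norm v)\<^sup>2 / 2 \<le> \<mu> / r\<^sub>c" using E by linarith
  then have "(norm v)\<^sup>2 \<le> 2 * (\<mu> / r\<^sub>c)" by linarith
  then have "(norm v)\<^sup>2 \<le> 2 * \<mu> / r\<^sub>c" by (simp only: times_divide_eq_right)
  then show "norm v \<le> sqrt (2 * \<mu> / r\<^sub>c)" by (rule real_le_rsqrt)
  have "norm (gravity \<mu> r) = \<mu> / (norm r)\<^sup>2"
    using r assms by (simp add: gravity_def field_simps eval_nat_numeral)
  also have "\<dots> \<le> \<mu> / r\<^sub>c\<^sup>2" using r assms by (intro divide_left_mono power_mono mult_pos_pos zero_less_power) auto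
  finally show "norm (gravity \<mu> r) \<le> \<mu> / r\<^sub>c\<^sup>2" .
qed

lemma sat_field_eq:
  "sat_field \<mu> \<beta> ((r, v), m) w = ((v, (1 / m) *\<^sub>R w - gravity \<mu> r), - \<beta> * norm w)"
  by (simp add: sat_field_def gravity_def)

text \<open>On the admissible region with the mass bounded below the field is bounded, so that absolute
integrability is automatic and the integral equation alone describes a trajectory.\<close>
lemma admissible_trajectory_iff:
  assumes pos: "\<mu> > 0" "\<beta> > 0" "r\<^sub>c > 0" "T \<ge> 0" and u: "control \<tau> T u"
  shows "admissible_trajectory \<mu> \<beta> r\<^sub>c T u x m \<longleftrightarrow>
    (\<exists>M\<^sub>0>0. \<forall>t\<in>{0..T}. x t \<in> admissible_region \<mu> r\<^sub>c \<and> m t \<ge> M\<^sub>0) \<and>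
    (\<forall>t\<in>{0..T}. ((\<lambda>s. sat_field \<mu> \<beta> (x s, m s) (u s)) has_integral ((x t, m t) - (x 0, m 0))) {0..t})"
    (is "?L \<longleftrightarrow> ?A \<and> ?I")
proof
  assume ?L
  then have A: ?A and int: "(\<lambda>s. sat_field \<mu> \<beta> (x s, m s) (u s)) absolutely_integrable_on {0..T}"
    and eq: "\<And>t. t \<in> {0..T} \<Longrightarrow> (x t, m t) =
        (x 0, m 0) + integral {0..t} (\<lambda>s. sat_field \<mu> \<beta> (x s, m s) (u s))"
    unfolding admissible_trajectory_def sat_trajectory_def by blast+
  have ?I
  proof
    fix t assume t: "t \<in> {0..T}"
    have "(\<lambda>s. sat_field \<mu> \<beta> (x s, m s) (u s)) integrable_on {0..t}"
      by (rule integrable_on_subinterval[OF set_lebesgue_integral_eq_integral(1)[OF int]]) (use t in auto)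
    then show "((\<lambda>s. sat_field \<mu> \<beta> (x s, m s) (u s)) has_integral ((x t, m t) - (x 0, m 0))) {0..t}"
      unfolding eq[OF t] by (simp add: has_integral_integral)
  qed
  with A show "?A \<and> ?I" by blast
next
  assume R: "?A \<and> ?I"
  then obtain M where M: "M > 0" "\<And>t. t \<in> {0..T} \<Longrightarrow> x t \<in> admissible_region \<mu> r\<^sub>c \<and> m t \<ge> M"
    by blast
  have u\<tau>: "norm (u t) \<le> \<tau>" if "t \<in> {0..T}" for t
    using u that by (auto simp: control_def)
  have bound: "norm (sat_field \<mu> \<beta> (x t, m t) (u t)) \<le>
      sqrt (2 * \<mu> / r\<^sub>c) + (\<tau> / M + \<mu> / r\<^sub>c\<^sup>2) + \<beta> * \<tau>" if t: "t \<in> {0..T}" for t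
  proof -
    obtain r v where x: "x t = (r, v)" by fastforce
    have adm: "(r, v) \<in> admissible_region \<mu> r\<^sub>c" using M(2)[OF t] x by simp
    note b = admissible_bounds[OF \<open>\<mu> > 0\<close> \<open>r\<^sub>c > 0\<close> adm]
    have "norm ((1 / m t) *\<^sub>R u t) \<le> \<tau> / M"
      using u\<tau>[OF t] M(1) M(2)[OF t] order_trans[OF norm_ge_zero u\<tau>[OF t]]
      by (auto intro!: frac_le)
    then have "norm ((1 / m t) *\<^sub>R u t - gravity \<mu> r) \<le> \<tau> / M + \<mu> / r\<^sub>c\<^sup>2"
      using b(4) by (intro order_trans[OF norm_triangle_ineq4]) auto
    moreover have "norm (- \<beta> * norm (u t)) \<le> \<beta> * \<tau>" using u\<tau>[OF t] pos by (simp add: abs_mult)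
    ultimately show ?thesis unfolding x sat_field_eq using b(3)
      by (intro order_trans[OF norm_Pair_le] add_mono) auto
  qed
  have "(\<lambda>s. sat_field \<mu> \<beta> (x s, m s) (u s)) integrable_on {0..T}"
    using R \<open>T \<ge> 0\<close> has_integral_integrable[where i = "(x T, m T) - (x 0, m 0)" and s = "{0..T}"]
    by (meson atLeastAtMost_iff order_refl)
  then have "(\<lambda>s. sat_field \<mu> \<beta> (x s, m s) (u s)) absolutely_integrable_on {0..T}"
    by (intro absolutely_integrable_integrable_bound[OF bound] integrable_const_ivl)
  moreover have "fst (x t) \<noteq> 0 \<and> m t > 0" if "t \<in> {0..T}" for t
    using M(1) M(2)[OF that] by (auto simp: admissible_region_def periodic_region_def)
  moreover have "(x t, m t) = (x 0, m 0) + integral {0..t} (\<lambda>s. sat_field \<mu> \<beta> (x s, m s) (u s))"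
    if "t \<in> {0..T}" for t
    unfolding integral_unique[OF bspec[OF conjunct2[OF R] that]] by simp
  ultimately have "sat_trajectory \<mu> \<beta> T u x m" unfolding sat_trajectory_def by blast
  then show ?L using conjunct1[OF R] unfolding admissible_trajectory_def by blast
qed

text \<open>The duration is hidden and the mass belongs to the state, so that \<open>steers\<close> is a transitive relation
(\<open>steers_trans\<close>).\<close>
definition steers :: "real \<Rightarrow> real \<Rightarrow> real \<Rightarrow> real \<Rightarrow> phase \<times> real \<Rightarrow> phase \<times> real \<Rightarrow> bool" where
  "steers \<mu> \<beta> r\<^sub>c \<tau> p q \<longleftrightarrow> (\<exists>T\<ge>0. \<exists>u x m. control \<tau> T u \<and>
     admissible_trajectory \<mu> \<beta> r\<^sub>c T u x m \<and> (x 0, m 0) = p \<and> (x T, m T) = q)"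

lemma OIP_controllable_iff_steers:
  "OIP_controllable \<mu> \<beta> r\<^sub>c \<tau> x\<^sub>i m\<^sub>i \<longleftrightarrow>
     (\<forall>x\<^sub>f\<in>P_plus \<mu> r\<^sub>c. \<exists>m\<^sub>f. steers \<mu> \<beta> r\<^sub>c \<tau> (x\<^sub>i, m\<^sub>i) (x\<^sub>f, m\<^sub>f))"
  unfolding OIP_controllable_def steers_def prod.inject by blast

lemma steers_mono:
  assumes "steers \<mu> \<beta> r\<^sub>c \<tau> p q" "\<tau> \<le> \<tau>'"
  shows "steers \<mu> \<beta> r\<^sub>c \<tau>' p q"
proof -
  have "control \<tau> T u \<Longrightarrow> control \<tau>' T u" for T u
    using assms(2) by (force simp: control_def)
  then show ?thesis using assms(1) unfolding steers_def by blast
qed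

lemma has_integral_shift:
  fixes f :: "real \<Rightarrow> 'a::euclidean_space"
  assumes "(f has_integral i) {0..b}"
  shows "((\<lambda>s. f (s - c)) has_integral i) {c..b + c}"
  using has_integral_affinity'[of f i 0 b 1 "-c"] assms by simp

lemma has_integral_concat:
  fixes f g :: "real \<Rightarrow> 'a::euclidean_space"
  assumes "a \<ge> 0" "b \<ge> 0" "(f has_integral i) {0..a}" "(g has_integral j) {0..b}"
  shows "((\<lambda>s. if s \<le> a then f s else g (s - a)) has_integral i + j) {0..b + a}"
proof (rule has_integral_combine[where c = a])
  show "((\<lambda>s. if s \<le> a then f s else g (s - a)) has_integral i) {0..a}"
    by (rule has_integral_eq[OF _ assms(3)]) auto
  show "((\<lambda>s. if s \<le> a then f s else g (s - a)) has_integral j) {a..b + a}"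
    by (rule has_integral_spike_finite[OF _ _ has_integral_shift[OF assms(4)], of "{a}"]) auto
qed (use assms in auto)

lemma control_concat:
  assumes "control \<tau> a u" "control \<tau> b w" "a \<ge> 0" "b \<ge> 0"
  shows "control \<tau> (b + a) (\<lambda>s. if s \<le> a then u s else w (s - a))"
proof -
  have "u integrable_on {0..a}" "w integrable_on {0..b}"
    using assms bounded_measurable_integrable[of u a \<tau> 0 a] bounded_measurable_integrable[of w b \<tau> 0 b]
    by (auto simp: control_def)
  then have "(\<lambda>s. if s \<le> a then u s else w (s - a)) integrable_on {0..b + a}"
    using has_integral_concat[OF assms(3,4)] unfolding integrable_on_def by blast
  then have "(\<lambda>s. if s \<le> a then u s else w (s - a)) \<in> borel_measurable (lebesgue_on {0..b + a})"
    by (rule integrable_imp_measurable)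
  then show ?thesis using assms by (auto simp: control_def)
qed

lemma steers_trans:
  assumes pos: "\<mu> > 0" "\<beta> > 0" "r\<^sub>c > 0"
    and pq: "steers \<mu> \<beta> r\<^sub>c \<tau> p q" and qs: "steers \<mu> \<beta> r\<^sub>c \<tau> q s"
  shows "steers \<mu> \<beta> r\<^sub>c \<tau> p s"
proof -
  obtain a u x m where a: "a \<ge> 0" "control \<tau> a u" "admissible_trajectory \<mu> \<beta> r\<^sub>c a u x m"
    "(x 0, m 0) = p" "(x a, m a) = q" using pq unfolding steers_def by blast
  obtain b w y n where b: "b \<ge> 0" "control \<tau> b w" "admissible_trajectory \<mu> \<beta> r\<^sub>c b w y n"
    "(y 0, n 0) = q" "(y b, n b) = s" using qs unfolding steers_def by blast
  note ia = a(3)[unfolded admissible_trajectory_iff[OF pos a(1,2)]]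
  note ib = b(3)[unfolded admissible_trajectory_iff[OF pos b(1,2)]]
  obtain M where M: "M > 0" "\<And>t. t \<in> {0..a} \<Longrightarrow> x t \<in> admissible_region \<mu> r\<^sub>c \<and> m t \<ge> M"
    using ia by blast
  obtain N where N: "N > 0" "\<And>t. t \<in> {0..b} \<Longrightarrow> y t \<in> admissible_region \<mu> r\<^sub>c \<and> n t \<ge> N"
    using ib by blast
  define U where "U = (\<lambda>s. if s \<le> a then u s else w (s - a))"
  define X where "X = (\<lambda>s. if s \<le> a then x s else y (s - a))"
  define Z where "Z = (\<lambda>s. if s \<le> a then m s else n (s - a))"
  have U: "control \<tau> (b + a) U" unfolding U_def by (rule control_concat) (use a b in auto)
  have field: "sat_field \<mu> \<beta> (X s, Z s) (U s) = (if s \<le> a then sat_field \<mu> \<beta> (x s, m s) (u s)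
      else sat_field \<mu> \<beta> (y (s - a), n (s - a)) (w (s - a)))" for s
    by (simp add: X_def Z_def U_def)
  have "((\<lambda>s. sat_field \<mu> \<beta> (X s, Z s) (U s)) has_integral ((X t, Z t) - (X 0, Z 0))) {0..t}"
    if t: "t \<in> {0..b + a}" for t
  proof (cases "t \<le> a")
    case True
    then have "((\<lambda>s. sat_field \<mu> \<beta> (x s, m s) (u s)) has_integral ((X t, Z t) - (X 0, Z 0))) {0..t}"
      using ia t a(1) by (auto simp: X_def Z_def)
    then show ?thesis by (rule has_integral_eq[rotated]) (use True in \<open>auto simp: field\<close>)
  next
    case False
    have 1: "((\<lambda>s. sat_field \<mu> \<beta> (x s, m s) (u s)) has_integral (q - p)) {0..a}"
      using ia a by force
    have 2: "((\<lambda>s. sat_field \<mu> \<beta> (y s, n s) (w s)) has_integral ((X t, Z t) - q)) {0..t - a}"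
      using ib b(4) False t by (auto simp: X_def Z_def)
    have eq: "(q - p) + ((X t, Z t) - q) = (X t, Z t) - (X 0, Z 0)"
      using a by (simp add: X_def Z_def)
    show ?thesis
      using has_integral_concat[OF a(1) _ 1 2] False unfolding field eq by simp
  qed
  moreover have "\<forall>t\<in>{0..b + a}. X t \<in> admissible_region \<mu> r\<^sub>c \<and> Z t \<ge> min M N"
  proof
    fix t assume t: "t \<in> {0..b + a}"
    show "X t \<in> admissible_region \<mu> r\<^sub>c \<and> Z t \<ge> min M N"
      using M(2)[of t] N(2)[of "t - a"] t by (cases "t \<le> a") (auto simp: X_def Z_def min_le_iff_disj)
  qed
  ultimately have "admissible_trajectory \<mu> \<beta> r\<^sub>c (b + a) U X Z"
    using M(1) N(1) a b
    by (subst admissible_trajectory_iff[OF pos _ U]) (auto intro!: exI[of _ "min M N"])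
  moreover have "(X 0, Z 0) = p" using a by (simp add: X_def Z_def)
  moreover have "(X (b + a), Z (b + a)) = s"
    using a b by (cases "b = 0") (auto simp: X_def Z_def)
  ultimately show ?thesis
    unfolding steers_def using U a(1) b(1) by (intro exI[of _ "b + a"]) auto
qed

text \<open>The thrust \<open>m t *\<^sub>R a t\<close> realizes the acceleration \<open>a\<close>, where the mass is determined by \<open>a\<close> through the
rocket equation. No differential equation has to be solved.\<close>
lemma steers_along_path:
  fixes r v a :: "real \<Rightarrow> real^3"
  assumes pos: "\<mu> > 0" "\<beta> > 0" "r\<^sub>c > 0" "m\<^sub>0 > 0" and T: "T \<ge> 0"
    and meas: "a \<in> borel_measurable (lebesgue_on {0..T})"
    and bnd: "\<And>t. t \<in> {0..T} \<Longrightarrow> norm (a t) \<le> K"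
    and r: "\<And>t. t \<in> {0..T} \<Longrightarrow> (v has_integral (r t - r 0)) {0..t}"
    and v: "\<And>t. t \<in> {0..T} \<Longrightarrow> ((\<lambda>s. a s - gravity \<mu> (r s)) has_integral (v t - v 0)) {0..t}"
    and adm: "\<And>t. t \<in> {0..T} \<Longrightarrow> (r t, v t) \<in> admissible_region \<mu> r\<^sub>c"
    and thrust: "\<And>t. t \<in> {0..T} \<Longrightarrow>
      m\<^sub>0 * exp (- (\<beta> * integral {0..t} (\<lambda>s. norm (a s)))) * norm (a t) \<le> \<tau>"
  shows "\<exists>m. 0 < m \<and> m \<le> m\<^sub>0 \<and> steers \<mu> \<beta> r\<^sub>c \<tau> ((r 0, v 0), m\<^sub>0) ((r T, v T), m)"
proof -
  define f where "f = (\<lambda>s. \<beta> * norm (a s))"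
  define m where "m = (\<lambda>t. m\<^sub>0 * exp (- integral {0..t} f))"
  define u where "u = (\<lambda>t. m t *\<^sub>R a t)"
  have f_int: "integral {0..t} f = \<beta> * integral {0..t} (\<lambda>s. norm (a s))" for t
    by (simp add: f_def)
  have m_pos: "m t > 0" for t using pos by (simp add: m_def)
  have f_meas: "f \<in> borel_measurable (lebesgue_on {0..T})"
    unfolding f_def using meas by measurable
  have f_bnd: "0 \<le> f t \<and> f t \<le> \<beta> * K" if "t \<in> {0..T}" for t
    using bnd[OF that] pos by (simp add: f_def)
  have f_int_bnd: "0 \<le> integral {0..t} f \<and> integral {0..t} f \<le> integral {0..T} f" if t: "t \<in> {0..T}" for t
  proof -
    have i: "f integrable_on {s..w}" if "0 \<le> s" "w \<le> T" for s w
      by (rule bounded_measurable_integrable[OF f_meas, of "\<beta> * K"]) (use f_bnd that in auto)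
    show ?thesis using t f_bnd
      by (auto intro!: integral_nonneg integral_subset_le i)
  qed
  have u_norm: "norm (u t) = m t * norm (a t)" for t
    using m_pos[of t] by (simp add: u_def)
  have m_int: "((\<lambda>s. - \<beta> * norm (u s)) has_integral (m t - m 0)) {0..t}" if t: "t \<in> {0..T}" for t
  proof -
    have "((\<lambda>s. m\<^sub>0 * (- f s * exp (- integral {0..s} f))) has_integral (m\<^sub>0 * (exp (- integral {0..t} f) - 1))) {0..t}"
      by (intro has_integral_mult_right has_integral_exp_neg_integral[OF f_meas f_bnd t])
    moreover have "m\<^sub>0 * (exp (- integral {0..t} f) - 1) = m t - m 0"
      by (simp add: m_def algebra_simps)
    moreover have "(\<lambda>s. m\<^sub>0 * (- f s * exp (- integral {0..s} f))) = (\<lambda>s. - \<beta> * norm (u s))"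
      unfolding u_norm by (auto simp: f_def m_def)
    ultimately show ?thesis by simp
  qed
  have ctrl: "control \<tau> T u"
    unfolding control_def
  proof (intro conjI ballI)
    have "continuous_on {0..T} (\<lambda>t. integral {0..t} f)"
      by (intro indefinite_integral_continuous_1 bounded_measurable_integrable[OF f_meas, of "\<beta> * K"])
         (use f_bnd T in auto)
    then have "m \<in> borel_measurable (lebesgue_on {0..T})"
      unfolding m_def
      by (intro continuous_imp_measurable_on_sets_lebesgue continuous_intros) auto
    then show "u \<in> borel_measurable (lebesgue_on {0..T})"
      unfolding u_def using meas by measurable
    fix t assume "t \<in> {0..T}"
    then show "u t \<in> cball 0 \<tau>" using thrust u_norm by (simp add: m_def f_int)
  qed
  have "admissible_trajectory \<mu> \<beta> r\<^sub>c T u (\<lambda>t. (r t, v t)) m"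
    unfolding admissible_trajectory_iff[OF pos(1-3) T ctrl]
  proof (intro conjI ballI)
    show "\<exists>M\<^sub>0>0. \<forall>t\<in>{0..T}. (r t, v t) \<in> admissible_region \<mu> r\<^sub>c \<and> M\<^sub>0 \<le> m t"
      using adm m_pos[of T] f_int_bnd pos by (intro exI[of _ "m T"]) (auto simp: m_def)
    fix t assume t: "t \<in> {0..T}"
    have "sat_field \<mu> \<beta> ((r s, v s), m s) (u s) = ((v s, a s - gravity \<mu> (r s)), - \<beta> * norm (u s))" for s
      using m_pos[of s] by (simp add: sat_field_eq u_def)
    then show "((\<lambda>s. sat_field \<mu> \<beta> ((r s, v s), m s) (u s)) has_integral ((r t, v t), m t) - ((r 0, v 0), m 0)) {0..t}"
      using r[OF t] v[OF t] m_int[OF t] by (simp add: has_integral_Pair_iff)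
  qed
  moreover have "m 0 = m\<^sub>0" by (simp add: m_def)
  moreover have "0 < m T" "m T \<le> m\<^sub>0" using m_pos f_int_bnd[of T] T pos by (auto simp: m_def)
  ultimately show ?thesis unfolding steers_def using T ctrl by blast
qed

text \<open>Along a twice differentiable path the engine must supply the acceleration of the path minus the
gravitational one. The mass only decreases, so that a bound with the initial mass suffices.\<close>
lemma steers_along_smooth_path:
  fixes r v w :: "real \<Rightarrow> real^3"
  assumes pos: "\<mu> > 0" "\<beta> > 0" "r\<^sub>c > 0" "m\<^sub>0 > 0" and T: "T \<ge> 0"
    and r: "\<And>t. t \<in> {0..T} \<Longrightarrow> (r has_vector_derivative v t) (at t)"
    and v: "\<And>t. t \<in> {0..T} \<Longrightarrow> (v has_vector_derivative w t) (at t)"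
    and w: "continuous_on {0..T} w"
    and adm: "\<And>t. t \<in> {0..T} \<Longrightarrow> (r t, v t) \<in> admissible_region \<mu> r\<^sub>c"
    and thrust: "\<And>t. t \<in> {0..T} \<Longrightarrow> m\<^sub>0 * norm (w t + gravity \<mu> (r t)) \<le> \<tau>"
  shows "\<exists>m. 0 < m \<and> m \<le> m\<^sub>0 \<and> steers \<mu> \<beta> r\<^sub>c \<tau> ((r 0, v 0), m\<^sub>0) ((r T, v T), m)"
proof (rule steers_along_path[OF pos T, where a = "\<lambda>t. w t + gravity \<mu> (r t)" and K = "\<tau> / m\<^sub>0"])
  have rc: "continuous_on {0..T} r"
    using r by (meson has_vector_derivative_continuous continuous_at_imp_continuous_on)
  have nz: "r t \<noteq> 0" if "t \<in> {0..T}" for t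
    using adm[OF that] by (auto simp: admissible_region_def periodic_region_def)
  have ac: "continuous_on {0..T} (\<lambda>t. w t + gravity \<mu> (r t))"
    using nz by (intro continuous_intros w rc) auto
  then show "(\<lambda>t. w t + gravity \<mu> (r t)) \<in> borel_measurable (lebesgue_on {0..T})"
    by (rule continuous_imp_measurable_on_sets_lebesgue) auto
  fix t assume t: "t \<in> {0..T}"
  show "norm (w t + gravity \<mu> (r t)) \<le> \<tau> / m\<^sub>0"
    using thrust[OF t] pos by (simp add: field_simps)
  show "(v has_integral (r t - r 0)) {0..t}"
    by (rule fundamental_theorem_of_calculus) (use t r in \<open>auto intro: has_vector_derivative_at_within\<close>)
  show "((\<lambda>s. w s + gravity \<mu> (r s) - gravity \<mu> (r s)) has_integral (v t - v 0)) {0..t}"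
    unfolding add_diff_cancel_right'
    by (rule fundamental_theorem_of_calculus) (use t v in \<open>auto intro: has_vector_derivative_at_within\<close>)
  show "(r t, v t) \<in> admissible_region \<mu> r\<^sub>c" by (rule adm[OF t])
  have int: "(\<lambda>s. norm (w s + gravity \<mu> (r s))) integrable_on {0..t}"
    using t by (intro integrable_continuous_real continuous_on_norm continuous_on_subset[OF ac]) auto
  have "exp (- (\<beta> * integral {0..t} (\<lambda>s. norm (w s + gravity \<mu> (r s))))) \<le> 1"
    using pos integral_nonneg[OF int] by auto
  then have "m\<^sub>0 * exp (- (\<beta> * integral {0..t} (\<lambda>s. norm (w s + gravity \<mu> (r s))))) * norm (w t + gravity \<mu> (r t))
     \<le> m\<^sub>0 * 1 * norm (w t + gravity \<mu> (r t))"
    using pos by (intro mult_right_mono mult_left_mono) auto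
  then show "m\<^sub>0 * exp (- (\<beta> * integral {0..t} (\<lambda>s. norm (w s + gravity \<mu> (r s))))) * norm (w t + gravity \<mu> (r t)) \<le> \<tau>"
    using thrust[OF t] by simp
qed

section \<open>Elliptic Kepler motion\<close>

text \<open>Motion in the field of gravity with negative energy is explicit in the fictitious time \<open>s\<close> with
\<open>dt = \<rho> ds\<close>, where \<open>\<rho>\<close> is the distance to the center of attraction: in this parameter the equation
of motion becomes a harmonic oscillator with frequency \<open>\<omega>\<close>, where \<open>\<omega>\<^sup>2\<close> is minus twice the energy.
Unlike the parametrization by the eccentric anomaly measured from perigee, this form has no
degenerate case for circular orbits. In the notation below \<open>a\<close> is the semi-major axis and
\<open>center\<close> the center of the ellipse; \<open>p\<close> and \<open>q\<close> are the Fourier coefficients of the distance.\<close>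
locale kepler_data =
  fixes \<mu> :: real and r\<^sub>0 v\<^sub>0 :: "real^3"
  assumes mu: "\<mu> > 0" and per: "(r\<^sub>0, v\<^sub>0) \<in> periodic_region \<mu>"
begin

definition "\<rho>\<^sub>0 = norm r\<^sub>0"
definition "w\<^sub>0 = r\<^sub>0 \<bullet> v\<^sub>0"
definition "W = 2 * \<mu> / \<rho>\<^sub>0 - v\<^sub>0 \<bullet> v\<^sub>0"
definition "\<omega> = sqrt W"
definition "a = \<mu> / W"
definition "p = \<rho>\<^sub>0 - a"
definition "q = w\<^sub>0 / \<omega>"
definition "center = (1 - a / \<rho>\<^sub>0) *\<^sub>R r\<^sub>0 + (w\<^sub>0 / W) *\<^sub>R v\<^sub>0"
definition "A = (a / \<rho>\<^sub>0) *\<^sub>R r\<^sub>0 - (w\<^sub>0 / W) *\<^sub>R v\<^sub>0"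
definition "B = (\<rho>\<^sub>0 / \<omega>) *\<^sub>R v\<^sub>0"
definition "\<rho> s = a + p * cos (\<omega> * s) + q * sin (\<omega> * s)"
definition "\<rho>' s = \<omega> * (q * cos (\<omega> * s) - p * sin (\<omega> * s))"
definition "X s = center + cos (\<omega> * s) *\<^sub>R A + sin (\<omega> * s) *\<^sub>R B"
definition "X' s = \<omega> *\<^sub>R (cos (\<omega> * s) *\<^sub>R B - sin (\<omega> * s) *\<^sub>R A)"
definition "time s = a * s + p / \<omega> * sin (\<omega> * s) + q / \<omega> * (1 - cos (\<omega> * s))"

lemma elements_pos: "\<rho>\<^sub>0 > 0" "W > 0" "\<omega> > 0" "a > 0"
proof -
  show rho: "\<rho>\<^sub>0 > 0" using per by (auto simp: periodic_region_def \<rho>\<^sub>0_def)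
  show W: "W > 0" using per rho
    by (simp add: periodic_region_def energy_def W_def \<rho>\<^sub>0_def power2_norm_eq_inner mult.commute)
  show "\<omega> > 0" "a > 0" using W mu by (auto simp: \<omega>_def a_def)
qed

lemma omega_sq: "\<omega>\<^sup>2 = W" "\<omega> * \<omega> = W"
  using elements_pos by (simp_all add: \<omega>_def)

lemma speed_sq: "v\<^sub>0 \<bullet> v\<^sub>0 = 2 * a * W / \<rho>\<^sub>0 - W" and mu_eq: "a * W = \<mu>"
  using elements_pos by (simp_all add: W_def a_def)

lemma radius_sq: "r\<^sub>0 \<bullet> r\<^sub>0 = \<rho>\<^sub>0\<^sup>2" by (simp add: \<rho>\<^sub>0_def power2_norm_eq_inner)

text \<open>The square of the semi-minor axis; it is positive because the angular momentum does not vanish.\<close>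
definition "minor = 2 * a * \<rho>\<^sub>0 - \<rho>\<^sub>0\<^sup>2 - w\<^sub>0\<^sup>2 / W"

lemma q_sq: "q\<^sup>2 = w\<^sub>0\<^sup>2 / W" by (simp add: q_def power_divide omega_sq)

lemma minor_alt: "minor = a\<^sup>2 - (p\<^sup>2 + q\<^sup>2)"
  unfolding minor_def q_sq p_def by (simp add: power2_eq_square algebra_simps)

lemma minor_pos: "minor > 0"
proof -
  have "ang_mom (r\<^sub>0, v\<^sub>0) \<noteq> 0" using per by (simp add: periodic_region_def)
  then have "0 < (norm (r\<^sub>0 \<times> v\<^sub>0))\<^sup>2" by (simp add: ang_mom_def)
  also have "\<dots> = \<rho>\<^sub>0\<^sup>2 * (2 * a * W / \<rho>\<^sub>0 - W) - w\<^sub>0\<^sup>2"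
    unfolding norm_cross w\<^sub>0_def by (simp add: power2_norm_eq_inner speed_sq radius_sq)
  also have "\<dots> = W * minor"
    using elements_pos by (simp add: minor_def field_simps power2_eq_square)
  finally show ?thesis using elements_pos by (simp add: zero_less_mult_iff)
qed

text \<open>This relation places the center of attraction at a focus of the ellipse. The remaining scalar
products of the elements follow from it and from the three products of \<open>A\<close> and \<open>B\<close>.\<close>
lemma focal: "a *\<^sub>R center = p *\<^sub>R A + q *\<^sub>R B"
proof -
  have 1: "a * (1 - a / \<rho>\<^sub>0) = p * (a / \<rho>\<^sub>0)" using elements_pos by (simp add: p_def field_simps)
  have 2: "a * (w\<^sub>0 / W) = - p * (w\<^sub>0 / W) + q * (\<rho>\<^sub>0 / \<omega>)"
    using elements_pos omega_sq by (simp add: p_def q_def field_simps)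
  have "p *\<^sub>R A + q *\<^sub>R B = (p * (a / \<rho>\<^sub>0)) *\<^sub>R r\<^sub>0 + (- p * (w\<^sub>0 / W) + q * (\<rho>\<^sub>0 / \<omega>)) *\<^sub>R v\<^sub>0"
    by (simp add: A_def B_def algebra_simps)
  also have "\<dots> = a *\<^sub>R center"
    unfolding 1[symmetric] 2[symmetric] by (simp add: center_def algebra_simps)
  finally show ?thesis by simp
qed

lemma A_sq: "A \<bullet> A = p\<^sup>2 + minor" and B_sq: "B \<bullet> B = q\<^sup>2 + minor" and A_B: "A \<bullet> B = p * q"
proof -
  have "A \<bullet> A = (a / \<rho>\<^sub>0)\<^sup>2 * (r\<^sub>0 \<bullet> r\<^sub>0) - 2 * (a / \<rho>\<^sub>0) * (w\<^sub>0 / W) * w\<^sub>0 + (w\<^sub>0 / W)\<^sup>2 * (v\<^sub>0 \<bullet> v\<^sub>0)"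
    by (simp add: A_def inner_diff_left inner_diff_right w\<^sub>0_def inner_commute power2_eq_square algebra_simps)
  also have "\<dots> = a\<^sup>2 - w\<^sub>0\<^sup>2 / W"
    unfolding speed_sq radius_sq using elements_pos by (simp add: field_simps power2_eq_square)
  finally show "A \<bullet> A = p\<^sup>2 + minor" by (simp add: minor_alt q_sq)
  have "B \<bullet> B = \<rho>\<^sub>0\<^sup>2 / W * (v\<^sub>0 \<bullet> v\<^sub>0)"
    using omega_sq by (simp add: B_def power2_eq_square)
  also have "\<dots> = 2 * a * \<rho>\<^sub>0 - \<rho>\<^sub>0\<^sup>2"
    unfolding speed_sq using elements_pos by (simp add: field_simps power2_eq_square)
  finally show "B \<bullet> B = q\<^sup>2 + minor" by (simp add: minor_def q_sq)
  have "A \<bullet> B = \<rho>\<^sub>0 / \<omega> * (a / \<rho>\<^sub>0 * w\<^sub>0 - w\<^sub>0 / W * (v\<^sub>0 \<bullet> v\<^sub>0))"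
    by (simp add: A_def B_def inner_diff_left w\<^sub>0_def)
  also have "\<dots> = p * q"
    unfolding speed_sq p_def q_def using elements_pos by (simp add: field_simps)
  finally show "A \<bullet> B = p * q" .
qed

lemma center_A: "center \<bullet> A = a * p" and center_B: "center \<bullet> B = a * q" and center_sq: "center \<bullet> center = p\<^sup>2 + q\<^sup>2"
proof -
  have "a * (center \<bullet> A) = p * (A \<bullet> A) + q * (A \<bullet> B)"
    using arg_cong[OF focal, of "\<lambda>x. x \<bullet> A"] by (simp add: inner_add_left inner_add_right inner_commute)
  also have "\<dots> = a * (a * p)" by (simp add: A_sq A_B minor_alt algebra_simps power2_eq_square)
  finally show A: "center \<bullet> A = a * p" using elements_pos by simp
  have "a * (center \<bullet> B) = p * (A \<bullet> B) + q * (B \<bullet> B)"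
    using arg_cong[OF focal, of "\<lambda>x. x \<bullet> B"] by (simp add: inner_add_left)
  also have "\<dots> = a * (a * q)" by (simp add: B_sq A_B minor_alt algebra_simps power2_eq_square)
  finally show B: "center \<bullet> B = a * q" using elements_pos by simp
  have "a * (center \<bullet> center) = p * (center \<bullet> A) + q * (center \<bullet> B)"
    using arg_cong[OF focal, of "\<lambda>x. x \<bullet> center"] by (simp add: inner_add_left inner_add_right inner_commute)
  also have "\<dots> = a * (p\<^sup>2 + q\<^sup>2)" by (simp add: A B algebra_simps power2_eq_square)
  finally show "center \<bullet> center = p\<^sup>2 + q\<^sup>2" using elements_pos by simp
qed

lemma ecc_lt: "sqrt (p\<^sup>2 + q\<^sup>2) < a"
  using minor_pos minor_alt elements_pos by (intro real_less_lsqrt) auto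

lemma rho_ge: "\<rho> s \<ge> a - sqrt (p\<^sup>2 + q\<^sup>2)"
proof -
  have lagrange: "(p * c + q * d)\<^sup>2 + (p * d - q * c)\<^sup>2 = (p\<^sup>2 + q\<^sup>2) * (d\<^sup>2 + c\<^sup>2)" for c d
    by algebra
  have "(p * cos (\<omega> * s) + q * sin (\<omega> * s))\<^sup>2 + (p * sin (\<omega> * s) - q * cos (\<omega> * s))\<^sup>2 = p\<^sup>2 + q\<^sup>2"
    unfolding lagrange by simp
  moreover have "(p * sin (\<omega> * s) - q * cos (\<omega> * s))\<^sup>2 \<ge> 0" by simp
  ultimately have "(p * cos (\<omega> * s) + q * sin (\<omega> * s))\<^sup>2 \<le> p\<^sup>2 + q\<^sup>2" by linarith
  then have "\<bar>p * cos (\<omega> * s) + q * sin (\<omega> * s)\<bar> \<le> sqrt (p\<^sup>2 + q\<^sup>2)"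
    by (intro real_le_rsqrt) simp
  then show ?thesis unfolding \<rho>_def by linarith
qed

lemma rho_pos: "\<rho> s > 0" using rho_ge[of s] ecc_lt by linarith

lemma norm_X: "norm (X s) = \<rho> s"
proof -
  define c where "c = cos (\<omega> * s)"
  define d where "d = sin (\<omega> * s)"
  have cd: "d\<^sup>2 = 1 - c\<^sup>2" by (simp add: c_def d_def sin_squared_eq)
  have "X s \<bullet> X s = center \<bullet> center + c\<^sup>2 * (A \<bullet> A) + d\<^sup>2 * (B \<bullet> B) + 2 * c * (center \<bullet> A)
      + 2 * d * (center \<bullet> B) + 2 * c * d * (A \<bullet> B)"
    by (simp add: X_def c_def d_def inner_add_left inner_add_right inner_commute power2_eq_square algebra_simps)
  also have "\<dots> = p\<^sup>2 + q\<^sup>2 + c\<^sup>2 * p\<^sup>2 + d\<^sup>2 * q\<^sup>2 + (c\<^sup>2 + d\<^sup>2) * minor + 2 * c * (a * p) + 2 * d * (a * q) + 2 * c * d * (p * q)"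
    unfolding A_sq B_sq A_B center_A center_B center_sq by (simp add: algebra_simps)
  also have "\<dots> = (a + p * c + q * d)\<^sup>2"
    unfolding minor_alt using cd by algebra
  finally have "(norm (X s))\<^sup>2 = (\<rho> s)\<^sup>2"
    by (simp add: power2_norm_eq_inner \<rho>_def c_def d_def)
  then show ?thesis using rho_pos[of s] by simp
qed

lemma norm_X': "X' s \<bullet> X' s = W * minor + (\<rho>' s)\<^sup>2"
proof -
  define c where "c = cos (\<omega> * s)"
  define d where "d = sin (\<omega> * s)"
  have cd: "d\<^sup>2 = 1 - c\<^sup>2" by (simp add: c_def d_def sin_squared_eq)
  have "X' s \<bullet> X' s = \<omega>\<^sup>2 * (d\<^sup>2 * (A \<bullet> A) + c\<^sup>2 * (B \<bullet> B) - 2 * c * d * (A \<bullet> B))"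
    by (simp add: X'_def c_def d_def inner_diff_left inner_diff_right inner_commute power2_eq_square algebra_simps)
  also have "\<dots> = \<omega>\<^sup>2 * ((d\<^sup>2 + c\<^sup>2) * minor + (q * c - p * d)\<^sup>2)"
    unfolding A_sq B_sq A_B by (simp add: algebra_simps power2_eq_square)
  also have "\<dots> = W * minor + (\<rho>' s)\<^sup>2"
    unfolding \<rho>'_def c_def[symmetric] d_def[symmetric] power_mult_distrib omega_sq
    by (simp add: cd algebra_simps)
  finally show ?thesis .
qed

lemma X_dot_X': "X s \<bullet> X' s = \<rho> s * \<rho>' s"
proof -
  define c where "c = cos (\<omega> * s)"
  define d where "d = sin (\<omega> * s)"
  have cd: "d * d = 1 - c * c" using sin_squared_eq[of "\<omega> * s"] by (simp add: c_def d_def power2_eq_square)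
  have "X s \<bullet> X' s = \<omega> * (c * (center \<bullet> B) - d * (center \<bullet> A) + c * d * (B \<bullet> B) - c * d * (A \<bullet> A) + (c * c - d * d) * (A \<bullet> B))"
    by (simp add: X_def X'_def c_def d_def inner_add_left inner_diff_right inner_commute algebra_simps)
  also have "\<dots> = \<rho> s * \<rho>' s"
    unfolding A_sq B_sq A_B center_A center_B \<rho>_def \<rho>'_def c_def[symmetric] d_def[symmetric]
    by (simp add: algebra_simps power2_eq_square)
  finally show ?thesis .
qed

lemma X_deriv: "(X has_vector_derivative X' s) (at s)"
  unfolding X_def X'_def
  by (auto intro!: derivative_eq_intros has_vector_derivative_scaleR simp: algebra_simps
      simp flip: has_real_derivative_iff_has_vector_derivative)

lemma X'_deriv: "(X' has_vector_derivative - W *\<^sub>R (cos (\<omega> * s) *\<^sub>R A + sin (\<omega> * s) *\<^sub>R B)) (at s)"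
  unfolding X'_def omega_sq(2)[symmetric]
  by (auto intro!: derivative_eq_intros has_vector_derivative_scaleR simp: algebra_simps
      simp flip: has_real_derivative_iff_has_vector_derivative)

lemma rho_deriv: "(\<rho> has_real_derivative \<rho>' s) (at s)"
  unfolding \<rho>_def \<rho>'_def by (auto intro!: derivative_eq_intros simp: algebra_simps)

lemma time_deriv: "(time has_real_derivative \<rho> s) (at s)"
  unfolding time_def \<rho>_def using elements_pos by (auto intro!: derivative_eq_intros simp: algebra_simps)

text \<open>Newton's equation in the parameter \<open>s\<close>: with a prime for the derivative in \<open>s\<close>, the acceleration in
physical time is \<open>(\<rho> X'' - \<rho>' X') / \<rho> ^ 3\<close>.\<close>
lemma regularized_newton: "\<rho> s *\<^sub>R (- W *\<^sub>R (cos (\<omega> * s) *\<^sub>R A + sin (\<omega> * s) *\<^sub>R B)) - \<rho>' s *\<^sub>R X' s = - \<mu> *\<^sub>R X s"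
proof -
  define c where "c = cos (\<omega> * s)"
  define d where "d = sin (\<omega> * s)"
  have cd: "d * d = 1 - c * c" using sin_squared_eq[of "\<omega> * s"] by (simp add: c_def d_def power2_eq_square)
  have 1: "- (a + p * c + q * d) * c + (q * c - p * d) * d = - p - a * c"
    using cd by algebra
  have 2: "- (a + p * c + q * d) * d - (q * c - p * d) * c = - q - a * d"
    using cd by algebra
  have "\<rho> s *\<^sub>R (- W *\<^sub>R (c *\<^sub>R A + d *\<^sub>R B)) - \<rho>' s *\<^sub>R X' s
     = W *\<^sub>R ((- (a + p * c + q * d) * c + (q * c - p * d) * d) *\<^sub>R A + (- (a + p * c + q * d) * d - (q * c - p * d) * c) *\<^sub>R B)"
    unfolding \<rho>_def \<rho>'_def X'_def c_def[symmetric] d_def[symmetric] omega_sq(2)[symmetric]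
    by (simp add: algebra_simps)
  also have "\<dots> = - (W *\<^sub>R ((p *\<^sub>R A + q *\<^sub>R B) + (a * c) *\<^sub>R A + (a * d) *\<^sub>R B))"
    unfolding 1 2 by (simp add: algebra_simps)
  also have "\<dots> = - (a * W) *\<^sub>R X s"
    unfolding focal[symmetric] X_def c_def[symmetric] d_def[symmetric]
    by (simp add: scaleR_add_right ac_simps)
  also have "\<dots> = - \<mu> *\<^sub>R X s" unfolding mu_eq ..
  finally show ?thesis by (simp add: c_def d_def)
qed

lemma time_strict_mono: "time s < time s'" if "s < s'"
  using DERIV_pos_imp_increasing[OF that] time_deriv rho_pos by blast

lemma time_0: "time 0 = 0" by (simp add: time_def)

text \<open>Kepler's equation is solvable for every time because \<open>time\<close> differs from a linear function by a
bounded one.\<close>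
lemma time_surj: "\<exists>s. time s = t"
proof -
  \<comment> \<open>A bound for the periodic part of \<open>time\<close>.\<close>
  define C where "C = (\<bar>p\<bar> + 2 * \<bar>q\<bar>) / \<omega>"
  have bound: "\<bar>time s - a * s\<bar> \<le> C" for s
  proof -
    have "\<bar>time s - a * s\<bar> \<le> \<bar>p / \<omega> * sin (\<omega> * s)\<bar> + \<bar>q / \<omega> * (1 - cos (\<omega> * s))\<bar>"
      unfolding time_def by linarith
    also have "\<dots> \<le> \<bar>p / \<omega>\<bar> * 1 + \<bar>q / \<omega>\<bar> * 2"
      unfolding abs_mult
      using abs_sin_le_one[of "\<omega> * s"] abs_cos_le_one[of "\<omega> * s"]
      by (intro add_mono mult_left_mono) (auto simp: abs_le_iff)
    also have "\<dots> = C" using elements_pos by (simp add: C_def abs_divide add_divide_distrib)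
    finally show ?thesis .
  qed
  have "time ((t - C) / a) \<le> t" "t \<le> time ((t + C) / a)"
    using bound[of "(t - C) / a"] bound[of "(t + C) / a"] elements_pos by auto
  moreover have "(t - C) / a \<le> (t + C) / a"
    using elements_pos bound[of 0] by (intro divide_right_mono) auto
  ultimately show ?thesis
    using IVT[of time "(t - C) / a" t "(t + C) / a"] time_deriv DERIV_isCont by blast
qed

definition "anomaly t = (THE s. time s = t)"

lemma anomaly_time: "anomaly (time s) = s"
  unfolding anomaly_def by (rule the_equality) (metis time_strict_mono linorder_neqE_linordered_idom less_irrefl)+

lemma time_anomaly: "time (anomaly t) = t"
  using time_surj[of t] anomaly_time by metis

lemma anomaly_deriv: "(anomaly has_real_derivative 1 / \<rho> (anomaly t)) (at t)"
proof -
  have "isCont anomaly (time (anomaly t))"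
    by (rule isCont_inverse_function[where d = 1]) (auto simp: anomaly_time intro: DERIV_isCont[OF time_deriv])
  then have "isCont anomaly t" by (simp add: time_anomaly)
  then have "(anomaly has_real_derivative inverse (\<rho> (anomaly t))) (at t)"
    by (intro DERIV_inverse_function[OF time_deriv, where a = "t - 1" and b = "t + 1"])
       (use rho_pos[of "anomaly t"] in \<open>auto simp: time_anomaly\<close>)
  then show ?thesis by (simp add: inverse_eq_divide)
qed

definition "pos t = X (anomaly t)"
definition "vel t = (1 / \<rho> (anomaly t)) *\<^sub>R X' (anomaly t)"

lemma pos_deriv: "(pos has_vector_derivative vel t) (at t)"
  using vector_diff_chain_at[OF anomaly_deriv[unfolded has_real_derivative_iff_has_vector_derivative] X_deriv]
  unfolding pos_def vel_def o_def by simp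

lemma vel_deriv: "(vel has_vector_derivative - gravity \<mu> (pos t)) (at t)"
proof -
  define s where "s = anomaly t"
  have r: "\<rho> s > 0" by (rule rho_pos)
  have "((\<lambda>s. (1 / \<rho> s) *\<^sub>R X' s) has_vector_derivative
      (1 / \<rho> s) *\<^sub>R (- W *\<^sub>R (cos (\<omega> * s) *\<^sub>R A + sin (\<omega> * s) *\<^sub>R B)) + (- \<rho>' s / (\<rho> s)\<^sup>2) *\<^sub>R X' s) (at s)"
    by (intro has_vector_derivative_scaleR X'_deriv)
       (use r in \<open>auto intro!: derivative_eq_intros rho_deriv simp: power2_eq_square\<close>)
  also have "(1 / \<rho> s) *\<^sub>R (- W *\<^sub>R (cos (\<omega> * s) *\<^sub>R A + sin (\<omega> * s) *\<^sub>R B)) + (- \<rho>' s / (\<rho> s)\<^sup>2) *\<^sub>R X' s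
     = (1 / (\<rho> s)\<^sup>2) *\<^sub>R (\<rho> s *\<^sub>R (- W *\<^sub>R (cos (\<omega> * s) *\<^sub>R A + sin (\<omega> * s) *\<^sub>R B)) - \<rho>' s *\<^sub>R X' s)"
    using r by (simp add: scaleR_diff_right power2_eq_square)
  also have "\<dots> = (1 / (\<rho> s)\<^sup>2) *\<^sub>R (- \<mu> *\<^sub>R X s)" unfolding regularized_newton ..
  finally have D: "((\<lambda>s. (1 / \<rho> s) *\<^sub>R X' s) has_vector_derivative (1 / (\<rho> s)\<^sup>2) *\<^sub>R (- \<mu> *\<^sub>R X s)) (at s)" .
  have "((\<lambda>s. (1 / \<rho> s) *\<^sub>R X' s) \<circ> anomaly has_vector_derivative
      (1 / \<rho> s) *\<^sub>R ((1 / (\<rho> s)\<^sup>2) *\<^sub>R (- \<mu> *\<^sub>R X s))) (at t)"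
    unfolding s_def
    by (rule vector_diff_chain_at[OF anomaly_deriv[unfolded has_real_derivative_iff_has_vector_derivative]])
       (use D in \<open>simp add: s_def\<close>)
  moreover have "(1 / \<rho> s) *\<^sub>R ((1 / (\<rho> s)\<^sup>2) *\<^sub>R (- \<mu> *\<^sub>R X s)) = - gravity \<mu> (pos t)"
    by (simp add: gravity_def pos_def s_def[symmetric] norm_X eval_nat_numeral)
  moreover have "vel = (\<lambda>s. (1 / \<rho> s) *\<^sub>R X' s) \<circ> anomaly" by (simp add: vel_def fun_eq_iff)
  ultimately show ?thesis by simp
qed

lemma pos_nonzero: "pos t \<noteq> 0"
  using norm_X[of "anomaly t"] rho_pos[of "anomaly t"] by (auto simp: pos_def)

lemma initial_values: "X 0 = r\<^sub>0" "(1 / \<rho> 0) *\<^sub>R X' 0 = v\<^sub>0"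
  using elements_pos by (simp_all add: X_def center_def A_def X'_def \<rho>_def p_def B_def algebra_simps)

lemma pos_vel_0: "pos 0 = r\<^sub>0" "vel 0 = v\<^sub>0"
  using anomaly_time[of 0] initial_values by (simp_all add: time_0 pos_def vel_def)

lemma pos_vel_period: "\<exists>T>0. pos T = r\<^sub>0 \<and> vel T = v\<^sub>0"
proof (intro exI conjI)
  define P where "P = 2 * pi / \<omega>"
  have P: "P > 0" "\<omega> * P = 2 * pi" using elements_pos by (auto simp: P_def)
  show "time P > 0" using time_strict_mono[OF P(1)] by (simp add: time_0)
  show "pos (time P) = r\<^sub>0" "vel (time P) = v\<^sub>0"
    using initial_values P by (simp_all add: pos_def vel_def anomaly_time X_def X'_def \<rho>_def)
qed

text \<open>The second inequality says that the apsis reached is the perigee and not the apogee: the speed is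
at least that of the circular orbit.\<close>
lemma perigee_passage: "\<exists>t\<ge>0. pos t \<bullet> vel t = 0 \<and> norm (pos t) * (norm (vel t))\<^sup>2 \<ge> \<mu>"
proof -
  define R where "R = sqrt (p\<^sup>2 + q\<^sup>2)"
  have R: "R \<ge> 0" "R\<^sup>2 = p\<^sup>2 + q\<^sup>2" by (auto simp: R_def)
  obtain \<phi> where \<phi>: "0 \<le> \<phi>" "p = R * cos \<phi>" "q = R * sin \<phi>"
  proof (cases "R = 0")
    case True
    then have "p = 0" "q = 0" using R(2) by (auto simp: sum_power2_eq_zero_iff)
    then show ?thesis using that[of 0] True by simp
  next
    case False
    have "(p / R)\<^sup>2 + (q / R)\<^sup>2 = (p\<^sup>2 + q\<^sup>2) / R\<^sup>2"
      by (simp add: power_divide add_divide_distrib)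
    also have "\<dots> = 1" unfolding R(2)[symmetric] using False by simp
    finally have "(p / R)\<^sup>2 + (q / R)\<^sup>2 = 1" .
    from sincos_total_2pi[OF this] obtain \<phi> where "0 \<le> \<phi>" "p / R = cos \<phi>" "q / R = sin \<phi>" by metis
    then show ?thesis using that[of \<phi>] False by (simp add: field_simps)
  qed
  \<comment> \<open>In polar form the distance is \<open>a + R * cos (\<omega> * s - \<phi>)\<close>, which is minimal here.\<close>
  define s where "s = (\<phi> + pi) / \<omega>"
  have s: "s > 0" "\<omega> * s = \<phi> + pi" using elements_pos \<phi> pi_gt_zero by (auto simp: s_def add_nonneg_pos)
  have "\<rho> s = a - (R * cos \<phi> * cos \<phi> + R * sin \<phi> * sin \<phi>)"
    by (simp only: \<rho>_def s(2)) (simp add: \<phi>(2,3))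
  also have "R * cos \<phi> * cos \<phi> + R * sin \<phi> * sin \<phi> = R * ((sin \<phi>)\<^sup>2 + (cos \<phi>)\<^sup>2)" by algebra
  finally have rho: "\<rho> s = a - R" by simp
  have rho': "\<rho>' s = 0" by (simp only: \<rho>'_def s(2)) (simp add: \<phi>(2,3))
  have m: "minor = \<rho> s * (a + R)" unfolding minor_alt R(2)[symmetric] rho by (simp add: power2_eq_square algebra_simps)
  have "(norm (vel (time s)))\<^sup>2 = (X' s \<bullet> X' s) / (\<rho> s)\<^sup>2"
    unfolding power2_norm_eq_inner by (simp add: vel_def anomaly_time power2_eq_square)
  also have "\<dots> = W * (a + R) / \<rho> s"
    unfolding norm_X' rho' m using rho_pos[of s] by (simp add: power2_eq_square)
  finally have "norm (pos (time s)) * (norm (vel (time s)))\<^sup>2 = W * (a + R)"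
    using rho_pos[of s] by (simp add: pos_def anomaly_time norm_X)
  then have "norm (pos (time s)) * (norm (vel (time s)))\<^sup>2 \<ge> \<mu>"
    using mu_eq R(1) elements_pos by (simp add: algebra_simps)
  moreover have "pos (time s) \<bullet> vel (time s) = 0"
    by (simp add: pos_def vel_def anomaly_time X_dot_X' rho')
  moreover have "time s \<ge> 0" using time_strict_mono[OF s(1)] by (simp add: time_0)
  ultimately show ?thesis by blast
qed

end

definition kepler_motion :: "real \<Rightarrow> (real \<Rightarrow> real^3) \<Rightarrow> (real \<Rightarrow> real^3) \<Rightarrow> bool" where
  "kepler_motion \<mu> r v \<longleftrightarrow> (\<forall>t. r t \<noteq> 0 \<and> (r has_vector_derivative v t) (at t) \<and>
     (v has_vector_derivative - gravity \<mu> (r t)) (at t))"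

text \<open>The motion through an elliptic state exists for all times, returns to its initial state, and passes
its perigee.\<close>
theorem kepler_motion_exists:
  assumes "\<mu> > 0" "x \<in> periodic_region \<mu>"
  obtains r v T t\<^sub>p where "kepler_motion \<mu> r v" "(r 0, v 0) = x" "T > 0" "(r T, v T) = x"
    "t\<^sub>p \<ge> 0" "r t\<^sub>p \<bullet> v t\<^sub>p = 0" "norm (r t\<^sub>p) * (norm (v t\<^sub>p))\<^sup>2 \<ge> \<mu>"
proof -
  obtain r\<^sub>0 v\<^sub>0 where x: "x = (r\<^sub>0, v\<^sub>0)" by fastforce
  interpret kepler_data \<mu> r\<^sub>0 v\<^sub>0 using assms by unfold_locales (auto simp: x)
  show ?thesis
    using that[of pos vel] pos_vel_period perigee_passage pos_deriv vel_deriv pos_nonzero pos_vel_0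
    unfolding kepler_motion_def x by blast
qed

section \<open>Orbital elements along Kepler motion\<close>

lemma continuous_on_ang_mom: "continuous_on S ang_mom"
proof -
  have eq: "ang_mom = (\<lambda>x. fst x \<times> snd x)" by (auto simp: ang_mom_def)
  show ?thesis unfolding eq by (intro continuous_on_cross continuous_intros)
qed

lemma continuous_on_energy: "continuous_on {x. fst x \<noteq> 0} (energy \<mu>)"
proof -
  have eq: "energy \<mu> = (\<lambda>x. (norm (snd x))\<^sup>2 / 2 - \<mu> / norm (fst x))" by (auto simp: energy_def)
  show ?thesis unfolding eq by (intro continuous_intros) auto
qed

lemma continuous_on_perigee:
  assumes "\<mu> > 0"
  shows "continuous_on {x. fst x \<noteq> 0} (perigee \<mu>)"
proof -
  have eq: "laplace_vec \<mu> = (\<lambda>x. snd x \<times> ang_mom x - (\<mu> / norm (fst x)) *\<^sub>R fst x)"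
    by (auto simp: laplace_vec_def)
  have L: "continuous_on {x. fst x \<noteq> 0} (laplace_vec \<mu>)"
    unfolding eq by (intro continuous_on_cross continuous_on_ang_mom continuous_intros) auto
  have nz: "\<mu> * (1 + norm z / \<mu>) \<noteq> 0" for z :: "real^3"
    using assms by (simp add: distrib_left) (metis add_pos_nonneg less_irrefl norm_ge_zero)
  show ?thesis
    unfolding perigee_def[abs_def] eccentricity_def
    by (intro continuous_intros continuous_on_ang_mom L) (use nz assms in auto)
qed

lemma open_nonzero_position: "open {x :: phase. fst x \<noteq> 0}"
  by (intro open_Collect_neq continuous_intros)

lemma open_sublevel:
  fixes f g :: "'a::topological_space \<Rightarrow> real"
  assumes "open U" "continuous_on U f" "continuous_on U g"
  shows "open {x \<in> U. f x < g x}"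
proof -
  obtain A where "open A" "A \<inter> U = {x \<in> U. f x < g x}"
    using open_Collect_less_Int[OF assms(2,3)] by blast
  then show ?thesis using open_Int[OF _ assms(1), of A] by simp
qed

lemma open_periodic_region: "open (periodic_region \<mu>)"
proof -
  have "periodic_region \<mu> = {x \<in> {x. fst x \<noteq> 0}. energy \<mu> x < 0} \<inter> {x. ang_mom x \<noteq> 0}"
    by (auto simp: periodic_region_def)
  moreover have "open {x. ang_mom x \<noteq> 0}"
    by (intro open_Collect_neq continuous_on_ang_mom continuous_intros)
  moreover have "open {x \<in> {x. fst x \<noteq> 0}. energy \<mu> x < 0}"
    by (intro open_sublevel open_nonzero_position continuous_on_energy continuous_intros)
  ultimately show ?thesis by (simp only: open_Int)
qed

lemma periodic_region_nonzero: "periodic_region \<mu> \<subseteq> {x. fst x \<noteq> 0}"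
  by (auto simp: periodic_region_def)

lemma open_admissible_region: "open (admissible_region \<mu> r\<^sub>c)"
  unfolding admissible_region_def
  by (intro open_sublevel open_periodic_region continuous_intros)

lemma
  assumes "\<mu> > 0"
  shows open_perigee_gt: "open {x \<in> periodic_region \<mu>. perigee \<mu> x > c}"
    and open_perigee_lt: "open {x \<in> periodic_region \<mu>. perigee \<mu> x < c}"
  by (intro open_sublevel open_periodic_region continuous_intros
      continuous_on_subset[OF continuous_on_perigee[OF assms] periodic_region_nonzero])+

lemma laplace_vec_eq:
  "laplace_vec \<mu> (r, v) = (v \<bullet> v - \<mu> / norm r) *\<^sub>R r - (r \<bullet> v) *\<^sub>R v"
  by (simp add: laplace_vec_def ang_mom_def Lagrange inner_commute algebra_simps)

lemma norm_ang_mom: "(norm (ang_mom (r, v)))\<^sup>2 = (norm r)\<^sup>2 * (v \<bullet> v) - (r \<bullet> v)\<^sup>2"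
  by (simp add: ang_mom_def norm_cross power2_norm_eq_inner[of v])

text \<open>The eccentricity is a function of energy and angular momentum. Its conservation, and that of the
perigee distance, therefore follows from theirs.\<close>
lemma norm_laplace_vec:
  assumes "r \<noteq> 0"
  shows "(norm (laplace_vec \<mu> (r, v)))\<^sup>2 = \<mu>\<^sup>2 + 2 * energy \<mu> (r, v) * (norm (ang_mom (r, v)))\<^sup>2"
proof -
  define \<rho> where "\<rho> = norm r"
  define V where "V = v \<bullet> v"
  define w where "w = r \<bullet> v"
  have rho: "\<rho> > 0" using assms by (simp add: \<rho>_def)
  have rr: "r \<bullet> r = \<rho>\<^sup>2" by (simp add: \<rho>_def power2_norm_eq_inner)
  have "(norm (laplace_vec \<mu> (r, v)))\<^sup>2 = (V - \<mu> / \<rho>)\<^sup>2 * (r \<bullet> r) - 2 * (V - \<mu> / \<rho>) * w * w + w\<^sup>2 * V"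
    unfolding power2_norm_eq_inner laplace_vec_eq \<rho>_def[symmetric] V_def[symmetric] w_def[symmetric]
    by (simp add: inner_diff_left inner_diff_right inner_commute[of v r] V_def[symmetric] w_def[symmetric]
        power2_eq_square algebra_simps)
  also have "\<dots> = \<mu>\<^sup>2 + 2 * (V / 2 - \<mu> / \<rho>) * (\<rho>\<^sup>2 * V - w\<^sup>2)"
    unfolding rr using rho by (simp add: field_simps power2_eq_square)
  also have "\<dots> = \<mu>\<^sup>2 + 2 * energy \<mu> (r, v) * (norm (ang_mom (r, v)))\<^sup>2"
    unfolding norm_ang_mom by (simp add: energy_def V_def \<rho>_def w_def power2_norm_eq_inner)
  finally show ?thesis .
qed

lemma perigee_cong:
  assumes "fst x \<noteq> 0" "fst y \<noteq> 0" "ang_mom x = ang_mom y" "energy \<mu> x = energy \<mu> y"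
  shows "perigee \<mu> x = perigee \<mu> y"
proof -
  have "(norm (laplace_vec \<mu> x))\<^sup>2 = (norm (laplace_vec \<mu> y))\<^sup>2"
    using norm_laplace_vec[of "fst x" \<mu> "snd x"] norm_laplace_vec[of "fst y" \<mu> "snd y"] assms by simp
  then show ?thesis using assms by (simp add: perigee_def eccentricity_def)
qed

text \<open>From \<open>laplace_vec \<mu> (r, v) \<bullet> r = (norm (ang_mom (r, v)))\<^sup>2 - \<mu> * norm r\<close> and the inequality of
Cauchy and Schwarz.\<close>
lemma perigee_le_norm:
  assumes "\<mu> > 0" "r \<noteq> 0"
  shows "perigee \<mu> (r, v) \<le> norm r"
proof -
  have pos: "\<mu> + norm (laplace_vec \<mu> (r, v)) > 0" using assms by (simp add: add_pos_nonneg)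
  have "(norm (ang_mom (r, v)))\<^sup>2 = \<mu> * norm r + laplace_vec \<mu> (r, v) \<bullet> r"
    unfolding norm_ang_mom laplace_vec_eq using assms(2)
    by (simp add: inner_diff_left inner_commute[of v r] power2_norm_eq_inner[symmetric] power2_eq_square algebra_simps)
  also have "\<dots> \<le> \<mu> * norm r + norm (laplace_vec \<mu> (r, v)) * norm r"
    using norm_cauchy_schwarz by auto
  finally have "(norm (ang_mom (r, v)))\<^sup>2 \<le> norm r * (\<mu> + norm (laplace_vec \<mu> (r, v)))"
    by (simp add: algebra_simps)
  then have "(norm (ang_mom (r, v)))\<^sup>2 / (\<mu> + norm (laplace_vec \<mu> (r, v))) \<le> norm r"
    using pos by (simp add: divide_le_eq)
  moreover have "\<mu> * (1 + eccentricity \<mu> (r, v)) = \<mu> + norm (laplace_vec \<mu> (r, v))"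
    using assms by (simp add: eccentricity_def algebra_simps)
  ultimately show ?thesis by (simp add: perigee_def)
qed

lemma P_plus_admissible:
  assumes "\<mu> > 0"
  shows "P_plus \<mu> r\<^sub>c \<subseteq> admissible_region \<mu> r\<^sub>c"
proof
  fix x assume x: "x \<in> P_plus \<mu> r\<^sub>c"
  then have "perigee \<mu> x \<le> norm (fst x)"
    using perigee_le_norm[OF assms, of "fst x" "snd x"] by (simp add: P_plus_def periodic_region_def)
  then show "x \<in> admissible_region \<mu> r\<^sub>c" using x by (auto simp: P_plus_def admissible_region_def)
qed

text \<open>With at least circular speed the apsis is the perigee; with a smaller speed it would be the
apogee.\<close>
lemma perigee_at_apsis:
  assumes "\<mu> > 0" "r \<noteq> 0" "r \<bullet> v = 0" "norm r * (norm v)\<^sup>2 \<ge> \<mu>"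
  shows "perigee \<mu> (r, v) = norm r"
proof -
  define V where "V = v \<bullet> v"
  have V: "norm r * V \<ge> \<mu>" using assms(4) by (simp add: V_def power2_norm_eq_inner)
  have "norm (laplace_vec \<mu> (r, v)) = \<bar>V - \<mu> / norm r\<bar> * norm r"
    by (simp add: laplace_vec_eq assms(3) V_def)
  also have "\<dots> = \<bar>(V - \<mu> / norm r) * norm r\<bar>" by (simp add: abs_mult)
  also have "\<dots> = norm r * V - \<mu>" using V assms(2) by (simp add: algebra_simps)
  finally have "\<mu> * (1 + eccentricity \<mu> (r, v)) = norm r * V"
    using assms(1) by (simp add: eccentricity_def algebra_simps)
  moreover have "(norm (ang_mom (r, v)))\<^sup>2 = (norm r)\<^sup>2 * V"
    by (simp add: norm_ang_mom assms(3) V_def)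
  moreover have "norm r * V \<noteq> 0" using V assms(1) by linarith
  ultimately show ?thesis by (simp add: perigee_def power2_eq_square)
qed

lemma kepler_motion_invariants:
  assumes km: "kepler_motion \<mu> r v"
  shows "ang_mom (r t, v t) = ang_mom (r 0, v 0)" "energy \<mu> (r t, v t) = energy \<mu> (r 0, v 0)"
    "perigee \<mu> (r t, v t) = perigee \<mu> (r 0, v 0)"
proof -
  have D: "r s \<noteq> 0" "(r has_vector_derivative v s) (at s)"
    "(v has_vector_derivative - gravity \<mu> (r s)) (at s)" for s
    using km by (auto simp: kepler_motion_def)
  have "bounded_bilinear ((\<times>) :: real^3 \<Rightarrow> real^3 \<Rightarrow> real^3)"
    using bilinear_cross by (simp add: bilinear_conv_bounded_bilinear)
  from bounded_bilinear.has_vector_derivative[OF this D(2,3)]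
  have "((\<lambda>s. r s \<times> v s) has_vector_derivative 0) (at s within UNIV)" for s
    by (simp add: gravity_def cross_mult_right)
  from has_vector_derivative_zero_constant[OF convex_UNIV this]
  show h: "ang_mom (r t, v t) = ang_mom (r 0, v 0)" by (metis UNIV_I ang_mom_def case_prod_conv)
  have "((\<lambda>s. v s \<bullet> v s / 2 - \<mu> / sqrt (r s \<bullet> r s)) has_real_derivative 0) (at s within UNIV)" for s
  proof -
    have rr: "((\<lambda>s. r s \<bullet> r s) has_real_derivative 2 * (r s \<bullet> v s)) (at s)"
      using bounded_bilinear.has_vector_derivative[OF bounded_bilinear_inner D(2) D(2), of s]
      by (simp add: has_real_derivative_iff_has_vector_derivative inner_commute)
    have vv: "((\<lambda>s. v s \<bullet> v s) has_real_derivative - 2 * (v s \<bullet> gravity \<mu> (r s))) (at s)"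
      using bounded_bilinear.has_vector_derivative[OF bounded_bilinear_inner D(3) D(3), of s]
      by (simp add: has_real_derivative_iff_has_vector_derivative inner_commute)
    have pos: "r s \<bullet> r s > 0" "norm (r s) > 0" using D(1) by simp_all
    have n: "sqrt (r s \<bullet> r s) = norm (r s)" by (simp add: norm_eq_sqrt_inner)
    have "((\<lambda>s. v s \<bullet> v s / 2 - \<mu> / sqrt (r s \<bullet> r s)) has_real_derivative
       - (v s \<bullet> gravity \<mu> (r s)) + \<mu> * (r s \<bullet> v s) / norm (r s) ^ 3) (at s)"
      using DERIV_diff[OF DERIV_cdivide[OF vv, of 2]
          DERIV_divide[OF DERIV_const[of \<mu>] DERIV_chain2[OF DERIV_real_sqrt[OF pos(1)] rr]]] pos
      by (simp add: n field_simps eval_nat_numeral)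
    then show ?thesis by (simp add: gravity_def inner_commute)
  qed
  then have "((\<lambda>s. v s \<bullet> v s / 2 - \<mu> / sqrt (r s \<bullet> r s)) has_vector_derivative 0) (at s within UNIV)" for s
    by (simp add: has_real_derivative_iff_has_vector_derivative)
  from has_vector_derivative_zero_constant[OF convex_UNIV this]
  have "v t \<bullet> v t / 2 - \<mu> / sqrt (r t \<bullet> r t) = v 0 \<bullet> v 0 / 2 - \<mu> / sqrt (r 0 \<bullet> r 0)" by (metis UNIV_I)
  then show E: "energy \<mu> (r t, v t) = energy \<mu> (r 0, v 0)"
    by (simp add: energy_def norm_eq_sqrt_inner)
  show "perigee \<mu> (r t, v t) = perigee \<mu> (r 0, v 0)"
    by (rule perigee_cong) (use D(1) h E in auto)
qed

lemma kepler_motion_stays: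
  assumes km: "kepler_motion \<mu> r v"
  shows "(r 0, v 0) \<in> periodic_region \<mu> \<Longrightarrow> (r t, v t) \<in> periodic_region \<mu>"
    and "(r 0, v 0) \<in> P_plus \<mu> r\<^sub>c \<Longrightarrow> (r t, v t) \<in> P_plus \<mu> r\<^sub>c"
  using kepler_motion_invariants[OF km, of t] km
  by (auto simp: periodic_region_def P_plus_def kepler_motion_def)

lemma kepler_motion_continuous:
  assumes "kepler_motion \<mu> r v"
  shows "continuous_on S r" "continuous_on S v"
  using assms by (auto simp: kepler_motion_def
      intro!: continuous_at_imp_continuous_on has_vector_derivative_continuous)

section \<open>Corrections of a Kepler arc\<close>

text \<open>Cubic interpolation of the position and velocity at both ends of the interval. The point is that the
correction, with its first two derivatives, is bounded linearly by the boundary values.\<close>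
lemma hermite_interpolation:
  fixes T :: real
  assumes T: "T > 0"
  obtains C where "C > 0" "\<And>(c\<^sub>0::real^3) d\<^sub>0 c\<^sub>1 d\<^sub>1 \<eta>. \<lbrakk>norm c\<^sub>0 \<le> \<eta>; norm d\<^sub>0 \<le> \<eta>; norm c\<^sub>1 \<le> \<eta>; norm d\<^sub>1 \<le> \<eta>\<rbrakk> \<Longrightarrow>
    \<exists>z z' z''. (\<forall>t. (z has_vector_derivative z' t) (at t)) \<and> (\<forall>t. (z' has_vector_derivative z'' t) (at t)) \<and>
      continuous_on UNIV z'' \<and> z 0 = c\<^sub>0 \<and> z' 0 = d\<^sub>0 \<and> z T = c\<^sub>1 \<and> z' T = d\<^sub>1 \<and>
      (\<forall>t\<in>{0..T}. norm (z t) \<le> C * \<eta> \<and> norm (z' t) \<le> C * \<eta> \<and> norm (z'' t) \<le> C * \<eta>)"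
proof -
  define a where "a = (6 + 5 * T) / T\<^sup>2"
  define g where "g = (4 + 4 * T) / T ^ 3"
  define C where "C = 1 + (1 + T) + (1 + 2 * T + T\<^sup>2 + 2) * a + (6 * T + 3 * T\<^sup>2 + T ^ 3) * g"
  have a: "a \<ge> 0" and g: "g \<ge> 0" using T by (auto simp: a_def g_def)
  have C: "C > 0" unfolding C_def using T a g by (intro add_pos_nonneg) auto
  have "\<exists>z z' z''. (\<forall>t. (z has_vector_derivative z' t) (at t)) \<and> (\<forall>t. (z' has_vector_derivative z'' t) (at t)) \<and>
      continuous_on UNIV z'' \<and> z 0 = c\<^sub>0 \<and> z' 0 = d\<^sub>0 \<and> z T = c\<^sub>1 \<and> z' T = d\<^sub>1 \<and>
      (\<forall>t\<in>{0..T}. norm (z t) \<le> C * \<eta> \<and> norm (z' t) \<le> C * \<eta> \<and> norm (z'' t) \<le> C * \<eta>)"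
    if n: "norm c\<^sub>0 \<le> \<eta>" "norm d\<^sub>0 \<le> \<eta>" "norm c\<^sub>1 \<le> \<eta>" "norm d\<^sub>1 \<le> \<eta>" for c\<^sub>0 d\<^sub>0 c\<^sub>1 d\<^sub>1 :: "real^3" and \<eta>
  proof -
    define e where "e = c\<^sub>1 - c\<^sub>0 - T *\<^sub>R d\<^sub>0"
    define f where "f = d\<^sub>1 - d\<^sub>0"
    \<comment> \<open>The quadratic and cubic coefficients solve the two linear conditions at the end \<open>T\<close>.\<close>
    define \<alpha> where "\<alpha> = (1 / T\<^sup>2) *\<^sub>R (3 *\<^sub>R e - T *\<^sub>R f)"
    define \<gamma> where "\<gamma> = (1 / T ^ 3) *\<^sub>R (T *\<^sub>R f - 2 *\<^sub>R e)"
    define z where "z = (\<lambda>t. c\<^sub>0 + t *\<^sub>R d\<^sub>0 + t\<^sup>2 *\<^sub>R \<alpha> + t ^ 3 *\<^sub>R \<gamma>)"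
    define z' where "z' = (\<lambda>t. d\<^sub>0 + (2 * t) *\<^sub>R \<alpha> + (3 * t\<^sup>2) *\<^sub>R \<gamma>)"
    define z'' where "z'' = (\<lambda>t::real. 2 *\<^sub>R \<alpha> + (6 * t) *\<^sub>R \<gamma>)"
    have \<eta>: "\<eta> \<ge> 0" using n(1) norm_ge_zero order_trans by blast
    have ne: "norm e \<le> (2 + T) * \<eta>"
    proof -
      have "norm e \<le> norm c\<^sub>1 + norm c\<^sub>0 + T * norm d\<^sub>0"
        unfolding e_def using T norm_triangle_ineq4[of "c\<^sub>1 - c\<^sub>0" "T *\<^sub>R d\<^sub>0"] norm_triangle_ineq4[of c\<^sub>1 c\<^sub>0] by simp
      also have "\<dots> \<le> \<eta> + \<eta> + T * \<eta>" using n T by (intro add_mono mult_left_mono) auto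
      finally show ?thesis by (simp add: algebra_simps)
    qed
    have nf: "norm f \<le> 2 * \<eta>"
      unfolding f_def using n norm_triangle_ineq4[of d\<^sub>1 d\<^sub>0] by linarith
    have na: "norm \<alpha> \<le> a * \<eta>"
    proof -
      have "norm \<alpha> \<le> (1 / T\<^sup>2) * (3 * norm e + T * norm f)"
        unfolding \<alpha>_def using T norm_triangle_ineq4[of "3 *\<^sub>R e" "T *\<^sub>R f"] by (simp add: divide_right_mono)
      also have "\<dots> \<le> (1 / T\<^sup>2) * (3 * ((2 + T) * \<eta>) + T * (2 * \<eta>))"
        using ne nf T by (intro mult_left_mono add_mono) auto
      also have "\<dots> = a * \<eta>" using T by (simp add: a_def field_simps)
      finally show ?thesis .
    qed
    have ng: "norm \<gamma> \<le> g * \<eta>"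
    proof -
      have "norm \<gamma> \<le> (1 / T ^ 3) * (T * norm f + 2 * norm e)"
        unfolding \<gamma>_def using T norm_triangle_ineq4[of "T *\<^sub>R f" "2 *\<^sub>R e"] by (simp add: divide_right_mono)
      also have "\<dots> \<le> (1 / T ^ 3) * (T * (2 * \<eta>) + 2 * ((2 + T) * \<eta>))"
        using ne nf T by (intro mult_left_mono add_mono) auto
      also have "\<dots> = g * \<eta>" using T by (simp add: g_def field_simps)
      finally show ?thesis .
    qed
    have 1: "T\<^sup>2 *\<^sub>R \<alpha> + T ^ 3 *\<^sub>R \<gamma> = e"
      using T by (simp add: \<alpha>_def \<gamma>_def vec_eq_iff)
    have 2: "(2 * T) *\<^sub>R \<alpha> + (3 * T\<^sup>2) *\<^sub>R \<gamma> = f"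
    proof -
      have "(2 * T) *\<^sub>R \<alpha> = (2 / T) *\<^sub>R (3 *\<^sub>R e - T *\<^sub>R f)" "(3 * T\<^sup>2) *\<^sub>R \<gamma> = (3 / T) *\<^sub>R (T *\<^sub>R f - 2 *\<^sub>R e)"
        using T by (simp_all add: \<alpha>_def \<gamma>_def power2_eq_square power3_eq_cube)
      then have "(2 * T) *\<^sub>R \<alpha> + (3 * T\<^sup>2) *\<^sub>R \<gamma> = (2 / T) *\<^sub>R (3 *\<^sub>R e - T *\<^sub>R f) + (3 / T) *\<^sub>R (T *\<^sub>R f - 2 *\<^sub>R e)"
        by (simp only:)
      also have "\<dots> = f" using T by (simp add: vec_eq_iff field_simps)
      finally show ?thesis .
    qed
    have ends: "z 0 = c\<^sub>0" "z' 0 = d\<^sub>0" "z T = c\<^sub>1" "z' T = d\<^sub>1"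
      using 1 2 by (simp_all add: z_def z'_def e_def f_def add.assoc)
    have der: "(z has_vector_derivative z' t) (at t)" "(z' has_vector_derivative z'' t) (at t)" for t
      unfolding z_def z'_def z''_def
      by (auto intro!: derivative_eq_intros has_vector_derivative_scaleR simp: power2_eq_square
          simp flip: has_real_derivative_iff_has_vector_derivative)
    have "norm (z t) \<le> C * \<eta> \<and> norm (z' t) \<le> C * \<eta> \<and> norm (z'' t) \<le> C * \<eta>" if t: "t \<in> {0..T}" for t
    proof -
      have p2: "t\<^sup>2 \<le> T\<^sup>2" and p3: "t ^ 3 \<le> T ^ 3" using t by (auto intro!: power_mono)
      have x: "norm (k *\<^sub>R y) \<le> K * (b * \<eta>)" if "0 \<le> k" "k \<le> K" "norm y \<le> b * \<eta>" for k K b and y :: "real^3"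
        using that by (auto intro!: mult_mono)
      have nonneg: "0 \<le> T * \<eta>" "0 \<le> a * \<eta>" "0 \<le> g * \<eta>" "0 \<le> T * (a * \<eta>)" "0 \<le> T\<^sup>2 * (a * \<eta>)" "0 \<le> T * (g * \<eta>)" "0 \<le> T\<^sup>2 * (g * \<eta>)" "0 \<le> T ^ 3 * (g * \<eta>)"
        using T a g \<eta> by auto
      have Ceq: "C * \<eta> = \<eta> + (\<eta> + T * \<eta>) + (3 * (a * \<eta>) + 2 * (T * (a * \<eta>)) + T\<^sup>2 * (a * \<eta>)) + (6 * (T * (g * \<eta>)) + 3 * (T\<^sup>2 * (g * \<eta>)) + T ^ 3 * (g * \<eta>))"
        by (simp add: C_def algebra_simps)
      have "norm (z t) \<le> norm c\<^sub>0 + norm (t *\<^sub>R d\<^sub>0) + norm (t\<^sup>2 *\<^sub>R \<alpha>) + norm (t ^ 3 *\<^sub>R \<gamma>)"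
        unfolding z_def by (intro norm_triangle_mono norm_triangle_ineq order_refl)
      also have "\<dots> \<le> \<eta> + T * (1 * \<eta>) + T\<^sup>2 * (a * \<eta>) + T ^ 3 * (g * \<eta>)"
        using n na ng p2 p3 t by (intro add_mono x) auto
      finally have A: "norm (z t) \<le> C * \<eta>" unfolding Ceq using nonneg \<eta> by linarith
      have "norm (z' t) \<le> norm d\<^sub>0 + norm ((2 * t) *\<^sub>R \<alpha>) + norm ((3 * t\<^sup>2) *\<^sub>R \<gamma>)"
        unfolding z'_def by (intro norm_triangle_mono norm_triangle_ineq order_refl)
      also have "\<dots> \<le> \<eta> + (2 * T) * (a * \<eta>) + (3 * T\<^sup>2) * (g * \<eta>)"
        using n na ng p2 p3 t by (intro add_mono x) auto
      finally have B: "norm (z' t) \<le> C * \<eta>" unfolding Ceq mult.assoc using nonneg \<eta> by linarith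
      have "norm (z'' t) \<le> norm (2 *\<^sub>R \<alpha>) + norm ((6 * t) *\<^sub>R \<gamma>)"
        unfolding z''_def by (intro norm_triangle_mono norm_triangle_ineq order_refl)
      also have "\<dots> \<le> 2 * (a * \<eta>) + (6 * T) * (g * \<eta>)"
        using n na ng p2 p3 t by (intro add_mono x) auto
      finally have D: "norm (z'' t) \<le> C * \<eta>" unfolding Ceq mult.assoc using nonneg \<eta> by linarith
      from A B D show ?thesis by blast
    qed
    moreover have "continuous_on UNIV z''" unfolding z''_def by (intro continuous_intros)
    ultimately show ?thesis using ends der by blast
  qed
  with C that show thesis by blast
qed

text \<open>The cubic correction \<open>z\<close> of the Kepler arc demands the acceleration \<open>z''\<close> plus the difference of
gravity at two nearby points. Both are of the order of the boundary values. So the endpoints of the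
arc can be moved freely within a small ball, for any positive thrust bound.\<close>
lemma steers_near_kepler_arc:
  assumes pos: "\<mu> > 0" "\<beta> > 0" "r\<^sub>c > 0" "\<tau> > 0" "M > 0" "T > 0"
    and km: "kepler_motion \<mu> r v"
    and adm: "\<And>t. t \<in> {0..T} \<Longrightarrow> (r t, v t) \<in> admissible_region \<mu> r\<^sub>c"
  obtains \<delta> where "\<delta> > 0" "\<And>x y m. \<lbrakk>dist x (r 0, v 0) < \<delta>; dist y (r T, v T) < \<delta>; 0 < m; m \<le> M\<rbrakk> \<Longrightarrow>
    \<exists>m'. 0 < m' \<and> m' \<le> m \<and> steers \<mu> \<beta> r\<^sub>c \<tau> (x, m) (y, m')"
proof -
  obtain C where C: "C > 0" and hermite: "\<And>(c\<^sub>0::real^3) d\<^sub>0 c\<^sub>1 d\<^sub>1 \<eta>. \<lbrakk>norm c\<^sub>0 \<le> \<eta>; norm d\<^sub>0 \<le> \<eta>; norm c\<^sub>1 \<le> \<eta>; norm d\<^sub>1 \<le> \<eta>\<rbrakk> \<Longrightarrow>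
    \<exists>z z' z''. (\<forall>t. (z has_vector_derivative z' t) (at t)) \<and> (\<forall>t. (z' has_vector_derivative z'' t) (at t)) \<and>
      continuous_on UNIV z'' \<and> z 0 = c\<^sub>0 \<and> z' 0 = d\<^sub>0 \<and> z T = c\<^sub>1 \<and> z' T = d\<^sub>1 \<and>
      (\<forall>t\<in>{0..T}. norm (z t) \<le> C * \<eta> \<and> norm (z' t) \<le> C * \<eta> \<and> norm (z'' t) \<le> C * \<eta>)"
    using hermite_interpolation[OF \<open>T > 0\<close>] by blast
  have cont: "continuous_on {0..T} (\<lambda>t. (r t, v t))"
    using kepler_motion_continuous[OF km] by (intro continuous_intros)
  obtain \<epsilon> where \<epsilon>: "\<epsilon> > 0" "(\<Union>x\<in>(\<lambda>t. (r t, v t)) ` {0..T}. ball x \<epsilon>) \<subseteq> admissible_region \<mu> r\<^sub>c"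
    using compact_subset_open_imp_ball_epsilon_subset[OF compact_continuous_image[OF cont compact_Icc] open_admissible_region]
    adm by blast
  define L where "L = 4 * \<mu> / r\<^sub>c ^ 3"
  have L: "L > 0" using pos by (simp add: L_def)
  define \<delta> where "\<delta> = min (\<epsilon> / (3 * C)) (\<tau> / (M * ((1 + L) * C)))"
  have \<delta>: "\<delta> > 0" using C \<epsilon> pos L by (simp add: \<delta>_def)
  have \<delta>1: "2 * (C * \<delta>) < \<epsilon>"
  proof -
    have "\<delta> \<le> \<epsilon> / (3 * C)" by (simp add: \<delta>_def)
    then have "3 * C * \<delta> \<le> \<epsilon>" using C by (simp add: pos_le_divide_eq mult.commute)
    then show ?thesis using mult_pos_pos[OF C \<delta>] by simp
  qed
  have \<delta>2: "M * ((1 + L) * (C * \<delta>)) \<le> \<tau>"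
  proof -
    have "\<delta> \<le> \<tau> / (M * ((1 + L) * C))" by (simp add: \<delta>_def)
    then show ?thesis using C L pos by (simp add: pos_le_divide_eq mult_ac)
  qed
  show thesis
  proof (rule that[OF \<delta>])
    fix x y :: phase and m assume xy: "dist x (r 0, v 0) < \<delta>" "dist y (r T, v T) < \<delta>" and m: "0 < m" "m \<le> M"
    have n: "norm (fst x - r 0) \<le> \<delta>" "norm (snd x - v 0) \<le> \<delta>" "norm (fst y - r T) \<le> \<delta>" "norm (snd y - v T) \<le> \<delta>"
      using xy dist_fst_le[of x "(r 0, v 0)"] dist_snd_le[of x "(r 0, v 0)"]
        dist_fst_le[of y "(r T, v T)"] dist_snd_le[of y "(r T, v T)"]
      by (simp_all add: dist_norm)
    obtain z z' z'' where z: "\<And>t. (z has_vector_derivative z' t) (at t)" "\<And>t. (z' has_vector_derivative z'' t) (at t)"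
      "continuous_on UNIV z''" and ends: "z 0 = fst x - r 0" "z' 0 = snd x - v 0" "z T = fst y - r T" "z' T = snd y - v T"
      and bnd: "\<And>t. t \<in> {0..T} \<Longrightarrow> norm (z t) \<le> C * \<delta>" "\<And>t. t \<in> {0..T} \<Longrightarrow> norm (z' t) \<le> C * \<delta>"
        "\<And>t. t \<in> {0..T} \<Longrightarrow> norm (z'' t) \<le> C * \<delta>"
      using hermite[OF n] by blast
    have adm': "(r t + z t, v t + z' t) \<in> admissible_region \<mu> r\<^sub>c" if t: "t \<in> {0..T}" for t
    proof -
      have "dist (r t, v t) (r t + z t, v t + z' t) = norm (z t, z' t)"
        by (subst dist_commute) (simp add: dist_norm)
      also have "\<dots> \<le> norm (z t) + norm (z' t)" by (rule norm_Pair_le)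
      also have "\<dots> < \<epsilon>" using bnd(1,2)[OF t] \<delta>1 by linarith
      finally have "(r t + z t, v t + z' t) \<in> ball (r t, v t) \<epsilon>" by simp
      then show ?thesis using \<epsilon>(2) t by blast
    qed
    have "\<exists>m'. 0 < m' \<and> m' \<le> m \<and> steers \<mu> \<beta> r\<^sub>c \<tau> ((r 0 + z 0, v 0 + z' 0), m) ((r T + z T, v T + z' T), m')"
    proof (rule steers_along_smooth_path[where w = "\<lambda>t. - gravity \<mu> (r t) + z'' t"])
      fix t assume t: "t \<in> {0..T}"
      have km': "(r has_vector_derivative v t) (at t)" "(v has_vector_derivative - gravity \<mu> (r t)) (at t)"
        using km unfolding kepler_motion_def by blast+
      show "((\<lambda>t. r t + z t) has_vector_derivative v t + z' t) (at t)"
        "((\<lambda>t. v t + z' t) has_vector_derivative - gravity \<mu> (r t) + z'' t) (at t)"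
        by (rule has_vector_derivative_add[OF km'(1) z(1)], rule has_vector_derivative_add[OF km'(2) z(2)])
      have "norm (gravity \<mu> (r t + z t) - gravity \<mu> (r t)) \<le> L * norm (r t + z t - r t)"
        unfolding L_def using adm[OF t] adm'[OF t] pos
        by (intro gravity_lipschitz) (auto simp: admissible_region_def)
      also have "\<dots> \<le> L * (C * \<delta>)" using bnd(1)[OF t] L by (simp add: mult_left_mono)
      finally have "norm (z'' t + (gravity \<mu> (r t + z t) - gravity \<mu> (r t))) \<le> C * \<delta> + L * (C * \<delta>)"
        using bnd(3)[OF t] by (intro order_trans[OF norm_triangle_ineq] add_mono)
      then have "norm (- gravity \<mu> (r t) + z'' t + gravity \<mu> (r t + z t)) \<le> (1 + L) * (C * \<delta>)"
        by (simp add: algebra_simps)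
      then have "m * norm (- gravity \<mu> (r t) + z'' t + gravity \<mu> (r t + z t)) \<le> M * ((1 + L) * (C * \<delta>))"
        using m by (intro mult_mono) auto
      then show "m * norm (- gravity \<mu> (r t) + z'' t + gravity \<mu> (r t + z t)) \<le> \<tau>"
        using \<delta>2 by linarith
    next
      show "continuous_on {0..T} (\<lambda>t. - gravity \<mu> (r t) + z'' t)"
        using km continuous_on_subset[OF z(3)] kepler_motion_continuous[OF km]
        by (intro continuous_intros) (auto simp: kepler_motion_def)
    qed (use adm' pos m in auto)
    then show "\<exists>m'. 0 < m' \<and> m' \<le> m \<and> steers \<mu> \<beta> r\<^sub>c \<tau> (x, m) (y, m')"
      by (simp add: ends)
  qed
qed

section \<open>Connectedness of the region of safe orbits\<close>

definition circular :: "real \<Rightarrow> real \<Rightarrow> real^3 \<Rightarrow> real^3 \<Rightarrow> phase" where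
  "circular \<mu> \<rho> P Q = (\<rho> *\<^sub>R P, sqrt (\<mu> / \<rho>) *\<^sub>R Q)"

definition frame :: "real^3 \<Rightarrow> real^3 \<Rightarrow> bool" where
  "frame P Q \<longleftrightarrow> P \<bullet> P = 1 \<and> Q \<bullet> Q = 1 \<and> P \<bullet> Q = 0"

text \<open>Transverse velocities between circular and escape speed have their perigee at the current point.\<close>
lemma apsis_in_P_plus:
  assumes "\<mu> > 0" "r\<^sub>c > 0" "norm r > r\<^sub>c" "r \<bullet> v = 0" "norm r * (norm v)\<^sup>2 \<ge> \<mu>" "norm r * (norm v)\<^sup>2 < 2 * \<mu>"
  shows "(r, v) \<in> P_plus \<mu> r\<^sub>c"
proof -
  have r: "r \<noteq> 0" "norm r > 0" using assms by auto
  have v: "v \<noteq> 0" using assms by auto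
  have "(norm (ang_mom (r, v)))\<^sup>2 = (norm r)\<^sup>2 * (norm v)\<^sup>2"
    by (simp add: norm_ang_mom assms(4) power2_norm_eq_inner[of v])
  then have "ang_mom (r, v) \<noteq> 0" using r v by auto
  moreover have "energy \<mu> (r, v) < 0" using assms(6) r by (simp add: energy_def field_simps)
  moreover have "perigee \<mu> (r, v) = norm r" by (rule perigee_at_apsis) (use assms r in auto)
  ultimately show ?thesis using assms r by (simp add: P_plus_def periodic_region_def)
qed

lemma circular_in_P_plus:
  assumes "\<mu> > 0" "r\<^sub>c > 0" "\<rho> > r\<^sub>c" "frame P Q"
  shows "circular \<mu> \<rho> P Q \<in> P_plus \<mu> r\<^sub>c"
proof -
  have "norm P = 1" "norm Q = 1" "P \<bullet> Q = 0" using assms(4) by (auto simp: frame_def norm_eq_sqrt_inner)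
  then show ?thesis unfolding circular_def using assms
    by (intro apsis_in_P_plus) (auto simp: power_mult_distrib)
qed

text \<open>The first rotation moves along the circular orbit, the second turns the orbital plane about the
position vector.\<close>
lemma frame_rotate:
  assumes "frame P Q"
  shows "frame (cos \<theta> *\<^sub>R P + sin \<theta> *\<^sub>R Q) (cos \<theta> *\<^sub>R Q - sin \<theta> *\<^sub>R P)"
    and "frame P (cos \<theta> *\<^sub>R Q + sin \<theta> *\<^sub>R (P \<times> Q))"
    and "frame Q (P \<times> Q)"
proof -
  have s: "sin \<theta> * sin \<theta> = 1 - cos \<theta> * cos \<theta>" using sin_squared_eq[of \<theta>] by (simp add: power2_eq_square)
  have PQ: "P \<bullet> P = 1" "Q \<bullet> Q = 1" "P \<bullet> Q = 0" "Q \<bullet> P = 0" using assms by (auto simp: frame_def inner_commute)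
  have c: "(P \<times> Q) \<bullet> (P \<times> Q) = 1" "P \<bullet> (P \<times> Q) = 0" "Q \<bullet> (P \<times> Q) = 0" "(P \<times> Q) \<bullet> Q = 0"
    by (simp_all add: dot_cross PQ dot_cross_self)
  show "frame (cos \<theta> *\<^sub>R P + sin \<theta> *\<^sub>R Q) (cos \<theta> *\<^sub>R Q - sin \<theta> *\<^sub>R P)"
    by (simp add: frame_def inner_add_left inner_add_right inner_diff_left inner_diff_right PQ s)
  show "frame P (cos \<theta> *\<^sub>R Q + sin \<theta> *\<^sub>R (P \<times> Q))"
    by (simp add: frame_def inner_add_left inner_add_right PQ c s)
  show "frame Q (P \<times> Q)" by (simp add: frame_def PQ c)
qed

text \<open>The vector product with \<open>P \<times> Q\<close> is a quarter turn in the plane orthogonal to it; applying it twice to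
\<open>X\<close> expands \<open>X\<close> in \<open>P\<close> and \<open>Q\<close>.\<close>
lemma frame_plane:
  assumes F: "frame P Q" and X: "norm X = 1" "X \<bullet> (P \<times> Q) = 0"
  obtains \<theta> where "X = cos \<theta> *\<^sub>R P + sin \<theta> *\<^sub>R Q"
proof -
  have PQ: "P \<bullet> P = 1" "Q \<bullet> Q = 1" "P \<bullet> Q = 0" "Q \<bullet> P = 0" using F by (auto simp: frame_def inner_commute)
  define H where "H = P \<times> Q"
  have HX: "H \<times> X = (P \<bullet> X) *\<^sub>R Q - (Q \<bullet> X) *\<^sub>R P"
    using Lagrange[of X P Q] cross_skew[of H X] by (simp add: H_def inner_commute)
  have HP: "H \<times> P = Q" and HQ: "H \<times> Q = - P"
    using Lagrange[of P P Q] Lagrange[of Q P Q] cross_skew[of H P] cross_skew[of H Q] by (simp_all add: H_def PQ)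
  have HH: "H \<bullet> H = 1" "H \<bullet> X = 0" using X by (simp_all add: H_def dot_cross PQ inner_commute)
  have "- X = H \<times> (H \<times> X)" by (simp add: Lagrange HH)
  also have "\<dots> = - ((P \<bullet> X) *\<^sub>R P) - (Q \<bullet> X) *\<^sub>R Q"
    unfolding HX by (simp add: Cross3.right_diff_distrib cross_mult_right HP HQ)
  finally have XX: "X = (P \<bullet> X) *\<^sub>R P + (Q \<bullet> X) *\<^sub>R Q" by (metis add_uminus_conv_diff minus_add_distrib neg_equal_iff_equal)
  have "1 = X \<bullet> X" using X by (simp add: norm_eq_sqrt_inner)
  also have "\<dots> = (P \<bullet> X)\<^sup>2 + (Q \<bullet> X)\<^sup>2"
    by (subst (2) XX) (simp add: inner_add_right inner_commute power2_eq_square)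
  finally obtain \<theta> where "P \<bullet> X = cos \<theta>" "Q \<bullet> X = sin \<theta>" using sincos_total_2pi by metis
  then show thesis using that XX by metis
qed

lemma connected_component_image:
  assumes "continuous_on I g" "connected I" "g ` I \<subseteq> S" "s \<in> I" "t \<in> I"
  shows "connected_component S (g s) (g t)"
  unfolding connected_component_def using connected_continuous_image[OF assms(1,2)] assms(3-5)
  by (intro exI[of _ "g ` I"]) auto

text \<open>First change the radius. Two circular orbits of the same radius meet any line common to their
planes: move along the first orbit to that line, turn the orbital plane about it, and move along
the second orbit.\<close>
lemma circular_connected:
  assumes mu: "\<mu> > 0" "r\<^sub>c > 0" and \<rho>: "\<rho> > r\<^sub>c" "\<rho>' > r\<^sub>c" and F: "frame P Q" "frame P' Q'"
  shows "connected_component (P_plus \<mu> r\<^sub>c) (circular \<mu> \<rho> P Q) (circular \<mu> \<rho>' P' Q')"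
proof -
  let ?c = "connected_component (P_plus \<mu> r\<^sub>c)"
  have radius: "?c (circular \<mu> \<rho> P Q) (circular \<mu> \<rho>' P Q)"
    by (rule connected_component_image[where I = "{r\<^sub>c<..}" and g = "\<lambda>\<rho>. circular \<mu> \<rho> P Q"])
       (use assms circular_in_P_plus in \<open>auto simp: circular_def intro!: continuous_intros\<close>)
  have turn: "?c (circular \<mu> \<rho>' P Q) (circular \<mu> \<rho>' (cos \<theta> *\<^sub>R P + sin \<theta> *\<^sub>R Q) (cos \<theta> *\<^sub>R Q - sin \<theta> *\<^sub>R P))"
    if "frame P Q" for P Q \<theta>
    using connected_component_image[where I = UNIV and s = 0 and t = \<theta> and S = "P_plus \<mu> r\<^sub>c"
        and g = "\<lambda>\<theta>. circular \<mu> \<rho>' (cos \<theta> *\<^sub>R P + sin \<theta> *\<^sub>R Q) (cos \<theta> *\<^sub>R Q - sin \<theta> *\<^sub>R P)"]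
      circular_in_P_plus[OF mu \<rho>(2) frame_rotate(1)[OF that]]
    by (force simp: circular_def intro!: continuous_intros)
  have tilt: "?c (circular \<mu> \<rho>' P Q) (circular \<mu> \<rho>' P (cos \<theta> *\<^sub>R Q + sin \<theta> *\<^sub>R (P \<times> Q)))"
    if "frame P Q" for P Q \<theta>
    using connected_component_image[where I = UNIV and s = 0 and t = \<theta> and S = "P_plus \<mu> r\<^sub>c"
        and g = "\<lambda>\<theta>. circular \<mu> \<rho>' P (cos \<theta> *\<^sub>R Q + sin \<theta> *\<^sub>R (P \<times> Q))"]
      circular_in_P_plus[OF mu \<rho>(2) frame_rotate(2)[OF that]]
    by (force simp: circular_def intro!: continuous_intros)
  have "dim {P \<times> Q, P' \<times> Q'} \<le> card {P \<times> Q, P' \<times> Q'}" by (rule dim_le_card') simp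
  also have "\<dots> \<le> 2" by (simp add: card_insert_if)
  finally obtain Y where Y: "Y \<noteq> 0" "\<And>y. y \<in> span {P \<times> Q, P' \<times> Q'} \<Longrightarrow> orthogonal Y y"
    using orthogonal_to_subspace_exists[of "{P \<times> Q, P' \<times> Q'}"] by auto
  \<comment> \<open>A unit vector common to the two orbital planes, which may coincide.\<close>
  define N where "N = (1 / norm Y) *\<^sub>R Y"
  have N: "norm N = 1" using Y(1) by (simp add: N_def)
  have N0: "N \<bullet> (P \<times> Q) = 0" "N \<bullet> (P' \<times> Q') = 0"
    using Y(2)[OF span_base] by (auto simp: N_def orthogonal_def)
  obtain \<theta> where \<theta>: "N = cos \<theta> *\<^sub>R P + sin \<theta> *\<^sub>R Q" using frame_plane[OF F(1) N N0(1)] .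
  obtain \<theta>' where \<theta>': "N = cos \<theta>' *\<^sub>R P' + sin \<theta>' *\<^sub>R Q'" using frame_plane[OF F(2) N N0(2)] .
  define R where "R = cos \<theta> *\<^sub>R Q - sin \<theta> *\<^sub>R P"
  define R' where "R' = cos \<theta>' *\<^sub>R Q' - sin \<theta>' *\<^sub>R P'"
  have FR: "frame N R" "frame N R'"
    using frame_rotate(1)[OF F(1), of \<theta>] frame_rotate(1)[OF F(2), of \<theta>'] by (simp_all add: \<theta>[symmetric] \<theta>'[symmetric] R_def R'_def)
  have "R \<times> (N \<times> R) = N" using FR(1) by (simp add: Lagrange frame_def inner_commute)
  then have "norm R' = 1" "R' \<bullet> (R \<times> (N \<times> R)) = 0"
    using FR(2) by (simp_all add: frame_def norm_eq_sqrt_inner inner_commute)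
  then obtain \<phi> where \<phi>: "R' = cos \<phi> *\<^sub>R R + sin \<phi> *\<^sub>R (N \<times> R)"
    using frame_plane[OF frame_rotate(3)[OF FR(1)]] by blast
  have "?c (circular \<mu> \<rho>' P Q) (circular \<mu> \<rho>' N R)" using turn[OF F(1), of \<theta>] by (simp add: \<theta>[symmetric] R_def)
  moreover have "?c (circular \<mu> \<rho>' N R) (circular \<mu> \<rho>' N R')" using tilt[OF FR(1), of \<phi>] by (simp add: \<phi>)
  moreover have "?c (circular \<mu> \<rho>' P' Q') (circular \<mu> \<rho>' N R')" using turn[OF F(2), of \<theta>'] by (simp add: \<theta>'[symmetric] R'_def)
  ultimately show ?thesis using radius by (meson connected_component_trans connected_component_sym)
qed

text \<open>Drift to the perigee and then reduce the speed to the circular one. The perigee distance is constant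
along this path.\<close>
lemma P_plus_linked_to_circular:
  assumes mu: "\<mu> > 0" "r\<^sub>c > 0" and x: "x \<in> P_plus \<mu> r\<^sub>c"
  obtains \<rho> P Q where "\<rho> > r\<^sub>c" "frame P Q" "connected_component (P_plus \<mu> r\<^sub>c) x (circular \<mu> \<rho> P Q)"
proof -
  have "x \<in> periodic_region \<mu>" using x by (simp add: P_plus_def)
  from kepler_motion_exists[OF mu(1) this] obtain r v t where km: "kepler_motion \<mu> r v" "(r 0, v 0) = x"
    and t: "t \<ge> 0" "r t \<bullet> v t = 0" "norm (r t) * (norm (v t))\<^sup>2 \<ge> \<mu>" by metis
  have in_P: "(r s, v s) \<in> P_plus \<mu> r\<^sub>c" for s using kepler_motion_stays(2)[OF km(1)] km(2) x by simp
  have "connected_component (P_plus \<mu> r\<^sub>c) (r 0, v 0) (r t, v t)"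
    by (rule connected_component_image[where I = UNIV and s = 0 and t = t and g = "\<lambda>s. (r s, v s)"])
       (use in_P in \<open>auto intro!: continuous_on_Pair kepler_motion_continuous[OF km(1)]\<close>)
  then have drift: "connected_component (P_plus \<mu> r\<^sub>c) x (r t, v t)" unfolding km(2) .
  define \<rho> where "\<rho> = norm (r t)"
  define V where "V = norm (v t)"
  have rt: "r t \<noteq> 0" using km(1) unfolding kepler_motion_def by blast
  have "perigee \<mu> (r t, v t) = \<rho>" unfolding \<rho>_def by (rule perigee_at_apsis[OF mu(1) rt t(2,3)])
  then have \<rho>: "\<rho> > r\<^sub>c" "\<rho> > 0" using in_P[of t] mu by (auto simp: P_plus_def)
  have "V\<^sup>2 / 2 < \<mu> / \<rho>" using in_P[of t] by (simp add: P_plus_def periodic_region_def energy_def V_def \<rho>_def)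
  then have V2: "\<rho> * V\<^sup>2 < 2 * \<mu>" using \<rho> by (simp add: field_simps)
  have V1: "\<rho> * V\<^sup>2 \<ge> \<mu>" using t(3) by (simp add: \<rho>_def V_def)
  have V: "V > 0" using V1 mu \<rho> unfolding V_def by (cases "v t = 0") auto
  \<comment> \<open>The factor that reduces the perigee speed to the circular speed.\<close>
  define k where "k = sqrt (\<mu> / \<rho>) / V"
  have k: "0 < k" "k\<^sup>2 * (\<rho> * V\<^sup>2) = \<mu>" using mu \<rho> V by (auto simp: k_def power_divide)
  have "k\<^sup>2 * (\<rho> * V\<^sup>2) \<le> 1\<^sup>2 * (\<rho> * V\<^sup>2)" using k(2) V1 by simp
  then have "k\<^sup>2 \<le> 1\<^sup>2" by (rule mult_right_le_imp_le) (use V1 mu in linarith)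
  then have k1: "k \<le> 1" by (rule power2_le_imp_le) simp
  have slow: "connected_component (P_plus \<mu> r\<^sub>c) (r t, 1 *\<^sub>R v t) (r t, k *\<^sub>R v t)"
  proof (rule connected_component_image[where I = "{k..1}" and g = "\<lambda>s. (r t, s *\<^sub>R v t)"])
    show "(\<lambda>s. (r t, s *\<^sub>R v t)) ` {k..1} \<subseteq> P_plus \<mu> r\<^sub>c"
    proof clarify
      fix s assume s: "s \<in> {k..1}"
      have sq: "norm (r t) * (norm (s *\<^sub>R v t))\<^sup>2 = s\<^sup>2 * (\<rho> * V\<^sup>2)"
        by (simp add: power_mult_distrib \<rho>_def V_def)
      have "k\<^sup>2 * (\<rho> * V\<^sup>2) \<le> s\<^sup>2 * (\<rho> * V\<^sup>2)" using s k \<rho> by (intro mult_right_mono power_mono) auto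
      moreover have "s\<^sup>2 * (\<rho> * V\<^sup>2) \<le> 1 * (\<rho> * V\<^sup>2)"
        using s k \<rho> by (intro mult_right_mono) (auto simp: power_le_one)
      ultimately have "\<mu> \<le> norm (r t) * (norm (s *\<^sub>R v t))\<^sup>2" "norm (r t) * (norm (s *\<^sub>R v t))\<^sup>2 < 2 * \<mu>"
        unfolding sq using k(2) V2 by linarith+
      moreover have "r t \<bullet> (s *\<^sub>R v t) = 0" "norm (r t) > r\<^sub>c" using t(2) \<rho> by (simp_all add: \<rho>_def)
      ultimately show "(r t, s *\<^sub>R v t) \<in> P_plus \<mu> r\<^sub>c" by (intro apsis_in_P_plus mu)
    qed
  qed (use k1 in \<open>auto intro!: continuous_intros\<close>)
  have "(r t, k *\<^sub>R v t) = circular \<mu> \<rho> ((1 / \<rho>) *\<^sub>R r t) ((1 / V) *\<^sub>R v t)"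
    using \<rho> V by (simp add: circular_def k_def)
  moreover have "frame ((1 / \<rho>) *\<^sub>R r t) ((1 / V) *\<^sub>R v t)"
    using \<rho> V t(2) by (simp add: frame_def) (simp add: \<rho>_def V_def flip: power2_norm_eq_inner power2_eq_square)
  ultimately show thesis
    using that[OF \<rho>(1)] connected_component_trans[OF drift] slow by (simp add: scaleR_one)
qed

lemma connected_P_plus:
  assumes "\<mu> > 0" "r\<^sub>c > 0"
  shows "connected (P_plus \<mu> r\<^sub>c)"
  unfolding connected_iff_connected_component
proof (intro ballI)
  fix x y assume xy: "x \<in> P_plus \<mu> r\<^sub>c" "y \<in> P_plus \<mu> r\<^sub>c"
  obtain \<rho> P Q where 1: "\<rho> > r\<^sub>c" "frame P Q" "connected_component (P_plus \<mu> r\<^sub>c) x (circular \<mu> \<rho> P Q)"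
    using P_plus_linked_to_circular[OF assms xy(1)] .
  obtain \<rho>' P' Q' where 2: "\<rho>' > r\<^sub>c" "frame P' Q'" "connected_component (P_plus \<mu> r\<^sub>c) y (circular \<mu> \<rho>' P' Q')"
    using P_plus_linked_to_circular[OF assms xy(2)] .
  show "connected_component (P_plus \<mu> r\<^sub>c) x y"
    using circular_connected[OF assms 1(1) 2(1) 1(2) 2(2)] 1(3) 2(3)
    by (meson connected_component_trans connected_component_sym)
qed

lemma P_plus_nonempty:
  assumes "\<mu> > 0" "r\<^sub>c > 0"
  shows "P_plus \<mu> r\<^sub>c \<noteq> {}"
proof -
  have "frame (axis 1 1) (axis 2 1)" by (simp add: frame_def inner_vec_def sum_3 axis_def)
  from circular_in_P_plus[OF assms less_add_one this] show ?thesis by blast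
qed

text \<open>Mutual reachability is an equivalence relation on \<open>P_plus\<close>. Its classes are open, since one revolution
of the Kepler orbit through a point can be corrected so as to start or end anywhere nearby; and
\<open>P_plus\<close> is connected.\<close>
theorem steers_within_P_plus:
  assumes pos: "\<mu> > 0" "\<beta> > 0" "r\<^sub>c > 0" "\<tau> > 0" "m > 0"
    and xy: "x \<in> P_plus \<mu> r\<^sub>c" "y \<in> P_plus \<mu> r\<^sub>c"
  obtains m' where "0 < m'" "m' \<le> m" "steers \<mu> \<beta> r\<^sub>c \<tau> (x, m) (y, m')"
proof -
  \<comment> \<open>All masses up to \<open>m\<close> are admitted because fuel is spent on the way; this makes the relation
  transitive.\<close>
  define S where "S = (\<lambda>x y. \<forall>n. 0 < n \<and> n \<le> m \<longrightarrow> (\<exists>n'. 0 < n' \<and> n' \<le> n \<and> steers \<mu> \<beta> r\<^sub>c \<tau> (x, n) (y, n')))"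
  have trans: "S x z" if "S x y" "S y z" for x y z
    unfolding S_def
  proof (intro allI impI)
    fix n assume n: "0 < n \<and> n \<le> m"
    obtain n1 where n1: "0 < n1" "n1 \<le> n" "steers \<mu> \<beta> r\<^sub>c \<tau> (x, n) (y, n1)"
      using \<open>S x y\<close> n unfolding S_def by blast
    have "n1 \<le> m" using n n1 by linarith
    then obtain n2 where n2: "0 < n2" "n2 \<le> n1" "steers \<mu> \<beta> r\<^sub>c \<tau> (y, n1) (z, n2)"
      using \<open>S y z\<close> n1 unfolding S_def by blast
    have "n2 \<le> n" using n1 n2 by linarith
    then show "\<exists>n'. 0 < n' \<and> n' \<le> n \<and> steers \<mu> \<beta> r\<^sub>c \<tau> (x, n) (z, n')"
      using steers_trans[OF pos(1-3) n1(3) n2(3)] n2 by blast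
  qed
  have "S x y \<and> S y x"
  proof (rule connected_equivalence_relation[OF connected_P_plus[OF pos(1,3)] xy, of "\<lambda>x y. S x y \<and> S y x"])
    fix a assume a: "a \<in> P_plus \<mu> r\<^sub>c"
    then have "a \<in> periodic_region \<mu>" by (simp add: P_plus_def)
    from kepler_motion_exists[OF pos(1) this] obtain r v T where km: "kepler_motion \<mu> r v"
      "(r 0, v 0) = a" "T > 0" "(r T, v T) = a" by metis
    have "(r t, v t) \<in> admissible_region \<mu> r\<^sub>c" for t
      using kepler_motion_stays(2)[OF km(1)] km(2) a P_plus_admissible[OF pos(1)] by auto
    then obtain \<delta> where \<delta>: "\<delta> > 0" "\<And>x y n. \<lbrakk>dist x a < \<delta>; dist y a < \<delta>; 0 < n; n \<le> m\<rbrakk> \<Longrightarrow>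
        \<exists>n'. 0 < n' \<and> n' \<le> n \<and> steers \<mu> \<beta> r\<^sub>c \<tau> (x, n) (y, n')"
      using steers_near_kepler_arc[OF pos(1-5) km(3) km(1)] km(2,4) by metis
    have "S a b \<and> S b a" if "dist b a < \<delta>" for b
      unfolding S_def using \<delta> that by auto
    then show "\<exists>T. openin (top_of_set (P_plus \<mu> r\<^sub>c)) T \<and> a \<in> T \<and> (\<forall>x\<in>T. S a x \<and> S x a)"
      using a \<delta>(1)
      by (intro exI[of _ "P_plus \<mu> r\<^sub>c \<inter> ball a \<delta>"]) (auto simp: dist_commute)
  qed (use trans in blast)+
  then show thesis using that pos unfolding S_def by blast
qed

section \<open>Insertion with large thrust\<close>

text \<open>The velocity goes to the circular velocity of the current distance along a straight segment. It keeps
a positive transverse component in a fixed direction and stays in the ball of elliptic speeds, so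
with the position frozen the segment is admissible. If the maneuver is short enough, the true
position stays so close that this persists.\<close>
lemma steers_into_P_plus:
  assumes pos: "\<mu> > 0" "\<beta> > 0" "r\<^sub>c > 0" "m > 0" and x: "x \<in> admissible_region \<mu> r\<^sub>c"
  obtains \<tau> y m' where "\<tau> > 0" "y \<in> P_plus \<mu> r\<^sub>c" "m' > 0" "steers \<mu> \<beta> r\<^sub>c \<tau> (x, m) (y, m')"
proof -
  obtain r\<^sub>0 v\<^sub>0 where x_eq: "x = (r\<^sub>0, v\<^sub>0)" by fastforce
  define \<rho> where "\<rho> = norm r\<^sub>0"
  have \<rho>: "\<rho> > r\<^sub>c" "\<rho> > 0" "r\<^sub>0 \<noteq> 0" and h: "r\<^sub>0 \<times> v\<^sub>0 \<noteq> 0" and E: "(norm v\<^sub>0)\<^sup>2 / 2 < \<mu> / \<rho>"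
    using x pos by (auto simp: x_eq \<rho>_def admissible_region_def periodic_region_def ang_mom_def energy_def)
  \<comment> \<open>The transverse component of the velocity; rescaled to circular speed it is the target velocity.\<close>
  define w where "w = v\<^sub>0 - ((r\<^sub>0 \<bullet> v\<^sub>0) / \<rho>\<^sup>2) *\<^sub>R r\<^sub>0"
  have rw: "r\<^sub>0 \<times> w = r\<^sub>0 \<times> v\<^sub>0" by (simp add: w_def Cross3.right_diff_distrib cross_mult_right)
  have w0: "w \<noteq> 0" using rw h by auto
  have "r\<^sub>0 \<bullet> r\<^sub>0 = \<rho>\<^sup>2" by (simp add: \<rho>_def power2_norm_eq_inner)
  then have rw0: "r\<^sub>0 \<bullet> w = 0" using \<rho> by (simp add: w_def inner_diff_right)
  define c where "c = sqrt (\<mu> / \<rho>) / norm w"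
  have c: "c > 0" using pos \<rho> w0 by (simp add: c_def)
  define v\<^sub>f where "v\<^sub>f = c *\<^sub>R w"
  have nvf: "norm v\<^sub>f = sqrt (\<mu> / \<rho>)" using c w0 pos \<rho> by (simp add: v\<^sub>f_def c_def)
  have vf2: "\<rho> * (norm v\<^sub>f)\<^sup>2 = \<mu>" using \<rho> pos by (simp add: nvf)
  have target: "(r\<^sub>0, v\<^sub>f) \<in> P_plus \<mu> r\<^sub>c"
    using pos \<rho> rw0 vf2 by (intro apsis_in_P_plus) (auto simp: v\<^sub>f_def \<rho>_def)
  define d where "d = v\<^sub>f - v\<^sub>0"
  have seg: "(r\<^sub>0, v\<^sub>0 + s *\<^sub>R d) \<in> admissible_region \<mu> r\<^sub>c" if s: "s \<in> {0..1}" for s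
  proof -
    have "r\<^sub>0 \<times> (v\<^sub>0 + s *\<^sub>R d) = (1 - s + s * c) *\<^sub>R (r\<^sub>0 \<times> v\<^sub>0)"
      by (simp add: d_def v\<^sub>f_def cross_add_right cross_mult_right Cross3.right_diff_distrib rw algebra_simps)
    moreover have "1 - s + s * c > 0" using s c by (cases "s = 0") (auto intro!: add_nonneg_pos)
    ultimately have "ang_mom (r\<^sub>0, v\<^sub>0 + s *\<^sub>R d) \<noteq> 0" using h by (simp add: ang_mom_def)
    moreover have "energy \<mu> (r\<^sub>0, v\<^sub>0 + s *\<^sub>R d) < 0"
    proof -
      define b where "b = sqrt (2 * (\<mu> / \<rho>))"
      have "(norm v\<^sub>0)\<^sup>2 < 2 * (\<mu> / \<rho>)" using E by linarith
      then have n0: "norm v\<^sub>0 < b" unfolding b_def by (rule real_less_rsqrt)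
      have "\<mu> / \<rho> > 0" using pos \<rho> by simp
      then have nf: "norm v\<^sub>f < b" unfolding nvf b_def by (intro real_sqrt_less_mono) linarith
      have "v\<^sub>0 + s *\<^sub>R d = (1 - s) *\<^sub>R v\<^sub>0 + s *\<^sub>R v\<^sub>f" by (simp add: d_def algebra_simps)
      then have "norm (v\<^sub>0 + s *\<^sub>R d) \<le> (1 - s) * norm v\<^sub>0 + s * norm v\<^sub>f"
        using norm_triangle_ineq[of "(1 - s) *\<^sub>R v\<^sub>0" "s *\<^sub>R v\<^sub>f"] s by simp
      also have "\<dots> < b" using n0 nf s by (intro convex_bound_lt) auto
      finally have "(norm (v\<^sub>0 + s *\<^sub>R d))\<^sup>2 < b\<^sup>2" by (intro power_strict_mono) auto
      also have "b\<^sup>2 = 2 * (\<mu> / \<rho>)" unfolding b_def using pos \<rho> by simp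
      finally show ?thesis by (simp add: energy_def \<rho>_def mult.commute)
    qed
    ultimately show ?thesis using \<rho> by (simp add: admissible_region_def periodic_region_def \<rho>_def)
  qed
  have "continuous_on {0..1} (\<lambda>s. (r\<^sub>0, v\<^sub>0 + s *\<^sub>R d))" by (intro continuous_intros)
  then have comp: "compact ((\<lambda>s. (r\<^sub>0, v\<^sub>0 + s *\<^sub>R d)) ` {0..1})" by (rule compact_continuous_image) auto
  obtain e1 where e1: "e1 > 0" "(\<Union>x\<in>(\<lambda>s. (r\<^sub>0, v\<^sub>0 + s *\<^sub>R d)) ` {0..1}. ball x e1) \<subseteq> admissible_region \<mu> r\<^sub>c"
    using compact_subset_open_imp_ball_epsilon_subset[OF comp open_admissible_region] seg by blast
  have "open (P_plus \<mu> r\<^sub>c)" unfolding P_plus_def by (rule open_perigee_gt[OF pos(1)])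
  then obtain e2 where e2: "e2 > 0" "ball (r\<^sub>0, v\<^sub>f) e2 \<subseteq> P_plus \<mu> r\<^sub>c"
    using target open_contains_ball by blast
  define B where "B = norm v\<^sub>0 + norm d + 1"
  have B: "B > 0" unfolding B_def by (intro add_nonneg_pos add_nonneg_nonneg) auto
  define \<eta> where "\<eta> = min e1 e2 / (2 * B)"
  have \<eta>: "\<eta> > 0" "\<eta> * B < e1" "\<eta> * B < e2" using e1(1) e2(1) B by (auto simp: \<eta>_def min_def field_simps)
  define r where "r = (\<lambda>t. r\<^sub>0 + t *\<^sub>R v\<^sub>0 + (t\<^sup>2 / (2 * \<eta>)) *\<^sub>R d)"
  define v where "v = (\<lambda>t. v\<^sub>0 + (t / \<eta>) *\<^sub>R d)"
  have near: "dist (r\<^sub>0, v t) (r t, v t) \<le> \<eta> * B" if t: "t \<in> {0..\<eta>}" for t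
  proof -
    have "dist (r\<^sub>0, v t) (r t, v t) = norm (t *\<^sub>R v\<^sub>0 + (t\<^sup>2 / (2 * \<eta>)) *\<^sub>R d)"
      by (subst dist_commute) (simp add: dist_Pair_Pair r_def dist_norm)
    also have "\<dots> \<le> t * norm v\<^sub>0 + t\<^sup>2 / (2 * \<eta>) * norm d"
      using norm_triangle_ineq[of "t *\<^sub>R v\<^sub>0" "(t\<^sup>2 / (2 * \<eta>)) *\<^sub>R d"] t \<eta> by simp
    also have "\<dots> \<le> \<eta> * norm v\<^sub>0 + \<eta> * norm d"
    proof (intro add_mono mult_right_mono)
      have "t\<^sup>2 \<le> \<eta>\<^sup>2" using t by (intro power_mono) auto
      moreover have "\<eta> * (2 * \<eta>) = 2 * \<eta>\<^sup>2" by (simp add: power2_eq_square)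
      ultimately have "t\<^sup>2 \<le> \<eta> * (2 * \<eta>)" using zero_le_power2[of \<eta>] by linarith
      then show "t\<^sup>2 / (2 * \<eta>) \<le> \<eta>" using \<eta>(1) by (simp add: pos_divide_le_eq)
    qed (use t in auto)
    also have "\<dots> \<le> \<eta> * B" using \<eta>(1) by (simp add: B_def algebra_simps)
    finally show ?thesis .
  qed
  have adm: "(r t, v t) \<in> admissible_region \<mu> r\<^sub>c" if t: "t \<in> {0..\<eta>}" for t
  proof -
    have "(r t, v t) \<in> ball (r\<^sub>0, v\<^sub>0 + (t / \<eta>) *\<^sub>R d) e1" using near[OF t] \<eta>(2) by (simp add: v_def)
    moreover have "t / \<eta> \<in> {0..1}" using t \<eta> by (simp add: field_simps)
    ultimately show ?thesis using e1(2) by blast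
  qed
  define \<tau> where "\<tau> = m * (norm ((1 / \<eta>) *\<^sub>R d) + \<mu> / r\<^sub>c\<^sup>2)"
  have "0 < norm ((1 / \<eta>) *\<^sub>R d) + \<mu> / r\<^sub>c\<^sup>2" using pos by (intro add_nonneg_pos) auto
  then have \<tau>: "\<tau> > 0" using pos by (simp add: \<tau>_def)
  have "\<exists>m'. 0 < m' \<and> m' \<le> m \<and> steers \<mu> \<beta> r\<^sub>c \<tau> ((r 0, v 0), m) ((r \<eta>, v \<eta>), m')"
  proof (rule steers_along_smooth_path[OF pos less_imp_le[OF \<eta>(1)], where w = "\<lambda>t. (1 / \<eta>) *\<^sub>R d"])
    fix t assume t: "t \<in> {0..\<eta>}"
    show "(r has_vector_derivative v t) (at t)"
      unfolding r_def v_def using \<eta>(1)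
      by (auto intro!: derivative_eq_intros has_vector_derivative_scaleR simp: field_simps
          simp flip: has_real_derivative_iff_has_vector_derivative)
    show "(v has_vector_derivative (1 / \<eta>) *\<^sub>R d) (at t)"
      unfolding v_def using \<eta>(1)
      by (auto intro!: derivative_eq_intros has_vector_derivative_scaleR simp: field_simps
          simp flip: has_real_derivative_iff_has_vector_derivative)
    show "(r t, v t) \<in> admissible_region \<mu> r\<^sub>c" by (rule adm[OF t])
    have "norm ((1 / \<eta>) *\<^sub>R d + gravity \<mu> (r t)) \<le> norm ((1 / \<eta>) *\<^sub>R d) + \<mu> / r\<^sub>c\<^sup>2"
      by (intro order_trans[OF norm_triangle_ineq] add_mono order_refl
          admissible_bounds(4)[OF pos(1,3) adm[OF t]])
    then show "m * norm ((1 / \<eta>) *\<^sub>R d + gravity \<mu> (r t)) \<le> \<tau>"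
      unfolding \<tau>_def using pos by (intro mult_left_mono) auto
  qed auto
  moreover have "r 0 = r\<^sub>0" "v 0 = v\<^sub>0" "v \<eta> = v\<^sub>f" using \<eta>(1) by (simp_all add: r_def v_def d_def)
  moreover have "(r \<eta>, v\<^sub>f) \<in> P_plus \<mu> r\<^sub>c"
  proof -
    have "(r \<eta>, v\<^sub>f) \<in> ball (r\<^sub>0, v\<^sub>f) e2" using near[of \<eta>] \<eta> \<open>v \<eta> = v\<^sub>f\<close> by simp
    then show ?thesis using e2(2) by blast
  qed
  ultimately show thesis using that[OF \<tau>] unfolding x_eq by metis
qed

section \<open>Reaching safe orbits with less thrust\<close>

lemma continuous_on_indefinite_integral:
  fixes F :: "real \<Rightarrow> 'a::euclidean_space"
  assumes "\<And>t. t \<in> {0..T} \<Longrightarrow> (f has_integral (F t - F 0)) {0..t}"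
  shows "continuous_on {0..T} F"
proof (cases "T \<ge> 0")
  case True
  then have "f integrable_on {0..T}" using assms[of T] by auto
  then have "continuous_on {0..T} (\<lambda>t. F 0 + integral {0..t} f)"
    by (intro continuous_intros indefinite_integral_continuous_1)
  moreover have "F 0 + integral {0..t} f = F t" if "t \<in> {0..T}" for t
    using integral_unique[OF assms[OF that]] by simp
  ultimately show ?thesis by (rule continuous_on_eq)
qed auto

lemma steers_components:
  assumes "steers \<mu> \<beta> r\<^sub>c \<tau> (x, m\<^sub>0) (y, m\<^sub>1)"
  obtains T u r v m where "T \<ge> 0" "control \<tau> T u"
    "admissible_trajectory \<mu> \<beta> r\<^sub>c T u (\<lambda>t. (r t, v t)) m" "(r 0, v 0) = x" "m 0 = m\<^sub>0" "(r T, v T) = y"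
proof -
  obtain T u X m where T: "T \<ge> 0" and u: "control \<tau> T u"
    and adm: "admissible_trajectory \<mu> \<beta> r\<^sub>c T u X m" and ends: "(X 0, m 0) = (x, m\<^sub>0)" "(X T, m T) = (y, m\<^sub>1)"
    using assms unfolding steers_def by blast
  show thesis
    using that[of T u "fst \<circ> X" "snd \<circ> X" m] T u adm ends by simp
qed

lemma admissible_trajectory_components:
  assumes "\<mu> > 0" "\<beta> > 0" "r\<^sub>c > 0" "T \<ge> 0" "control \<tau> T u"
    and adm: "admissible_trajectory \<mu> \<beta> r\<^sub>c T u (\<lambda>t. (r t, v t)) m" and t: "t \<in> {0..T}"
  shows "(r t, v t) \<in> admissible_region \<mu> r\<^sub>c"
    and "(v has_integral (r t - r 0)) {0..t}"
    and "((\<lambda>s. (1 / m s) *\<^sub>R u s - gravity \<mu> (r s)) has_integral (v t - v 0)) {0..t}"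
    and "((\<lambda>s. - \<beta> * norm (u s)) has_integral (m t - m 0)) {0..t}"
proof -
  note I = adm[unfolded admissible_trajectory_iff[OF assms(1-5)]]
  show "(r t, v t) \<in> admissible_region \<mu> r\<^sub>c" using I t by blast
  show "(v has_integral (r t - r 0)) {0..t}"
    "((\<lambda>s. (1 / m s) *\<^sub>R u s - gravity \<mu> (r s)) has_integral (v t - v 0)) {0..t}"
    "((\<lambda>s. - \<beta> * norm (u s)) has_integral (m t - m 0)) {0..t}"
    using bspec[OF conjunct2[OF I] t] unfolding sat_field_eq diff_Pair has_integral_Pair_iff by blast+
qed

text \<open>Integration gains the factor \<open>1 / K\<close> over an exponential bound with rate \<open>K\<close>.\<close>
lemma norm_integral_exp_bound:
  fixes f :: "real \<Rightarrow> 'a::euclidean_space"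
  assumes "f integrable_on {0..t}" "t \<ge> 0" "K > 0" "c \<ge> 0"
    and "\<And>s. s \<in> {0..t} \<Longrightarrow> norm (f s) \<le> c * exp (K * s)"
  shows "norm (integral {0..t} f) \<le> c * exp (K * t) / K"
proof -
  have I: "((\<lambda>s. c * exp (K * s)) has_integral (c * exp (K * t) / K - c * exp (K * 0) / K)) {0..t}"
    using assms(2,3) by (intro fundamental_theorem_of_calculus)
      (auto intro!: derivative_eq_intros simp flip: has_real_derivative_iff_has_vector_derivative)
  have "norm (integral {0..t} f) \<le> integral {0..t} (\<lambda>s. c * exp (K * s))"
    using assms(5) by (intro integral_norm_bound_integral assms(1) has_integral_integrable[OF I]) auto
  also have "\<dots> \<le> c * exp (K * t) / K" using integral_unique[OF I] assms(3,4) by simp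
  finally show ?thesis .
qed

text \<open>Uniqueness for the linear equation of the mass, which is the rocket equation along a given
trajectory.\<close>
lemma mass_formula:
  fixes m f :: "real \<Rightarrow> real"
  assumes meas: "f \<in> borel_measurable (lebesgue_on {0..T})"
    and bnd: "\<And>t. t \<in> {0..T} \<Longrightarrow> 0 \<le> f t \<and> f t \<le> K"
    and m: "\<And>t. t \<in> {0..T} \<Longrightarrow> ((\<lambda>s. - (f s * m s)) has_integral (m t - m 0)) {0..t}"
    and t: "t \<in> {0..T}"
  shows "m t = m 0 * exp (- integral {0..t} f)"
proof -
  define n where "n = (\<lambda>t. m 0 * exp (- integral {0..t} f))"
  have n: "((\<lambda>s. - (f s * n s)) has_integral (n t - n 0)) {0..t}" if "t \<in> {0..T}" for t
    using has_integral_mult_right[OF has_integral_exp_neg_integral[OF meas bnd that], of "m 0"]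
    by (simp add: n_def algebra_simps)
  have K: "K \<ge> 0" using bnd[OF t] by linarith
  define d where "d = (\<lambda>t. \<bar>m t - n t\<bar>)"
  have cont: "continuous_on {0..T} d"
    unfolding d_def
    by (intro continuous_intros continuous_on_indefinite_integral[OF m] continuous_on_indefinite_integral[OF n])
  have "d t \<le> 0 * exp (K * t)"
  proof (rule gronwall[OF cont _ K t])
    fix t assume t: "t \<in> {0..T}"
    have I: "((\<lambda>s. - (f s * m s) - - (f s * n s)) has_integral (m t - m 0 - (n t - n 0))) {0..t}"
      by (intro has_integral_diff m n t)
    have "d t = norm (integral {0..t} (\<lambda>s. - (f s * m s) - - (f s * n s)))"
      unfolding integral_unique[OF I] by (simp add: d_def n_def)
    also have "\<dots> \<le> integral {0..t} (\<lambda>s. K * d s)"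
    proof (rule integral_norm_bound_integral)
      show "(\<lambda>s. - (f s * m s) - - (f s * n s)) integrable_on {0..t}" using I by blast
      show "(\<lambda>s. K * d s) integrable_on {0..t}"
        using t by (intro integrable_continuous_real continuous_intros continuous_on_subset[OF cont]) auto
      fix s assume s: "s \<in> {0..t}"
      have "norm (- (f s * m s) - - (f s * n s)) = f s * d s"
        using bnd[of s] s t by (simp add: d_def flip: abs_mult right_diff_distrib) (simp add: abs_mult abs_minus_commute)
      then show "norm (- (f s * m s) - - (f s * n s)) \<le> K * d s"
        using bnd[of s] s t by (simp add: d_def mult_right_mono)
    qed
    finally show "d t \<le> 0 + K * integral {0..t} d" by simp
  qed
  then show ?thesis by (simp add: d_def n_def)
qed

text \<open>The acceleration \<open>a\<close> is replaced by \<open>b\<close>, which is \<open>(1 - \<kappa> t) *\<^sub>R a t\<close> up to the change of gravity due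
to the displacement \<open>z\<close> of the path. With the weight \<open>\<kappa> t = k * exp (K * t)\<close> the displacement is at
most of order \<open>\<kappa> t / K\<^sup>2\<close>, and the mass grows at most by a factor \<open>exp (\<kappa> t / 4)\<close>. Thus, for large
\<open>K\<close>, the reduction by \<open>\<kappa> t\<close> prevails at every time, and \<open>\<kappa> t \<ge> k\<close> makes it uniform.\<close>
lemma steers_with_less_thrust:
  assumes pos: "\<mu> > 0" "\<beta> > 0" "r\<^sub>c > 0" "\<tau> > 0" "m\<^sub>0 > 0"
    and x\<^sub>f: "x\<^sub>f \<in> P_plus \<mu> r\<^sub>c" and st: "steers \<mu> \<beta> r\<^sub>c \<tau> (x, m\<^sub>0) (x\<^sub>f, m\<^sub>f)"
  obtains \<tau>' y m' where "0 < \<tau>'" "\<tau>' < \<tau>" "y \<in> P_plus \<mu> r\<^sub>c" "m' > 0"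
    "steers \<mu> \<beta> r\<^sub>c \<tau>' (x, m\<^sub>0) (y, m')"
proof -
  obtain T u r v m where T: "T \<ge> 0" and u: "control \<tau> T u"
    and traj: "admissible_trajectory \<mu> \<beta> r\<^sub>c T u (\<lambda>t. (r t, v t)) m"
    and ends: "(r 0, v 0) = x" "m 0 = m\<^sub>0" "(r T, v T) = x\<^sub>f"
    by (rule steers_components[OF st])
  note comps = admissible_trajectory_components[OF pos(1-3) T u traj]
  note adm = comps(1) and r_int = comps(2) and v_int = comps(3) and m_int = comps(4)
  obtain M where M: "M > 0" "\<And>t. t \<in> {0..T} \<Longrightarrow> m t \<ge> M"
    using traj unfolding admissible_trajectory_def by blast
  have u_meas: "u \<in> borel_measurable (lebesgue_on {0..T})" and u_bnd: "\<And>t. t \<in> {0..T} \<Longrightarrow> norm (u t) \<le> \<tau>"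
    using u by (auto simp: control_def)
  have m_pos: "m t > 0" if "t \<in> {0..T}" for t using M(2)[OF that] M(1) by linarith
  have r_cont: "continuous_on {0..T} r" and v_cont: "continuous_on {0..T} v" and m_cont: "continuous_on {0..T} m"
    using continuous_on_indefinite_integral[OF r_int] continuous_on_indefinite_integral[OF v_int]
      continuous_on_indefinite_integral[OF m_int] by blast+
  define a where "a = (\<lambda>t. (1 / m t) *\<^sub>R u t)"
  define A where "A = \<tau> / M"
  have A: "A > 0" using pos M(1) by (simp add: A_def)
  have a_meas: "a \<in> borel_measurable (lebesgue_on {0..T})"
  proof -
    have "(\<lambda>t. 1 / m t) \<in> borel_measurable (lebesgue_on {0..T})"
      using m_pos by (intro continuous_imp_measurable_on_sets_lebesgue continuous_intros m_cont) force+
    then show ?thesis unfolding a_def using u_meas by measurable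
  qed
  have a_bnd: "norm (a t) \<le> A" if t: "t \<in> {0..T}" for t
    using u_bnd[OF t] M(1) M(2)[OF t] m_pos[OF t] pos by (auto simp: a_def A_def intro!: frac_le)
  have ma: "m t * norm (a t) = norm (u t)" if t: "t \<in> {0..T}" for t
    using m_pos[OF t] by (simp add: a_def)
  define \<Phi> where "\<Phi> = (\<lambda>t. integral {0..t} (\<lambda>s. norm (a s)))"
  have m_eq: "m t = m\<^sub>0 * exp (- (\<beta> * \<Phi> t))" if t: "t \<in> {0..T}" for t
  proof -
    have "m t = m 0 * exp (- integral {0..t} (\<lambda>s. \<beta> * norm (a s)))"
    proof (rule mass_formula[where K = "\<beta> * A", OF _ _ _ t])
      show "(\<lambda>s. \<beta> * norm (a s)) \<in> borel_measurable (lebesgue_on {0..T})" using a_meas by measurable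
      fix t assume t: "t \<in> {0..T}"
      show "0 \<le> \<beta> * norm (a t) \<and> \<beta> * norm (a t) \<le> \<beta> * A" using a_bnd[OF t] pos by simp
      show "((\<lambda>s. - (\<beta> * norm (a s) * m s)) has_integral (m t - m 0)) {0..t}"
        by (rule has_integral_eq[OF _ m_int[OF t]]) (use ma t in \<open>auto simp: mult.assoc mult.commute\<close>)
    qed
    then show ?thesis by (simp add: ends(2) \<Phi>_def)
  qed
  define L where "L = 4 * \<mu> / r\<^sub>c ^ 3"
  have L: "L > 0" using pos by (simp add: L_def)
  \<comment> \<open>The summands of \<open>K\<close> serve, in this order, to have \<open>K \<le> K\<^sup>2\<close>, to bound the change of gravity by
  \<open>A * \<kappa> t\<close>, to bound the exponent in the change of mass by \<open>\<kappa> t / 4\<close>, and to bound the thrust that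
  the change of gravity costs by \<open>\<tau> * \<kappa> t / 4\<close>.\<close>
  define K where "K = 1 + L + 8 * \<beta> * A + 4 * m\<^sub>0 * L * A / \<tau>"
  have K1: "K \<ge> 1" and KL: "K \<ge> L" and K8: "K \<ge> 8 * \<beta> * A" and K4: "K \<ge> 4 * m\<^sub>0 * L * A / \<tau>"
    using pos L A by (simp_all add: K_def)
  have K0: "K > 0" using K1 by linarith
  have KK: "K \<le> K\<^sup>2" using K1 by (simp add: power2_eq_square)
  obtain \<epsilon> where \<epsilon>: "\<epsilon> > 0" "(\<Union>x\<in>(\<lambda>t. (r t, v t)) ` {0..T}. ball x \<epsilon>) \<subseteq> admissible_region \<mu> r\<^sub>c"
    using compact_subset_open_imp_ball_epsilon_subset[OF compact_continuous_image[OF continuous_on_Pair[OF r_cont v_cont] compact_Icc]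
        open_admissible_region, of \<mu> r\<^sub>c] adm by blast
  have "open (P_plus \<mu> r\<^sub>c)" unfolding P_plus_def by (rule open_perigee_gt[OF pos(1)])
  then obtain \<epsilon>' where \<epsilon>': "\<epsilon>' > 0" "ball x\<^sub>f \<epsilon>' \<subseteq> P_plus \<mu> r\<^sub>c"
    using x\<^sub>f open_contains_ball by blast
  \<comment> \<open>Up to the final time \<open>\<kappa>\<close> is at most \<open>1\<close>, and the displacement stays below \<open>\<epsilon>\<close> and \<open>\<epsilon>'\<close>.\<close>
  define k where "k = min 1 (min \<epsilon> \<epsilon>' / (4 * A)) * exp (- (K * T))"
  have k: "k > 0" using \<epsilon> \<epsilon>' A by (simp add: k_def)
  define \<kappa> where "\<kappa> = (\<lambda>t. k * exp (K * t))"
  have \<kappa>_T: "\<kappa> T = min 1 (min \<epsilon> \<epsilon>' / (4 * A))" by (simp add: \<kappa>_def k_def mult.assoc flip: exp_add)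
  have \<kappa>_le: "k \<le> \<kappa> t" "\<kappa> t \<le> \<kappa> T" if "t \<in> {0..T}" for t
    using that k K0 by (auto simp: \<kappa>_def)
  have \<kappa>_bnd: "0 < \<kappa> t" "\<kappa> t \<le> 1" "2 * (A * \<kappa> t) < \<epsilon>" "2 * (A * \<kappa> t) < \<epsilon>'" if t: "t \<in> {0..T}" for t
  proof -
    show "0 < \<kappa> t" using k by (simp add: \<kappa>_def)
    show "\<kappa> t \<le> 1" using \<kappa>_le(2)[OF t] \<kappa>_T by linarith
    have "\<kappa> t \<le> min \<epsilon> \<epsilon>' / (4 * A)" using \<kappa>_le(2)[OF t] \<kappa>_T by linarith
    then have "4 * (A * \<kappa> t) \<le> min \<epsilon> \<epsilon>'" using A by (simp add: pos_le_divide_eq mult_ac)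
    then show "2 * (A * \<kappa> t) < \<epsilon>" "2 * (A * \<kappa> t) < \<epsilon>'" using \<epsilon>(1) \<epsilon>'(1) by (simp_all add: min_def split: if_splits)
  qed
  have \<kappa>_cont: "continuous_on S \<kappa>" for S unfolding \<kappa>_def by (intro continuous_intros)
  define g where "g = (\<lambda>t. - (\<kappa> t *\<^sub>R a t))"
  have g_meas: "g \<in> borel_measurable (lebesgue_on {0..T})"
  proof -
    have "\<kappa> \<in> borel_measurable (lebesgue_on {0..T})"
      by (intro continuous_imp_measurable_on_sets_lebesgue \<kappa>_cont) auto
    then show ?thesis unfolding g_def using a_meas by measurable
  qed
  have g_bnd: "norm (g t) \<le> A * k * exp (K * t)" if t: "t \<in> {0..T}" for t
    using mult_right_mono[OF a_bnd[OF t] less_imp_le[OF \<kappa>_bnd(1)[OF t]]] \<kappa>_bnd(1)[OF t]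
    by (simp add: g_def \<kappa>_def mult_ac)
  have g_int: "g integrable_on {0..t}" if "t \<in> {0..T}" for t
  proof (rule bounded_measurable_integrable[OF g_meas, of A])
    fix s assume s: "s \<in> {0..T}"
    have "A * \<kappa> s \<le> A * 1" using \<kappa>_bnd(2)[OF s] A by (intro mult_left_mono) auto
    then show "norm (g s) \<le> A" using g_bnd[OF s] by (simp add: \<kappa>_def mult_ac)
  qed (use that in auto)
  define w where "w = (\<lambda>t. integral {0..t} g)"
  have w_int: "(g has_integral (w t - w 0)) {0..t}" if "t \<in> {0..T}" for t
    using g_int[OF that] by (simp add: w_def integrable_integral)
  have w_cont: "continuous_on {0..T} w" by (rule continuous_on_indefinite_integral[OF w_int])
  have w_bnd: "norm (w t) \<le> A * k * exp (K * t) / K" if t: "t \<in> {0..T}" for t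
    unfolding w_def by (rule norm_integral_exp_bound[OF g_int[OF t]]) (use t K0 A k g_bnd in auto)
  define z where "z = (\<lambda>t. integral {0..t} w)"
  have z_int: "(w has_integral (z t - z 0)) {0..t}" if "t \<in> {0..T}" for t
  proof -
    have "w integrable_on {0..t}" using that by (intro integrable_continuous_real continuous_on_subset[OF w_cont]) auto
    then show ?thesis by (simp add: z_def integrable_integral)
  qed
  have z_cont: "continuous_on {0..T} z" by (rule continuous_on_indefinite_integral[OF z_int])
  have z_bnd: "norm (z t) \<le> A * \<kappa> t / K\<^sup>2" if t: "t \<in> {0..T}" for t
  proof -
    have "norm (z t) \<le> A * k / K * exp (K * t) / K"
      unfolding z_def
    proof (rule norm_integral_exp_bound)
      show "w integrable_on {0..t}" using z_int[OF t] by blast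
      fix s assume "s \<in> {0..t}"
      then show "norm (w s) \<le> A * k / K * exp (K * s)" using w_bnd[of s] t by simp
    qed (use t K0 A k in auto)
    then show ?thesis by (simp add: \<kappa>_def power2_eq_square)
  qed
  have small: "norm (z t) \<le> A * \<kappa> t" "norm (w t) \<le> A * \<kappa> t" if t: "t \<in> {0..T}" for t
  proof -
    have nn: "0 \<le> A * \<kappa> t" using A \<kappa>_bnd(1)[OF t] by simp
    have "A * \<kappa> t / K\<^sup>2 \<le> A * \<kappa> t / 1" using nn KK K1 by (intro divide_left_mono) auto
    then show "norm (z t) \<le> A * \<kappa> t" using z_bnd[OF t] by simp
    have "A * \<kappa> t / K \<le> A * \<kappa> t / 1" using nn K1 by (intro divide_left_mono) auto
    then show "norm (w t) \<le> A * \<kappa> t" using w_bnd[OF t] by (simp add: \<kappa>_def mult.assoc)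
  qed
  have dist: "dist (r t, v t) (r t + z t, v t + w t) \<le> 2 * (A * \<kappa> t)" if t: "t \<in> {0..T}" for t
  proof -
    have "dist (r t, v t) (r t + z t, v t + w t) = norm (z t, w t)"
      by (subst dist_commute) (simp add: dist_norm)
    also have "\<dots> \<le> norm (z t) + norm (w t)" by (rule norm_Pair_le)
    finally show ?thesis using small[OF t] by linarith
  qed
  have adm': "(r t + z t, v t + w t) \<in> admissible_region \<mu> r\<^sub>c" if t: "t \<in> {0..T}" for t
  proof -
    have "(r t + z t, v t + w t) \<in> ball (r t, v t) \<epsilon>" using dist[OF t] \<kappa>_bnd(3)[OF t] by simp
    then show ?thesis using \<epsilon>(2) t by blast
  qed
  define D where "D = (\<lambda>t. gravity \<mu> (r t + z t) - gravity \<mu> (r t))"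
  have D_bnd: "norm (D t) \<le> L * A * \<kappa> t / K\<^sup>2" if t: "t \<in> {0..T}" for t
  proof -
    have "norm (D t) \<le> L * norm (r t + z t - r t)"
      unfolding L_def D_def using adm[OF t] adm'[OF t] pos
      by (intro gravity_lipschitz) (auto simp: admissible_region_def)
    also have "\<dots> = L * norm (z t)" by simp
    also have "\<dots> \<le> L * (A * \<kappa> t / K\<^sup>2)" by (rule mult_left_mono[OF z_bnd[OF t]]) (use L in simp)
    finally show ?thesis by (simp add: mult.assoc)
  qed
  \<comment> \<open>The acceleration that the engine must supply along the displaced path.\<close>
  define b where "b = (\<lambda>t. a t + g t + D t)"
  have b_meas: "b \<in> borel_measurable (lebesgue_on {0..T})"
  proof -
    have "D \<in> borel_measurable (lebesgue_on {0..T})"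
      unfolding D_def
      by (intro continuous_imp_measurable_on_sets_lebesgue continuous_intros r_cont z_cont)
         (use adm adm' in \<open>auto simp: admissible_region_def periodic_region_def\<close>)
    then show ?thesis unfolding b_def using a_meas g_meas by measurable
  qed
  have LA: "L * A * \<kappa> t / K\<^sup>2 \<le> A * \<kappa> t" if t: "t \<in> {0..T}" for t
  proof -
    have "L * (A * \<kappa> t) \<le> K\<^sup>2 * (A * \<kappa> t)"
      using KL KK A \<kappa>_bnd(1)[OF t] by (intro mult_right_mono) auto
    then show ?thesis using K0 by (simp add: pos_divide_le_eq mult_ac)
  qed
  have b_le: "norm (b t) \<le> (1 - \<kappa> t) * norm (a t) + L * A * \<kappa> t / K\<^sup>2" if t: "t \<in> {0..T}" for t
  proof -
    have "b t = (1 - \<kappa> t) *\<^sub>R a t + D t" by (simp add: b_def g_def algebra_simps)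
    then have "norm (b t) \<le> norm ((1 - \<kappa> t) *\<^sub>R a t) + norm (D t)" by (simp only: norm_triangle_ineq)
    also have "norm ((1 - \<kappa> t) *\<^sub>R a t) = (1 - \<kappa> t) * norm (a t)" using \<kappa>_bnd(2)[OF t] by simp
    finally show ?thesis using D_bnd[OF t] by linarith
  qed
  have b_bnd: "norm (b t) \<le> 2 * A" if t: "t \<in> {0..T}" for t
  proof -
    have "(1 - \<kappa> t) * norm (a t) \<le> 1 * A" using \<kappa>_bnd[OF t] a_bnd[OF t] A by (intro mult_mono) auto
    moreover have "A * \<kappa> t \<le> A * 1" using \<kappa>_bnd(2)[OF t] A by (intro mult_left_mono) auto
    ultimately show ?thesis using b_le[OF t] LA[OF t] by linarith
  qed
  define \<Psi> where "\<Psi> = (\<lambda>t. integral {0..t} (\<lambda>s. norm (b s)))"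
  have \<Phi>\<Psi>: "\<Phi> t \<le> \<Psi> t + 2 * A * \<kappa> t / K" if t: "t \<in> {0..T}" for t
  proof -
    have na: "(\<lambda>s. norm (a s)) integrable_on {0..t}"
      by (rule bounded_measurable_integrable[of _ T A]) (use a_meas a_bnd t in auto)
    have nb: "(\<lambda>s. norm (b s)) integrable_on {0..t}"
      by (rule bounded_measurable_integrable[of _ T "2 * A"]) (use b_meas b_bnd t in auto)
    have "norm (integral {0..t} (\<lambda>s. norm (a s) - norm (b s))) \<le> 2 * A * k * exp (K * t) / K"
    proof (rule norm_integral_exp_bound[OF integrable_diff[OF na nb]])
      fix s assume "s \<in> {0..t}"
      then have s: "s \<in> {0..T}" using t by auto
      have "norm (norm (a s) - norm (b s)) \<le> norm (a s - b s)" using norm_triangle_ineq3 by simp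
      also have "a s - b s = - (g s + D s)" by (simp add: b_def)
      also have "norm \<dots> = norm (g s + D s)" by (rule norm_minus_cancel)
      also have "\<dots> \<le> A * \<kappa> s + A * \<kappa> s"
      proof (intro order_trans[OF norm_triangle_ineq] add_mono)
        show "norm (g s) \<le> A * \<kappa> s" using g_bnd[OF s] by (simp add: \<kappa>_def mult.assoc)
        show "norm (D s) \<le> A * \<kappa> s" using D_bnd[OF s] LA[OF s] by linarith
      qed
      also have "\<dots> = 2 * A * k * exp (K * s)" by (simp add: \<kappa>_def)
      finally show "norm (norm (a s) - norm (b s)) \<le> 2 * A * k * exp (K * s)" .
    qed (use t K0 A k in auto)
    then have "\<Phi> t - \<Psi> t \<le> 2 * A * k * exp (K * t) / K"
      unfolding \<Phi>_def \<Psi>_def Henstock_Kurzweil_Integration.integral_diff[OF na nb] real_norm_def by linarith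
    moreover have "2 * A * \<kappa> t / K = 2 * A * k * exp (K * t) / K" by (simp add: \<kappa>_def mult.assoc)
    ultimately show ?thesis by linarith
  qed
  define \<tau>' where "\<tau>' = \<tau> * (1 - k / 2)"
  have k1: "k \<le> 1" using \<kappa>_le(1)[of 0] \<kappa>_bnd(2)[of 0] T by auto
  have thrust: "m\<^sub>0 * exp (- (\<beta> * \<Psi> t)) * norm (b t) \<le> \<tau>'" if t: "t \<in> {0..T}" for t
  proof -
    define y where "y = \<kappa> t / 4"
    have y: "0 < y" "y \<le> 1 / 4" using \<kappa>_bnd(1,2)[OF t] by (auto simp: y_def)
    have "\<beta> * (2 * A * \<kappa> t / K) \<le> y"
    proof -
      have "8 * \<beta> * A * \<kappa> t \<le> K * \<kappa> t" using K8 \<kappa>_bnd(1)[OF t] by (intro mult_right_mono) auto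
      then show ?thesis using K0 by (simp add: y_def field_simps)
    qed
    moreover have "\<beta> * \<Phi> t \<le> \<beta> * (\<Psi> t + 2 * A * \<kappa> t / K)" using \<Phi>\<Psi>[OF t] pos by (intro mult_left_mono) auto
    ultimately have "- (\<beta> * \<Psi> t) \<le> - (\<beta> * \<Phi> t) + y" by (simp add: distrib_left)
    then have "m\<^sub>0 * exp (- (\<beta> * \<Psi> t)) \<le> m\<^sub>0 * exp (- (\<beta> * \<Phi> t) + y)" using pos by simp
    also have "\<dots> = m t * exp y" by (simp only: m_eq[OF t] exp_add mult.assoc)
    finally have mm: "m\<^sub>0 * exp (- (\<beta> * \<Psi> t)) \<le> m t * exp y" .
    have m_le: "m t \<le> m\<^sub>0"
    proof -
      have "0 \<le> \<Phi> t" unfolding \<Phi>_def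
        by (intro integral_nonneg bounded_measurable_integrable[of _ T A]) (use a_meas a_bnd t in auto)
      then have "m\<^sub>0 * exp (- (\<beta> * \<Phi> t)) \<le> m\<^sub>0 * 1" using pos by (intro mult_left_mono) auto
      then show ?thesis using m_eq[OF t] by simp
    qed
    have "m t * norm (b t) \<le> m t * ((1 - \<kappa> t) * norm (a t) + L * A * \<kappa> t / K\<^sup>2)"
      using b_le[OF t] m_pos[OF t] by (intro mult_left_mono) auto
    also have "\<dots> = (1 - \<kappa> t) * norm (u t) + m t * (L * A * \<kappa> t / K\<^sup>2)"
      by (simp add: ma[OF t, symmetric] algebra_simps)
    also have "\<dots> \<le> (1 - \<kappa> t) * \<tau> + \<tau> * y"
    proof (rule add_mono)
      show "(1 - \<kappa> t) * norm (u t) \<le> (1 - \<kappa> t) * \<tau>" using \<kappa>_bnd(2)[OF t] u_bnd[OF t] by (intro mult_left_mono) auto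
      have "m t * (L * A * \<kappa> t / K\<^sup>2) \<le> m\<^sub>0 * (L * A * \<kappa> t / K)"
        using m_le m_pos[OF t] L A K0 KK \<kappa>_bnd(1)[OF t] by (intro mult_mono divide_left_mono) auto
      also have "\<dots> \<le> \<tau> * y"
      proof -
        have "4 * m\<^sub>0 * L * A \<le> K * \<tau>" using K4 pos by (simp add: pos_divide_le_eq)
        then have "4 * m\<^sub>0 * L * A * \<kappa> t \<le> K * \<tau> * \<kappa> t" using \<kappa>_bnd(1)[OF t] by (intro mult_right_mono) auto
        then show ?thesis using K0 by (simp add: y_def field_simps)
      qed
      finally show "m t * (L * A * \<kappa> t / K\<^sup>2) \<le> \<tau> * y" .
    qed
    also have "\<dots> = \<tau> * (1 - 3 * y)" by (simp add: y_def algebra_simps)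
    finally have mb: "m t * norm (b t) \<le> \<tau> * (1 - 3 * y)" .
    have "m\<^sub>0 * exp (- (\<beta> * \<Psi> t)) * norm (b t) \<le> m t * exp y * norm (b t)"
      using mm by (intro mult_right_mono) auto
    also have "\<dots> = (m t * norm (b t)) * exp y" by simp
    also have "\<dots> \<le> \<tau> * (1 - 3 * y) * exp y" using mb by (intro mult_right_mono) auto
    \<comment> \<open>The factor \<open>1 - y \<le> exp (- y)\<close> absorbs the change of mass and leaves a reduction by \<open>2 * y\<close>.\<close>
    also have "\<dots> \<le> \<tau> * ((1 - 2 * y) * (1 - y)) * exp y"
      using pos y by (intro mult_right_mono mult_left_mono) (auto simp: algebra_simps)
    also have "\<dots> \<le> \<tau> * ((1 - 2 * y) * exp (- y)) * exp y"
      using pos y exp_ge_add_one_self[of "- y"] by (intro mult_right_mono mult_left_mono) auto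
    also have "\<dots> = \<tau> * (1 - 2 * y)" by (simp add: mult.assoc flip: exp_add)
    also have "\<dots> \<le> \<tau>'" unfolding \<tau>'_def y_def using \<kappa>_le(1)[OF t] pos by (intro mult_left_mono) auto
    finally show ?thesis .
  qed
  have "\<exists>m'. 0 < m' \<and> m' \<le> m\<^sub>0 \<and> steers \<mu> \<beta> r\<^sub>c \<tau>' ((r 0 + z 0, v 0 + w 0), m\<^sub>0) ((r T + z T, v T + w T), m')"
  proof (rule steers_along_path[OF pos(1-3,5) T b_meas b_bnd])
    fix t assume t: "t \<in> {0..T}"
    show "((\<lambda>t. v t + w t) has_integral (r t + z t - (r 0 + z 0))) {0..t}"
      using has_integral_add[OF r_int[OF t] z_int[OF t]] by (simp add: algebra_simps)
    have "((\<lambda>s. ((1 / m s) *\<^sub>R u s - gravity \<mu> (r s)) + g s) has_integral (v t - v 0 + (w t - w 0))) {0..t}"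
      by (intro has_integral_add v_int w_int t)
    moreover have "((1 / m s) *\<^sub>R u s - gravity \<mu> (r s)) + g s = b s - gravity \<mu> (r s + z s)" for s
      by (simp add: b_def D_def a_def)
    moreover have "v t - v 0 + (w t - w 0) = v t + w t - (v 0 + w 0)" by simp
    ultimately show "((\<lambda>s. b s - gravity \<mu> (r s + z s)) has_integral (v t + w t - (v 0 + w 0))) {0..t}"
      by simp
    show "(r t + z t, v t + w t) \<in> admissible_region \<mu> r\<^sub>c" by (rule adm'[OF t])
    show "m\<^sub>0 * exp (- (\<beta> * integral {0..t} (\<lambda>s. norm (b s)))) * norm (b t) \<le> \<tau>'"
      using thrust[OF t] by (simp add: \<Psi>_def)
  qed
  then obtain m' where m': "0 < m'" "steers \<mu> \<beta> r\<^sub>c \<tau>' ((r 0 + z 0, v 0 + w 0), m\<^sub>0) ((r T + z T, v T + w T), m')"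
    by blast
  have start: "(r 0 + z 0, v 0 + w 0) = x" using ends by (simp add: z_def w_def)
  have target: "(r T + z T, v T + w T) \<in> P_plus \<mu> r\<^sub>c"
  proof -
    have "(r T + z T, v T + w T) \<in> ball x\<^sub>f \<epsilon>'" using dist[of T] \<kappa>_bnd(4)[of T] T ends(3) by simp
    then show ?thesis using \<epsilon>'(2) by blast
  qed
  have "0 < \<tau>'" "\<tau>' < \<tau>" using pos k k1 by (auto simp: \<tau>'_def)
  then show thesis using target m'(1) m'(2)[unfolded start] by (rule that)
qed

section \<open>Failure for small thrust\<close>

text \<open>The inequality of Gronwall compares the powered with the unpowered motion. The mass cannot fall below
half of its initial value within the time \<open>S\<close>, so a small thrust means a small acceleration.\<close>
lemma small_thrust_stays_near_drift:
  assumes pos: "\<mu> > 0" "\<beta> > 0" "r\<^sub>c > 0" "m\<^sub>0 > 0" "S \<ge> 0" "\<eta> > 0" "c > 0" "c \<le> r\<^sub>c"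
    and km: "kepler_motion \<mu> q p" and q: "\<And>t. norm (q t) \<ge> c"
  obtains \<tau>\<^sub>0 where "\<tau>\<^sub>0 > 0"
    "\<And>\<tau> T u r v m t. \<lbrakk>0 < \<tau>; \<tau> \<le> \<tau>\<^sub>0; T \<ge> 0; control \<tau> T u;
       admissible_trajectory \<mu> \<beta> r\<^sub>c T u (\<lambda>t. (r t, v t)) m; r 0 = q 0; v 0 = p 0; m 0 = m\<^sub>0;
       0 \<le> t; t \<le> T; t \<le> S\<rbrakk> \<Longrightarrow> norm (r t - q t) + norm (v t - p t) < \<eta>"
proof -
  define L where "L = 4 * \<mu> / c ^ 3"
  have L: "L > 0" using pos by (simp add: L_def)
  define F where "F = 2 * (S + 1) / m\<^sub>0 * exp ((1 + L) * S)"
  have F: "F > 0" using pos by (simp add: F_def)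
  \<comment> \<open>The first bound keeps half of the mass, the second one makes the final estimate smaller than \<open>\<eta>\<close>.\<close>
  define \<tau>\<^sub>0 where "\<tau>\<^sub>0 = min (m\<^sub>0 / (2 * \<beta> * (S + 1))) (\<eta> / (2 * F))"
  have \<tau>\<^sub>0: "\<tau>\<^sub>0 > 0" using pos F by (simp add: \<tau>\<^sub>0_def)
  have half: "\<beta> * \<tau>\<^sub>0 * (S + 1) \<le> m\<^sub>0 / 2"
  proof -
    have "\<tau>\<^sub>0 \<le> m\<^sub>0 / (2 * \<beta> * (S + 1))" by (simp add: \<tau>\<^sub>0_def)
    then have "\<tau>\<^sub>0 * (2 * \<beta> * (S + 1)) \<le> m\<^sub>0" using pos by (simp add: pos_le_divide_eq)
    then show ?thesis by (simp add: algebra_simps)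
  qed
  have F\<tau>: "\<tau>\<^sub>0 * F < \<eta>"
  proof -
    have "\<tau>\<^sub>0 \<le> \<eta> / (2 * F)" by (simp add: \<tau>\<^sub>0_def)
    then have "\<tau>\<^sub>0 * (2 * F) \<le> \<eta>" using F by (simp add: pos_le_divide_eq)
    then show ?thesis using mult_pos_pos[OF \<tau>\<^sub>0 F] by simp
  qed
  show thesis
  proof (rule that[OF \<tau>\<^sub>0])
    fix \<tau> T u r v m t\<^sub>1
    assume \<tau>: "0 < \<tau>" "\<tau> \<le> \<tau>\<^sub>0" and T: "T \<ge> 0" and u: "control \<tau> T u"
      and traj: "admissible_trajectory \<mu> \<beta> r\<^sub>c T u (\<lambda>t. (r t, v t)) m"
      and init: "r 0 = q 0" "v 0 = p 0" "m 0 = m\<^sub>0" and t1: "0 \<le> t\<^sub>1" "t\<^sub>1 \<le> T" "t\<^sub>1 \<le> S"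
    note comps = admissible_trajectory_components[OF pos(1-3) T u traj]
    have u_bnd: "norm (u t) \<le> \<tau>" if "t \<in> {0..T}" for t using u that by (auto simp: control_def)
    have T1: "t \<in> {0..T}" if "t \<in> {0..t\<^sub>1}" for t using that t1 by auto
    have m_ge: "m t \<ge> m\<^sub>0 / 2" if t: "t \<in> {0..t\<^sub>1}" for t
    proof -
      have "norm (m t - m 0) \<le> (\<beta> * \<tau>) * (t - 0)"
        unfolding integral_unique[OF comps(4)[OF T1[OF t]], symmetric]
        using comps(4)[OF T1[OF t]] t u_bnd pos T1
        by (intro integral_bound_interval) (auto simp: abs_mult)
      also have "\<dots> \<le> \<beta> * \<tau>\<^sub>0 * (S + 1)"
        using t t1 \<tau> pos by (intro mult_mono) auto
      finally have "\<bar>m t - m 0\<bar> \<le> m\<^sub>0 / 2" using half by simp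
      then show ?thesis using init(3) unfolding abs_le_iff by linarith
    qed
    define \<phi> where "\<phi> = (\<lambda>t. norm (r t - q t) + norm (v t - p t))"
    have qp: "(q has_vector_derivative p t) (at t)" "(p has_vector_derivative - gravity \<mu> (q t)) (at t)" for t
      using km unfolding kepler_motion_def by blast+
    have q_int: "(p has_integral (q t - q 0)) {0..t}" if "t \<ge> 0" for t
      by (rule fundamental_theorem_of_calculus[OF that has_vector_derivative_at_within[OF qp(1)]])
    have p_int: "((\<lambda>s. - gravity \<mu> (q s)) has_integral (p t - p 0)) {0..t}" if "t \<ge> 0" for t
      by (rule fundamental_theorem_of_calculus[OF that has_vector_derivative_at_within[OF qp(2)]])
    have "continuous_on {0..t\<^sub>1} r"
      by (rule continuous_on_indefinite_integral[OF comps(2)[OF T1]])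
    then have rq_cont: "continuous_on {0..t\<^sub>1} (\<lambda>s. norm (r s - q s))"
      by (intro continuous_on_norm continuous_on_diff kepler_motion_continuous(1)[OF km])
    have "continuous_on {0..t\<^sub>1} v"
      by (rule continuous_on_indefinite_integral[OF comps(3)[OF T1]])
    then have vp_cont: "continuous_on {0..t\<^sub>1} (\<lambda>s. norm (v s - p s))"
      by (intro continuous_on_norm continuous_on_diff kepler_motion_continuous(2)[OF km])
    have cont: "continuous_on {0..t\<^sub>1} \<phi>"
      unfolding \<phi>_def by (rule continuous_on_add[OF rq_cont vp_cont])
    have "\<phi> t\<^sub>1 \<le> (\<tau> * (2 * (S + 1) / m\<^sub>0)) * exp ((1 + L) * t\<^sub>1)"
    proof (rule gronwall[OF cont])
      fix t assume t: "t \<in> {0..t\<^sub>1}"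
      have dr: "((\<lambda>s. v s - p s) has_integral (r t - q t)) {0..t}"
        using has_integral_diff[OF comps(2)[OF T1[OF t]] q_int[of t]] t init by simp
      have dv: "((\<lambda>s. (1 / m s) *\<^sub>R u s - gravity \<mu> (r s) - - gravity \<mu> (q s)) has_integral (v t - p t)) {0..t}"
        using has_integral_diff[OF comps(3)[OF T1[OF t]] p_int[of t]] t init by simp
      have \<phi>_int: "\<phi> integrable_on {0..t}"
        using t by (intro integrable_continuous_real continuous_on_subset[OF cont]) auto
      have vp_int: "(\<lambda>s. norm (v s - p s)) integrable_on {0..t}"
        and rq_int: "(\<lambda>s. norm (r s - q s)) integrable_on {0..t}"
        using t by (intro integrable_continuous_real continuous_on_subset[OF vp_cont]
            continuous_on_subset[OF rq_cont]; auto)+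
      have R: "norm (r t - q t) \<le> integral {0..t} (\<lambda>s. norm (v s - p s))"
        unfolding integral_unique[OF dr, symmetric]
        by (rule integral_norm_bound_integral[OF has_integral_integrable[OF dr] vp_int order_refl])
      have V: "norm (v t - p t) \<le> integral {0..t} (\<lambda>s. 2 * \<tau> / m\<^sub>0 + L * norm (r s - q s))"
        unfolding integral_unique[OF dv, symmetric]
      proof (rule integral_norm_bound_integral[OF has_integral_integrable[OF dv]])
        show "(\<lambda>s. 2 * \<tau> / m\<^sub>0 + L * norm (r s - q s)) integrable_on {0..t}"
          by (intro integrable_add integrable_on_mult_right rq_int) auto
        fix s assume s: "s \<in> {0..t}"
        then have s1: "s \<in> {0..t\<^sub>1}" using t by auto
        have "norm ((1 / m s) *\<^sub>R u s) = norm (u s) / m s" using m_ge[OF s1] pos by simp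
        also have "\<dots> \<le> \<tau> / (m\<^sub>0 / 2)"
          using m_ge[OF s1] u_bnd[OF T1[OF s1]] pos \<tau> by (intro frac_le) auto
        finally have 1: "norm ((1 / m s) *\<^sub>R u s) \<le> 2 * \<tau> / m\<^sub>0" by (simp add: mult.commute)
        have "norm (r s) \<ge> c" using comps(1)[OF T1[OF s1]] pos by (simp add: admissible_region_def)
        then have 2: "norm (gravity \<mu> (r s) - gravity \<mu> (q s)) \<le> L * norm (r s - q s)"
          unfolding L_def by (intro gravity_lipschitz pos q)
        have eq: "(1 / m s) *\<^sub>R u s - gravity \<mu> (r s) - - gravity \<mu> (q s) = (1 / m s) *\<^sub>R u s - (gravity \<mu> (r s) - gravity \<mu> (q s))"
          by simp
        show "norm ((1 / m s) *\<^sub>R u s - gravity \<mu> (r s) - - gravity \<mu> (q s)) \<le> 2 * \<tau> / m\<^sub>0 + L * norm (r s - q s)"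
          unfolding eq using norm_triangle_ineq4[of "(1 / m s) *\<^sub>R u s" "gravity \<mu> (r s) - gravity \<mu> (q s)"] 1 2
          by linarith
      qed
      have split: "integral {0..t} (\<lambda>s. 2 * \<tau> / m\<^sub>0 + L * norm (r s - q s)) =
          2 * \<tau> / m\<^sub>0 * t + L * integral {0..t} (\<lambda>s. norm (r s - q s))"
        using t by (subst integral_add[OF integrable_const_ivl integrable_on_mult_right[OF rq_int]]) simp
      have vp_le: "integral {0..t} (\<lambda>s. norm (v s - p s)) \<le> integral {0..t} \<phi>"
        by (rule integral_le[OF vp_int \<phi>_int]) (simp add: \<phi>_def)
      have rq_le: "integral {0..t} (\<lambda>s. norm (r s - q s)) \<le> integral {0..t} \<phi>"
        by (rule integral_le[OF rq_int \<phi>_int]) (simp add: \<phi>_def)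
      have "2 * \<tau> / m\<^sub>0 * t \<le> 2 * \<tau> / m\<^sub>0 * (S + 1)"
        using t t1 \<tau> pos by (intro mult_left_mono) auto
      moreover have "\<tau> * (2 * (S + 1) / m\<^sub>0) = 2 * \<tau> / m\<^sub>0 * (S + 1)" by simp
      moreover have "L * integral {0..t} (\<lambda>s. norm (r s - q s)) \<le> L * integral {0..t} \<phi>"
        using rq_le L by (intro mult_left_mono) auto
      moreover have "(1 + L) * integral {0..t} \<phi> = integral {0..t} \<phi> + L * integral {0..t} \<phi>"
        by (simp add: algebra_simps)
      ultimately show "\<phi> t \<le> \<tau> * (2 * (S + 1) / m\<^sub>0) + (1 + L) * integral {0..t} \<phi>"
        using R V split vp_le fun_cong[OF \<phi>_def, of t] by linarith
    qed (use L t1 in auto)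
    also have "\<dots> \<le> (\<tau>\<^sub>0 * (2 * (S + 1) / m\<^sub>0)) * exp ((1 + L) * S)"
      using \<tau> pos t1 L by (intro mult_mono mult_right_mono) auto
    also have "\<dots> = \<tau>\<^sub>0 * F" by (simp add: F_def)
    finally show "norm (r t\<^sub>1 - q t\<^sub>1) + norm (v t\<^sub>1 - p t\<^sub>1) < \<eta>" using F\<tau> by (simp add: \<phi>_def)
  qed
qed

text \<open>The unpowered motion \<open>(q, p)\<close> from a point of \<open>P_minus\<close> reaches its perigee, at a distance
\<open>c < r\<^sub>c\<close>, at some time \<open>S\<close>. A nearby trajectory that ends no later than \<open>S\<close> ends at a state with perigee
below \<open>r\<^sub>c\<close>, outside \<open>P_plus\<close>; one that lasts longer comes too close to the
center of attraction at time \<open>S\<close> to be admissible.\<close>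
lemma small_thrust_misses_P_plus:
  assumes pos: "\<mu> > 0" "\<beta> > 0" "r\<^sub>c > 0" "m > 0" and x: "x \<in> P_minus \<mu> r\<^sub>c"
  obtains \<tau>\<^sub>0 where "\<tau>\<^sub>0 > 0"
    "\<And>\<tau> y m'. \<lbrakk>0 < \<tau>; \<tau> \<le> \<tau>\<^sub>0; y \<in> P_plus \<mu> r\<^sub>c\<rbrakk> \<Longrightarrow> \<not> steers \<mu> \<beta> r\<^sub>c \<tau> (x, m) (y, m')"
proof -
  have per: "x \<in> periodic_region \<mu>" and low: "perigee \<mu> x < r\<^sub>c" using x by (auto simp: P_minus_def)
  obtain q p S where km: "kepler_motion \<mu> q p" and x0: "(q 0, p 0) = x"
    and S: "S \<ge> 0" "q S \<bullet> p S = 0" "norm (q S) * (norm (p S))\<^sup>2 \<ge> \<mu>"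
    using kepler_motion_exists[OF pos(1) per] by metis
  have qnz: "q t \<noteq> 0" for t using km unfolding kepler_motion_def by blast
  have per_t: "(q t, p t) \<in> periodic_region \<mu>" for t using kepler_motion_stays(1)[OF km] per x0 by simp
  have perigee_t: "perigee \<mu> (q t, p t) = perigee \<mu> x" for t
    using kepler_motion_invariants(3)[OF km] x0 by simp
  define c where "c = perigee \<mu> x"
  have qS: "norm (q S) = c"
    using perigee_at_apsis[OF pos(1) qnz S(2,3)] perigee_t[of S] by (simp add: c_def)
  have "norm (q S) > 0" using qnz[of S] by simp
  then have c: "c > 0" "c < r\<^sub>c" using low unfolding qS by (simp_all add: c_def)
  have q_ge: "norm (q t) \<ge> c" for t
    using perigee_le_norm[OF pos(1) qnz, of t "p t"] perigee_t[of t] by (simp add: c_def)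
  let ?U = "{z \<in> periodic_region \<mu>. perigee \<mu> z < r\<^sub>c}"
  have "continuous_on {0..S} (\<lambda>t. (q t, p t))"
    by (intro continuous_on_Pair kepler_motion_continuous[OF km])
  then have comp: "compact ((\<lambda>t. (q t, p t)) ` {0..S})" by (rule compact_continuous_image) auto
  have sub: "(\<lambda>t. (q t, p t)) ` {0..S} \<subseteq> ?U" using per_t perigee_t low by auto
  obtain \<epsilon> where \<epsilon>: "\<epsilon> > 0" "(\<Union>z\<in>(\<lambda>t. (q t, p t)) ` {0..S}. ball z \<epsilon>) \<subseteq> ?U"
    by (rule compact_subset_open_imp_ball_epsilon_subset[OF comp open_perigee_lt[OF pos(1)] sub])
  define \<eta> where "\<eta> = min \<epsilon> (r\<^sub>c - c)"
  have \<eta>: "\<eta> > 0" "\<eta> \<le> \<epsilon>" "\<eta> \<le> r\<^sub>c - c" using \<epsilon> c by (auto simp: \<eta>_def)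
  obtain \<tau>\<^sub>0 where \<tau>\<^sub>0: "\<tau>\<^sub>0 > 0"
    and near: "\<And>\<tau> T u r v n t. \<lbrakk>0 < \<tau>; \<tau> \<le> \<tau>\<^sub>0; T \<ge> 0; control \<tau> T u;
       admissible_trajectory \<mu> \<beta> r\<^sub>c T u (\<lambda>t. (r t, v t)) n; r 0 = q 0; v 0 = p 0; n 0 = m;
       0 \<le> t; t \<le> T; t \<le> S\<rbrakk> \<Longrightarrow> norm (r t - q t) + norm (v t - p t) < \<eta>"
    using small_thrust_stays_near_drift[OF pos(1-4) S(1) \<eta>(1) c(1) less_imp_le[OF c(2)] km q_ge] by blast
  show thesis
  proof (rule that[OF \<tau>\<^sub>0], rule notI)
    fix \<tau> y m' assume \<tau>: "0 < \<tau>" "\<tau> \<le> \<tau>\<^sub>0" and y: "y \<in> P_plus \<mu> r\<^sub>c"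
      and st: "steers \<mu> \<beta> r\<^sub>c \<tau> (x, m) (y, m')"
    obtain T u r v n where T: "T \<ge> 0" and u: "control \<tau> T u"
      and traj: "admissible_trajectory \<mu> \<beta> r\<^sub>c T u (\<lambda>t. (r t, v t)) n"
      and ends: "(r 0, v 0) = x" "n 0 = m" "(r T, v T) = y"
      by (rule steers_components[OF st])
    have init: "r 0 = q 0" "v 0 = p 0" using ends(1) x0 by auto
    show False
    proof (cases "T \<le> S")
      case True
      have "dist (q T, p T) (r T, v T) \<le> norm (r T - q T) + norm (v T - p T)"
        by (subst dist_commute) (simp add: dist_norm norm_Pair_le)
      also have "\<dots> < \<epsilon>" using near[OF \<tau> T u traj init ends(2) T order_refl True] \<eta>(2) by linarith
      finally have "y \<in> ball (q T, p T) \<epsilon>" using ends(3) by simp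
      moreover have "T \<in> {0..S}" using True T by simp
      ultimately have "y \<in> ?U" using \<epsilon>(2) by blast
      then show False using y by (auto simp: P_plus_def)
    next
      case False
      then have ST: "S \<le> T" by simp
      have "norm (r S) \<le> norm (q S) + norm (r S - q S)"
        using norm_triangle_ineq[of "q S" "r S - q S"] by simp
      also have "\<dots> < r\<^sub>c"
        using near[OF \<tau> T u traj init ends(2) S(1) ST order_refl] \<eta>(3) qS norm_ge_zero[of "v S - p S"] by linarith
      finally show False
        using admissible_trajectory_components(1)[OF pos(1-3) T u traj, of S] S(1) ST
        by (auto simp: admissible_region_def)
    qed
  qed
qed

section \<open>The limiting thrust\<close>

lemma OIP_controllable_if_reaches_P_plus:
  assumes pos: "\<mu> > 0" "\<beta> > 0" "r\<^sub>c > 0" "\<tau> > 0"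
    and y: "y \<in> P_plus \<mu> r\<^sub>c" "m' > 0" "steers \<mu> \<beta> r\<^sub>c \<tau> (x, m) (y, m')"
  shows "OIP_controllable \<mu> \<beta> r\<^sub>c \<tau> x m"
  unfolding OIP_controllable_iff_steers
proof
  fix z assume "z \<in> P_plus \<mu> r\<^sub>c"
  then obtain n where "steers \<mu> \<beta> r\<^sub>c \<tau> (y, m') (z, n)"
    using steers_within_P_plus[OF pos y(2,1)] by metis
  then show "\<exists>n. steers \<mu> \<beta> r\<^sub>c \<tau> (x, m) (z, n)"
    using steers_trans[OF pos(1-3) y(3)] by blast
qed

theorem corollary2:
  fixes \<mu> \<beta> r\<^sub>c m\<^sub>i :: real and x\<^sub>i :: phase
  assumes "r\<^sub>c > 0" and "\<beta> > 0" and "\<mu> > 0"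
    and "x\<^sub>i \<in> P_minus \<mu> r\<^sub>c" and "m\<^sub>i > 0"
  shows "\<exists>\<tau>\<^sub>m\<^sub>a\<^sub>x>0.
    (\<forall>\<tau>>\<tau>\<^sub>m\<^sub>a\<^sub>x. OIP_controllable \<mu> \<beta> r\<^sub>c \<tau> x\<^sub>i m\<^sub>i) \<and>
    (\<forall>\<tau>. 0 < \<tau> \<and> \<tau> \<le> \<tau>\<^sub>m\<^sub>a\<^sub>x \<longrightarrow> \<not> OIP_controllable \<mu> \<beta> r\<^sub>c \<tau> x\<^sub>i m\<^sub>i)"
proof -
  note pos = \<open>\<mu> > 0\<close> \<open>\<beta> > 0\<close> \<open>r\<^sub>c > 0\<close>
  define Z where "Z = {\<tau>. 0 < \<tau> \<and> OIP_controllable \<mu> \<beta> r\<^sub>c \<tau> x\<^sub>i m\<^sub>i}"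
  obtain x\<^sub>f where x\<^sub>f: "x\<^sub>f \<in> P_plus \<mu> r\<^sub>c" using P_plus_nonempty[OF pos(1,3)] by blast
  have "x\<^sub>i \<in> admissible_region \<mu> r\<^sub>c"
    using assms(4) by (auto simp: P_minus_def admissible_region_def)
  from steers_into_P_plus[OF pos \<open>m\<^sub>i > 0\<close> this] obtain \<tau>\<^sub>1 y m' where "\<tau>\<^sub>1 > 0" "y \<in> P_plus \<mu> r\<^sub>c" "m' > 0"
    "steers \<mu> \<beta> r\<^sub>c \<tau>\<^sub>1 (x\<^sub>i, m\<^sub>i) (y, m')" by metis
  then have "\<tau>\<^sub>1 \<in> Z" using OIP_controllable_if_reaches_P_plus[OF pos] unfolding Z_def by blast
  then have ne: "Z \<noteq> {}" by blast
  obtain \<tau>\<^sub>0 where \<tau>\<^sub>0: "\<tau>\<^sub>0 > 0" "\<And>\<tau> y m'. \<lbrakk>0 < \<tau>; \<tau> \<le> \<tau>\<^sub>0; y \<in> P_plus \<mu> r\<^sub>c\<rbrakk> \<Longrightarrow> \<not> steers \<mu> \<beta> r\<^sub>c \<tau> (x\<^sub>i, m\<^sub>i) (y, m')"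
    using small_thrust_misses_P_plus[OF pos \<open>m\<^sub>i > 0\<close> assms(4)] by blast
  have lower: "\<tau>\<^sub>0 \<le> \<tau>" if \<tau>: "\<tau> \<in> Z" for \<tau>
  proof (rule ccontr)
    assume "\<not> \<tau>\<^sub>0 \<le> \<tau>"
    then have "0 < \<tau>" "\<tau> \<le> \<tau>\<^sub>0" using \<tau> by (auto simp: Z_def)
    moreover obtain n where "steers \<mu> \<beta> r\<^sub>c \<tau> (x\<^sub>i, m\<^sub>i) (x\<^sub>f, n)"
      using \<tau> x\<^sub>f unfolding Z_def OIP_controllable_iff_steers by blast
    ultimately show False using \<tau>\<^sub>0(2) x\<^sub>f by blast
  qed
  have bdd: "bdd_below Z" using lower by (intro bdd_belowI) auto
  have "\<tau>\<^sub>0 \<le> Inf Z" using cInf_greatest[OF ne] lower by blast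
  then have Inf_pos: "Inf Z > 0" using \<tau>\<^sub>0(1) by linarith
  have above: "OIP_controllable \<mu> \<beta> r\<^sub>c \<tau> x\<^sub>i m\<^sub>i" if \<tau>: "\<tau> > Inf Z" for \<tau>
  proof -
    obtain \<tau>' where "\<tau>' \<in> Z" "\<tau>' < \<tau>" using \<tau> cInf_less_iff[OF ne bdd] by blast
    then show ?thesis
      unfolding Z_def OIP_controllable_iff_steers using steers_mono less_imp_le by blast
  qed
  have not_attained: "Inf Z \<notin> Z"
  proof
    assume Z: "Inf Z \<in> Z"
    then obtain n where st: "steers \<mu> \<beta> r\<^sub>c (Inf Z) (x\<^sub>i, m\<^sub>i) (x\<^sub>f, n)"
      using x\<^sub>f unfolding Z_def OIP_controllable_iff_steers by blast
    obtain \<tau>' y m' where "0 < \<tau>'" "\<tau>' < Inf Z" "y \<in> P_plus \<mu> r\<^sub>c" "m' > 0"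
      "steers \<mu> \<beta> r\<^sub>c \<tau>' (x\<^sub>i, m\<^sub>i) (y, m')"
      using steers_with_less_thrust[OF pos Inf_pos \<open>m\<^sub>i > 0\<close> x\<^sub>f st] by metis
    then have "\<tau>' \<in> Z" using OIP_controllable_if_reaches_P_plus[OF pos] unfolding Z_def by blast
    then show False using cInf_lower[OF _ bdd] \<open>\<tau>' < Inf Z\<close> by fastforce
  qed
  have below: "\<not> OIP_controllable \<mu> \<beta> r\<^sub>c \<tau> x\<^sub>i m\<^sub>i" if "0 < \<tau>" "\<tau> \<le> Inf Z" for \<tau>
  proof
    assume "OIP_controllable \<mu> \<beta> r\<^sub>c \<tau> x\<^sub>i m\<^sub>i"
    then have "\<tau> \<in> Z" using that by (simp add: Z_def)
    then have "\<tau> = Inf Z" using cInf_lower[OF _ bdd] that(2) by fastforce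
    then show False using not_attained \<open>\<tau> \<in> Z\<close> by simp
  qed
  show ?thesis using Inf_pos above below by blast
qed

end
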